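(* Let $G$ be a connected 4-regular graph. Let $v$ and $w$ be adjacent vertices of $G$ such that they do not share any common neighbours. Then \[ c_2^{(2)}(G - v) = c_2^{(2)}(G - w). \]
   Context: For a finite graph $H$ (multiple edges and self-loops allowed) attach a variable $\alpha_e$ to each edge $e$, and let $\Psi_H=\sum_{T}\prod_{e\notin T}\alpha_e$ be the Kirchhoff polynomial, the sum over all spanning trees $T$ of $H$. For a prime power $q$, $[\Psi_H]_q$ is the number of zeros of $\Psi_H$ in $\mathbb{F}_q^{|E(H)|}$; this is divisible by $q^2$ (for connected $H$ with at least three vertices, by a result of Schnetz), and $c_2^{(q)}(H)\in\mathbb{Z}/q\mathbb{Z}$ is the residue of $[\Psi_H]_q/q^2$ modulo $q$. $G-v$ is $G$ with vertex $v$ and its incident edges deleted. *)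

theory Defs
  imports "HOL-Library.FuncSet" "HOL-Library.Cardinality" "HOL-Library.Z2"
begin

text \<open>Finite undirected multigraphs. The endpoint set of a self-loop is a singleton, and distinct
  edges may have the same endpoint set.\<close>

record ('v, 'e) multigraph =
  vertices :: "'v set"
  edges :: "'e set"
  ends :: "'e \<Rightarrow> 'v set"

definition finite_multigraph :: "('v, 'e) multigraph \<Rightarrow> bool" where
  "finite_multigraph G \<longleftrightarrow>
     finite (vertices G) \<and> finite (edges G) \<and>
     (\<forall>e\<in>edges G. \<exists>x\<in>vertices G. \<exists>y\<in>vertices G. ends G e = {x, y})"

text \<open>A vertex carrying a self-loop is adjacent to itself.\<close>

definition adjacent :: "('v, 'e) multigraph \<Rightarrow> 'v \<Rightarrow> 'v \<Rightarrow> bool" where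
  "adjacent G x y \<longleftrightarrow> (\<exists>e\<in>edges G. ends G e = {x, y})"

text \<open>Self-loops contribute two to the degree: they are counted by both summands.\<close>

definition vertex_degree :: "('v, 'e) multigraph \<Rightarrow> 'v \<Rightarrow> nat" where
  "vertex_degree G x = card {e \<in> edges G. x \<in> ends G e} + card {e \<in> edges G. ends G e = {x}}"

definition regular_graph :: "nat \<Rightarrow> ('v, 'e) multigraph \<Rightarrow> bool" where
  "regular_graph k G \<longleftrightarrow> (\<forall>x\<in>vertices G. vertex_degree G x = k)"

definition connected_graph :: "('v, 'e) multigraph \<Rightarrow> bool" where
  "connected_graph G \<longleftrightarrow>
     vertices G \<noteq> {} \<and> (\<forall>x\<in>vertices G. \<forall>y\<in>vertices G. (adjacent G)\<^sup>*\<^sup>* x y)"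

text \<open>Cycles of length one are self-loops, cycles of length two are pairs of parallel edges.\<close>

definition is_cycle :: "('v, 'e) multigraph \<Rightarrow> 'v list \<Rightarrow> 'e list \<Rightarrow> bool" where
  "is_cycle G xs es \<longleftrightarrow>
     es \<noteq> [] \<and> length xs = length es \<and> distinct xs \<and> distinct es \<and>
     set xs \<subseteq> vertices G \<and> set es \<subseteq> edges G \<and>
     (\<forall>i<length es. ends G (es ! i) = {xs ! i, xs ! (Suc i mod length es)})"

definition is_tree :: "('v, 'e) multigraph \<Rightarrow> bool" where
  "is_tree G \<longleftrightarrow> connected_graph G \<and> (\<nexists>xs es. is_cycle G xs es)"

text \<open>Spanning trees are represented by their edge sets.\<close>

definition spanning_trees :: "('v, 'e) multigraph \<Rightarrow> 'e set set" where
  "spanning_trees G = {T. T \<subseteq> edges G \<and> is_tree (G\<lparr>edges := T\<rparr>)}"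

definition delete_vertex :: "('v, 'e) multigraph \<Rightarrow> 'v \<Rightarrow> ('v, 'e) multigraph" where
  "delete_vertex G v = G\<lparr>vertices := vertices G - {v}, edges := {e \<in> edges G. v \<notin> ends G e}\<rparr>"

text \<open>The Kirchhoff polynomial, given by its values at points \<open>\<alpha>\<close> of the affine space of edge
  variables.\<close>

definition kirchhoff :: "('v, 'e) multigraph \<Rightarrow> ('e \<Rightarrow> 'k::comm_ring_1) \<Rightarrow> 'k" where
  "kirchhoff G \<alpha> = (\<Sum>T\<in>spanning_trees G. \<Prod>e\<in>edges G - T. \<alpha> e)"

text \<open>The field with \<open>q\<close> elements is given as a finite field type \<open>'k\<close>, so that \<open>q\<close> is the cardinality
  of \<open>'k\<close>.\<close>

definition point_count :: "'k::{field, finite} itself \<Rightarrow> ('v, 'e) multigraph \<Rightarrow> nat" where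
  "point_count _ G = card {\<alpha> \<in> edges G \<rightarrow>\<^sub>E (UNIV :: 'k set). kirchhoff G \<alpha> = 0}"

text \<open>The element \<open>c\<^sub>2\<close> of the integers modulo \<open>q\<close>, represented by its residue in \<open>{0..<q}\<close>. The division
  is exact for connected graphs with at least three vertices; otherwise it may truncate.\<close>

definition c2 :: "'k::{field, finite} itself \<Rightarrow> ('v, 'e) multigraph \<Rightarrow> nat" where
  "c2 k G = (point_count k G div CARD('k) ^ 2) mod CARD('k)"

text \<open>The two-element field is the type \<open>bit\<close>.\<close>

instance bit :: finite
proof
  have "(UNIV :: bit set) = {0, 1}"
    by (auto intro: bit.exhaust)
  then show "finite (UNIV :: bit set)"
    by (metis finite.emptyI finite.insertI)
qed

end

theory Submission
  imports Defs "HOL-Library.Multiset"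
begin

text \<open>
  For a graph \<open>K\<close> let \<open>t(K)\<close> be the number of ordered partitions of its edges into two spanning trees.
  A forest with three components is completed to a spanning tree by equally many of the four triples
  and of the three perfect matchings on four given vertices. Hence, for a vertex \<open>x\<close> of a 4-regular
  graph \<open>G\<close>, the number \<open>t(G - v)\<close> is the sum of the \<open>t(G' - v)\<close> over the three graphs \<open>G'\<close> in which \<open>x\<close> is
  replaced by two edges pairing up its neighbours, and by induction \<open>t(G - v)\<close> is independent of \<open>v\<close>.

  Let \<open>H = G - {v, w}\<close> and let \<open>w\<close> have the neighbours \<open>a\<close>, \<open>b\<close>, \<open>c\<close> in \<open>G - v\<close>. With \<open>f0\<close> the Kirchhoff
  polynomial of \<open>H\<close> and \<open>f1\<close>, \<open>f2\<close>, \<open>f3\<close> the sums over the 2-forests isolating \<open>a\<close>, \<open>b\<close>, \<open>c\<close> from the other two,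
  the Kirchhoff polynomial of \<open>G - v\<close> is \<open>f0 (x1 x2 + x1 x3 + x2 x3) + (f2 + f3) x1 + (f1 + f3) x2 + (f1 + f2) x3 + f4\<close>.
  Over the field with two elements \<open>f0 = 0\<close> allows at most one nonzero \<open>fi\<close>, so modulo 8 the number of zeros is 4 times
  the number of points of \<open>H\<close> at which \<open>f0\<close> or \<open>f1 + f2 + f3\<close> is nonzero. By degree reasons the parity of the
  latter is that of \<open>\<Sum> f0\<close>, which depends on \<open>H\<close> only, plus the coefficient of the product of all variables
  in \<open>f0 (f1 + f2 + f3)\<close>, which is \<open>t(G - v) / 4\<close>. Multiple edges joining \<open>v\<close> and \<open>w\<close> are
  handled in the same way and only involve \<open>H\<close>.
\<close>

section \<open>Linear forms over the field with two elements\<close>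

text \<open>The modulus 8 comes from q = 2: the count is divided by 4 and only its parity is kept.

  The degrees fit because G is 4-regular. If one edge joins \<open>v\<close> and \<open>w\<close>,
  then H has 2n - 3 edges on n vertices, \<open>f0\<close> has degree n - 2 and each
  \<open>fi\<close> has degree n - 1, so a product \<open>f0 fi\<close> can just reach the product
  of all variables. The coefficient of that product counts the partitions of H into a spanning tree
  and a 2-forest that separates \<open>a\<close>, \<open>b\<close>, \<open>c\<close>. Each of these
  gives four partitions of G - v: two pairs of edges at \<open>w\<close> reconnect the forest, and
  the two trees are ordered. With two joining edges the degree is one too large and a matrix with
  repeated columns settles the parity.

  That \<open>v\<close> and \<open>w\<close> have no common neighbour excludes loops at both, as
  they are adjacent, and makes n at least 3 whenever \<open>w\<close> has two distinct neighbours in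
  H. Then n - 1 < 2n - 3, so the \<open>fi\<close> alone sum to an even number.

  Forests are handled without paths or components: an edge set is tested by the functions to the
  field with two elements that are constant along it, which turns forest counts into ranks of
  incidence matrices.\<close>

declare add_bit_eq_xor [simp del] mult_bit_eq_and [simp del]
  bit_not_zero_iff [simp del] bit_not_one_iff [simp del]

lemma bit_add_self [simp]: "(b::bit) + b = 0"
  by (cases b) simp_all

lemma bit_add_eq_0_iff [simp]: "(a::bit) + b = 0 \<longleftrightarrow> a = b"
  by (cases a; cases b) simp_all

definition bit_subspace :: "('i \<Rightarrow> bit) set \<Rightarrow> bool" where
  "bit_subspace U \<longleftrightarrow> finite U \<and> (\<lambda>_. 0) \<in> U \<and> (\<forall>u\<in>U. \<forall>u'\<in>U. (\<lambda>i. u i + u' i) \<in> U)"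

definition bit_form :: "(('i \<Rightarrow> bit) \<Rightarrow> bit) \<Rightarrow> bool" where
  "bit_form s \<longleftrightarrow> (\<forall>u u'. s (\<lambda>i. u i + u' i) = s u + s u')"

lemma bit_form_add: "bit_form s \<Longrightarrow> s (\<lambda>i. u i + u' i) = s u + s u'"
  by (simp add: bit_form_def)

lemma bit_form_zero: "bit_form s \<Longrightarrow> s (\<lambda>_. 0) = 0"
  using bit_form_add[of s "\<lambda>_. 0" "\<lambda>_. 0"] by simp

lemma bit_subspace_kernel:
  assumes "bit_subspace U" "bit_form s"
  shows "bit_subspace {u \<in> U. s u = 0}"
  using assms bit_form_zero[OF assms(2)] bit_form_add[OF assms(2)]
  by (auto simp: bit_subspace_def)

text \<open>Translation by one element outside the kernel injects the complement into the kernel, so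
  a linear condition at most halves a space.\<close>

lemma card_kernel_ge:
  assumes U: "bit_subspace U" and s: "bit_form s"
  shows "card U \<le> 2 * card {u \<in> U. s u = 0}"
proof -
  let ?K = "{u \<in> U. s u = 0}"
  have fin: "finite U" using U by (simp add: bit_subspace_def)
  have "card (U - ?K) \<le> card ?K"
  proof (cases "U - ?K = {}")
    case False
    then obtain u0 where u0: "u0 \<in> U" "s u0 = 1" using bit_not_zero_iff by blast
    show ?thesis
    proof (rule card_inj_on_le[where f = "\<lambda>u i. u i + u0 i"])
      show "inj_on (\<lambda>u i. u i + u0 i) (U - ?K)" by (auto simp: inj_on_def fun_eq_iff)
      show "(\<lambda>u i. u i + u0 i) ` (U - ?K) \<subseteq> ?K"
        using U u0 s by (auto simp: bit_subspace_def bit_form_add bit_not_zero_iff)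
      show "finite ?K" using fin by simp
    qed
  qed (metis card.empty zero_le)
  moreover have "card U = card ?K + card (U - ?K)"
    using fin by (metis (no_types, lifting) card_Diff_subset card_mono finite_subset le_add_diff_inverse mem_Collect_eq subsetI)
  ultimately show ?thesis by linarith
qed

lemma card_kernels_ge:
  assumes "finite E" "bit_subspace U" "\<And>e. e \<in> E \<Longrightarrow> bit_form (s e)"
  shows "card U \<le> 2 ^ card E * card {u \<in> U. \<forall>e\<in>E. s e u = 0}
    \<and> bit_subspace {u \<in> U. \<forall>e\<in>E. s e u = 0}"
  using assms
proof (induction E rule: finite_induct)
  case empty
  then show ?case by simp
next
  case (insert e E)
  let ?K = "{u \<in> U. \<forall>e\<in>E. s e u = 0}"
  have eq: "{u \<in> U. \<forall>f\<in>insert e E. s f u = 0} = {u \<in> ?K. s e u = 0}" by auto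
  have K: "card U \<le> 2 ^ card E * card ?K" "bit_subspace ?K" using insert by auto
  have "card ?K \<le> 2 * card {u \<in> ?K. s e u = 0}"
    using K(2) insert.prems by (intro card_kernel_ge) auto
  then have "2 ^ card E * card ?K \<le> 2 ^ card E * (2 * card {u \<in> ?K. s e u = 0})"
    by (rule mult_le_mono2)
  with K(1) have "card U \<le> 2 ^ card E * (2 * card {u \<in> ?K. s e u = 0})" by (rule le_trans)
  then have "card U \<le> 2 ^ card (insert e E) * card {u \<in> ?K. s e u = 0}"
    by (simp only: card_insert_disjoint[OF insert.hyps] power_Suc mult.assoc mult.left_commute)
  moreover have "bit_subspace {u \<in> ?K. s e u = 0}"
    using K(2) insert.prems by (intro bit_subspace_kernel) auto
  ultimately show ?case unfolding eq by simp
qed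

text \<open>If \<open>s\<close> and \<open>t\<close> have no common nontrivial zero on \<open>U\<close>, then they embed \<open>U\<close> into a plane, and its image is
  the whole plane or one of the three lines \<open>s = 0\<close>, \<open>t = 0\<close>, \<open>s = t\<close>.\<close>

lemma three_lines:
  assumes U: "bit_subspace U" "2 \<le> card U" and s: "bit_form s" and t: "bit_form t"
  shows "(\<forall>u\<in>U. s u = t u \<longrightarrow> u = (\<lambda>_. 0)) \<longleftrightarrow>
    ((\<forall>u\<in>U. s u = 0 \<longrightarrow> u = (\<lambda>_. 0)) \<noteq> (\<forall>u\<in>U. t u = 0 \<longrightarrow> u = (\<lambda>_. 0)))"
proof -
  have z: "s (\<lambda>_. 0) = 0" "t (\<lambda>_. 0) = 0" using s t by (simp_all add: bit_form_zero)
  have fin: "finite U" using U(1) by (simp add: bit_subspace_def)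
  obtain u0 where u0: "u0 \<in> U" "u0 \<noteq> (\<lambda>_. 0)"
  proof -
    have "\<not> U \<subseteq> {\<lambda>_. 0}"
    proof
      assume "U \<subseteq> {\<lambda>_. 0}"
      then have "card U \<le> 1" using card_mono[of "{\<lambda>_. 0}" U] by simp
      with U(2) show False by simp
    qed
    then show ?thesis using that by blast
  qed
  have comb: "\<exists>u\<in>U. u \<noteq> (\<lambda>_. 0) \<and> s u = s u1 + s u2 \<and> t u = t u1 + t u2"
    if "u1 \<in> U" "u2 \<in> U" "s u1 \<noteq> s u2 \<or> t u1 \<noteq> t u2" for u1 u2
  proof (rule bexI[of _ "\<lambda>i. u1 i + u2 i"])
    show "(\<lambda>i. u1 i + u2 i) \<in> U" using U(1) that by (simp add: bit_subspace_def)
    have "s (\<lambda>i. u1 i + u2 i) \<noteq> 0 \<or> t (\<lambda>i. u1 i + u2 i) \<noteq> 0"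
      using that(3) by (simp add: bit_form_add[OF s] bit_form_add[OF t])
    then have "(\<lambda>i. u1 i + u2 i) \<noteq> (\<lambda>_. 0)" using z by metis
    then show "(\<lambda>i. u1 i + u2 i) \<noteq> (\<lambda>_. 0) \<and> s (\<lambda>i. u1 i + u2 i) = s u1 + s u2
        \<and> t (\<lambda>i. u1 i + u2 i) = t u1 + t u2"
      using bit_form_add[OF s] bit_form_add[OF t] by blast
  qed
  have ex: "(\<exists>u\<in>U. u \<noteq> (\<lambda>_. 0) \<and> s u = t u) \<or> (\<exists>u\<in>U. u \<noteq> (\<lambda>_. 0) \<and> s u = 0)
     \<or> (\<exists>u\<in>U. u \<noteq> (\<lambda>_. 0) \<and> t u = 0)"
    using u0 by (cases "s u0"; cases "t u0") auto
  define a where "a \<longleftrightarrow> (\<exists>u\<in>U. u \<noteq> (\<lambda>_. 0) \<and> s u = 0)"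
  define b where "b \<longleftrightarrow> (\<exists>u\<in>U. u \<noteq> (\<lambda>_. 0) \<and> t u = 0)"
  define c where "c \<longleftrightarrow> (\<exists>u\<in>U. u \<noteq> (\<lambda>_. 0) \<and> s u = t u)"
  have ab: "c" if A: "a" and B: "b"
  proof -
    obtain u1 where "u1 \<in> U" "u1 \<noteq> (\<lambda>_. 0)" "s u1 = 0" using A unfolding a_def by blast
    moreover obtain u2 where "u2 \<in> U" "u2 \<noteq> (\<lambda>_. 0)" "t u2 = 0" using B unfolding b_def by blast
    ultimately
    show c unfolding c_def using comb[of u1 u2] by (cases "t u1"; cases "s u2") fastforce+
  qed
  have ac: "b" if A: "a" and B: "c"
  proof -
    obtain u1 where "u1 \<in> U" "u1 \<noteq> (\<lambda>_. 0)" "s u1 = 0" using A unfolding a_def by blast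
    moreover obtain u2 where "u2 \<in> U" "u2 \<noteq> (\<lambda>_. 0)" "s u2 = t u2" using B unfolding c_def by blast
    ultimately
    show b unfolding b_def using comb[of u1 u2] by (cases "t u1"; cases "t u2") fastforce+
  qed
  have bc: "a" if A: "b" and B: "c"
  proof -
    obtain u1 where "u1 \<in> U" "u1 \<noteq> (\<lambda>_. 0)" "t u1 = 0" using A unfolding b_def by blast
    moreover obtain u2 where "u2 \<in> U" "u2 \<noteq> (\<lambda>_. 0)" "s u2 = t u2" using B unfolding c_def by blast
    ultimately
    show a unfolding a_def using comb[of u1 u2] by (cases "s u1"; cases "t u2") fastforce+
  qed
  have "(\<not> c) \<longleftrightarrow> ((\<not> a) \<noteq> (\<not> b))"
    using ab ac bc ex unfolding a_def[symmetric] b_def[symmetric] c_def[symmetric] by blast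
  then show ?thesis unfolding a_def b_def c_def by blast
qed

lemma sum_Pow_insert:
  assumes "finite A" "a \<notin> A"
  shows "(\<Sum>X\<in>Pow (insert a A). f X) = (\<Sum>X\<in>Pow A. f X) + (\<Sum>X\<in>Pow A. f (insert a X))"
proof -
  have inj: "inj_on (insert a) (Pow A)" using assms(2) by (auto simp: inj_on_def)
  have "Pow A \<inter> insert a ` Pow A = {}" using assms(2) by auto
  then show ?thesis
    using assms(1) by (simp add: Pow_insert sum.union_disjoint sum.reindex[OF inj])
qed

lemma card_Pow_insert_filter:
  assumes "finite A" "a \<notin> A"
  shows "card {X \<in> Pow (insert a A). P X} =
    card {X \<in> Pow A. P X} + card {X \<in> Pow A. P (insert a X)}"
proof -
  have card: "card {X \<in> S. R X} = (\<Sum>X\<in>S. if R X then 1 else 0)" if "finite S" for S :: "'a set set" and R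
    using that by (simp add: sum.If_cases Int_def)
  have fin: "finite (Pow A)" "finite (Pow (insert a A))" using assms(1) by simp_all
  show ?thesis unfolding card[OF fin(1)] card[OF fin(2)] by (rule sum_Pow_insert[OF assms])
qed

text \<open>A Laplace expansion over the field with two elements: if \<open>card U = 2 ^ card E\<close>, the right-hand side says
  that the square matrix of the forms \<open>s e - t e\<close> is nonsingular.\<close>

lemma odd_card_transversals:
  assumes "finite E" "bit_subspace U" "2 ^ card E \<le> card U"
    and "\<And>e. e \<in> E \<Longrightarrow> bit_form (s e)" "\<And>e. e \<in> E \<Longrightarrow> bit_form (t e)"
  shows "odd (card {S \<in> Pow E. \<forall>u\<in>U. (\<forall>e\<in>S. s e u = 0) \<and> (\<forall>e\<in>E - S. t e u = 0)
      \<longrightarrow> u = (\<lambda>_. 0)}) \<longleftrightarrow>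
    (\<forall>u\<in>U. (\<forall>e\<in>E. s e u = t e u) \<longrightarrow> u = (\<lambda>_. 0))"
  using assms
proof (induction E arbitrary: U rule: finite_induct)
  case empty
  then show ?case by (auto simp: Collect_conv_if)
next
  case (insert e E)
  define Q where "Q U E S \<longleftrightarrow> (\<forall>u\<in>U. (\<forall>e\<in>S. s e u = 0) \<and> (\<forall>e\<in>E - S. t e u = 0)
      \<longrightarrow> u = (\<lambda>_. 0))" for U E S
  let ?Us = "{u \<in> U. s e u = 0}" and ?Ut = "{u \<in> U. t e u = 0}"
  \<comment> \<open>\<open>?D\<close> imposes \<open>card E\<close> conditions on a space of
    dimension at least \<open>card E + 1\<close>, so it has a nonzero element, as
    \<open>three_lines\<close> requires.\<close>
  let ?D = "{u \<in> U. \<forall>e\<in>E. s e u + t e u = 0}"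
  have forms: "bit_form (s e)" "bit_form (t e)" using insert.prems by auto
  have sub: "bit_subspace ?Us" "bit_subspace ?Ut"
    using insert.prems forms by (auto intro: bit_subspace_kernel)
  have cU: "2 * 2 ^ card E \<le> card U" using insert.prems insert.hyps by simp
  have cs: "2 ^ card E \<le> card ?Us" "2 ^ card E \<le> card ?Ut"
    using card_kernel_ge[OF insert.prems(1) forms(1)] card_kernel_ge[OF insert.prems(1) forms(2)] cU
    by linarith+
  have fs: "bit_form (\<lambda>u. s f u + t f u)" if "f \<in> E" for f
    using insert.prems(3)[of f] insert.prems(4)[of f] that by (auto simp: bit_form_def algebra_simps)
  have D: "card U \<le> 2 ^ card E * card ?D" "bit_subspace ?D"
    using card_kernels_ge[OF insert.hyps(1) insert.prems(1), where s = "\<lambda>f u. s f u + t f u"] fs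
    by auto
  have "2 ^ card E * 2 \<le> 2 ^ card E * card ?D" using D(1) cU by linarith
  then have D2: "2 \<le> card ?D" by simp
  have D_alt: "?D = {u \<in> U. \<forall>e\<in>E. s e u = t e u}" by (simp add: bit_add_eq_0_iff)
  \<comment> \<open>A transversal imposes either \<open>t e\<close> or \<open>s e\<close>; in both
    cases \<open>U\<close> shrinks to a kernel and a transversal for \<open>E\<close> is
    left.\<close>
  have "Q U (insert e E) S = Q ?Ut E S \<and> Q U (insert e E) (insert e S) = Q ?Us E S" if "S \<in> Pow E" for S
  proof -
    have "insert e E - S = insert e (E - S)" "insert e E - insert e S = E - S"
      using insert.hyps that by auto
    then show ?thesis unfolding Q_def by auto
  qed
  then have "{S \<in> Pow E. Q U (insert e E) S} = {S \<in> Pow E. Q ?Ut E S}"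
      "{S \<in> Pow E. Q U (insert e E) (insert e S)} = {S \<in> Pow E. Q ?Us E S}"
    by blast+
  then have "card {S \<in> Pow (insert e E). Q U (insert e E) S} =
      card {S \<in> Pow E. Q ?Ut E S} + card {S \<in> Pow E. Q ?Us E S}"
    unfolding card_Pow_insert_filter[OF insert.hyps] by (simp only:)
  then have "odd (card {S \<in> Pow (insert e E). Q U (insert e E) S}) \<longleftrightarrow>
      odd (card {S \<in> Pow E. Q ?Ut E S}) \<noteq> odd (card {S \<in> Pow E. Q ?Us E S})"
    by simp
  also have "odd (card {S \<in> Pow E. Q ?Ut E S}) \<longleftrightarrow> (\<forall>u\<in>?D. t e u = 0 \<longrightarrow> u = (\<lambda>_. 0))"
    unfolding Q_def using insert.IH[OF sub(2) cs(2)] insert.prems D_alt by auto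
  also have "odd (card {S \<in> Pow E. Q ?Us E S}) \<longleftrightarrow> (\<forall>u\<in>?D. s e u = 0 \<longrightarrow> u = (\<lambda>_. 0))"
    unfolding Q_def using insert.IH[OF sub(1) cs(1)] insert.prems D_alt by auto
  finally have "odd (card {S \<in> Pow (insert e E). Q U (insert e E) S}) \<longleftrightarrow>
      (\<forall>u\<in>?D. s e u = t e u \<longrightarrow> u = (\<lambda>_. 0))"
    using three_lines[OF D(2) D2 forms] by blast
  then show ?case unfolding Q_def D_alt by auto
qed

section \<open>Forests and spanning trees\<close>

definition flat :: "('e \<Rightarrow> 'v set) \<Rightarrow> 'e set \<Rightarrow> ('v \<Rightarrow> bit) \<Rightarrow> bool" where
  "flat ep F g \<longleftrightarrow> (\<forall>e\<in>F. \<forall>x\<in>ep e. \<forall>y\<in>ep e. g x = g y)"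

text \<open>Functions that are constant along the edges of \<open>F\<close> encode the components of \<open>(V, F)\<close>: the
  predicate says that every component meets \<open>R\<close>.\<close>

definition pins :: "('e \<Rightarrow> 'v set) \<Rightarrow> 'v set \<Rightarrow> 'v set \<Rightarrow> 'e set \<Rightarrow> bool" where
  "pins ep V R F \<longleftrightarrow> (\<forall>g. flat ep F g \<and> (\<forall>x\<in>R. g x = 0) \<longrightarrow> (\<forall>x\<in>V. g x = 0))"

definition edges_within :: "('e \<Rightarrow> 'v set) \<Rightarrow> 'v set \<Rightarrow> 'e set \<Rightarrow> bool" where
  "edges_within ep V F \<longleftrightarrow> (\<forall>e\<in>F. \<exists>x\<in>V. \<exists>y\<in>V. ep e = {x, y})"

definition diff :: "('e \<Rightarrow> 'v set) \<Rightarrow> 'e \<Rightarrow> ('v \<Rightarrow> bit) \<Rightarrow> bit" where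
  "diff ep e g = of_bool (\<exists>x\<in>ep e. \<exists>y\<in>ep e. g x \<noteq> g y)"

definition point :: "'v \<Rightarrow> 'v \<Rightarrow> bit" where
  "point v = (\<lambda>x. of_bool (x = v))"

text \<open>The boundary of the edge chain \<open>x\<close> at \<open>v\<close>:
  \<open>diff ep e (point v)\<close> is the entry of the incidence matrix modulo 2, which is 0 for a
  self-loop.\<close>

definition divergence :: "('e \<Rightarrow> 'v set) \<Rightarrow> 'e set \<Rightarrow> ('e \<Rightarrow> bit) \<Rightarrow> 'v \<Rightarrow> bit" where
  "divergence ep F x v = (\<Sum>e\<in>F. x e * diff ep e (point v))"

text \<open>Linear independence of the columns \<open>F\<close> of the incidence matrix with the
  rows \<open>R\<close> removed. For edges within \<open>V\<close> this means that \<open>F\<close>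
  becomes a forest when the vertices of \<open>R\<close> are merged.\<close>

definition indep :: "('e \<Rightarrow> 'v set) \<Rightarrow> 'v set \<Rightarrow> 'v set \<Rightarrow> 'e set \<Rightarrow> bool" where
  "indep ep V R F \<longleftrightarrow>
    (\<forall>x. (\<forall>v\<in>V - R. divergence ep F x v = 0) \<longrightarrow> (\<forall>e\<in>F. x e = 0))"

lemma flat_iff_diff: "flat ep F g \<longleftrightarrow> (\<forall>e\<in>F. diff ep e g = 0)"
  unfolding flat_def diff_def of_bool_eq_0_iff by blast

lemma flat_mono: "flat ep F g \<Longrightarrow> F' \<subseteq> F \<Longrightarrow> flat ep F' g"
  unfolding flat_def by blast

lemma flat_add: "flat ep F g \<Longrightarrow> flat ep F h \<Longrightarrow> flat ep F (\<lambda>x. g x + h x)"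
  unfolding flat_def by (intro ballI) (rule arg_cong2[where f = "(+)"]; blast)

lemma flat_add_const: "flat ep F g \<Longrightarrow> flat ep F (\<lambda>x. g x + c)"
  unfolding flat_def by (intro ballI) (rule arg_cong[where f = "\<lambda>b. b + c"]; blast)

lemma diff_ends: "ep e = {x, y} \<Longrightarrow> diff ep e g = g x + g y"
  unfolding diff_def by (cases "g x"; cases "g y") auto

lemma flat_insert: "ep e = {x, y} \<Longrightarrow> flat ep (insert e F) g \<longleftrightarrow> flat ep F g \<and> g x = g y"
  by (auto simp: flat_iff_diff diff_ends)

lemma edges_within_mono: "edges_within ep V F \<Longrightarrow> F' \<subseteq> F \<Longrightarrow> edges_within ep V F'"
  by (auto simp: edges_within_def)

lemma diff_form:
  assumes "edges_within ep V F" "e \<in> F"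
  shows "bit_form (diff ep e)"
proof -
  obtain x y where "ep e = {x, y}" using assms by (auto simp: edges_within_def)
  then show ?thesis by (simp add: bit_form_def diff_ends ac_simps)
qed

lemma diff_cong:
  "edges_within ep V F \<Longrightarrow> e \<in> F \<Longrightarrow> (\<And>v. v \<in> V \<Longrightarrow> g v = h v) \<Longrightarrow> diff ep e g = diff ep e h"
  unfolding diff_def edges_within_def by fastforce

lemma diff_expand:
  assumes "edges_within ep V F" "e \<in> F" "finite V"
  shows "diff ep e g = (\<Sum>v\<in>V. g v * diff ep e (point v))"
proof -
  obtain x y where e: "x \<in> V" "y \<in> V" "ep e = {x, y}"
    using assms by (auto simp: edges_within_def)
  have "(\<Sum>v\<in>V. g v * diff ep e (point v)) = (\<Sum>v\<in>V. (if v = x then g v else 0) + (if v = y then g v else 0))"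
    by (rule sum.cong) (auto simp: diff_ends[of ep e x y, OF e(3)] point_def)
  also have "\<dots> = g x + g y" using assms(3) e by (simp add: sum.distrib sum.delta)
  finally show ?thesis using diff_ends[of ep e x y, OF e(3)] by simp
qed

text \<open>Summation by parts: boundary and coboundary are adjoint. It lets a flat potential and a
  relation among edges test each other.\<close>

lemma sum_divergence:
  assumes "edges_within ep V F" "finite V"
  shows "(\<Sum>e\<in>F. x e * diff ep e g) = (\<Sum>v\<in>V. g v * divergence ep F x v)"
proof -
  have "(\<Sum>e\<in>F. x e * diff ep e g) = (\<Sum>e\<in>F. \<Sum>v\<in>V. x e * (g v * diff ep e (point v)))"
    using diff_expand[OF assms(1) _ assms(2), of _ g] by (simp add: sum_distrib_left)
  also have "\<dots> = (\<Sum>v\<in>V. g v * divergence ep F x v)"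
    unfolding divergence_def by (subst sum.swap) (simp add: sum_distrib_left mult.left_commute)
  finally show ?thesis .
qed

lemma bit_subspace_supported:
  assumes "finite A"
  shows "bit_subspace {g :: 'i \<Rightarrow> bit. \<forall>i. i \<notin> A \<longrightarrow> g i = 0}"
    and "card {g :: 'i \<Rightarrow> bit. \<forall>i. i \<notin> A \<longrightarrow> g i = 0} = 2 ^ card A"
proof -
  let ?U = "{g :: 'i \<Rightarrow> bit. \<forall>i. i \<notin> A \<longrightarrow> g i = 0}"
  have bij: "bij_betw (\<lambda>X i. of_bool (i \<in> X)) (Pow A) ?U"
    unfolding bij_betw_def
  proof (intro conjI subset_antisym subsetI)
    show "inj_on (\<lambda>X i. of_bool (i \<in> X) :: bit) (Pow A)"
      by (auto simp: inj_on_def fun_eq_iff)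
    fix g assume g: "g \<in> ?U"
    have "of_bool (g i = 1) = g i" for i by (cases "g i") simp_all
    then have "g = (\<lambda>i. of_bool (i \<in> {i. g i = 1}))" by simp
    moreover have "{i. g i = 1} \<in> Pow A" using g by force
    ultimately show "g \<in> (\<lambda>X i. of_bool (i \<in> X)) ` Pow A" by blast
  next
    fix g assume "g \<in> (\<lambda>X i. of_bool (i \<in> X) :: bit) ` Pow A"
    then show "g \<in> ?U" by auto
  qed
  then have "finite ?U" using assms bij_betw_finite[OF bij] by simp
  then show "bit_subspace ?U" by (auto simp: bit_subspace_def)
  show "card ?U = 2 ^ card A" using bij_betw_same_card[OF bij] assms by (simp add: card_Pow)
qed

lemma card_le_1_if_subset_singleton: "A \<subseteq> {a} \<Longrightarrow> card A \<le> 1"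
  using card_mono[of "{a}" A] by simp

lemma le_mult_le_1: "a \<le> k * c \<Longrightarrow> c \<le> 1 \<Longrightarrow> a \<le> (k::nat)"
  by (metis le_trans mult.right_neutral mult_le_mono2)

text \<open>The coboundary onto \<open>F\<close> is injective on the functions supported on
  \<open>V - R\<close>, so \<open>card (V - R)\<close> is at most \<open>card F\<close>.\<close>

lemma pins_card:
  assumes "pins ep V R F" "finite V" "R \<subseteq> V" "finite F" "edges_within ep V F"
  shows "card V \<le> card R + card F"
proof -
  let ?U = "{g :: 'b \<Rightarrow> bit. \<forall>i. i \<notin> V - R \<longrightarrow> g i = 0}"
  have "{g \<in> ?U. \<forall>e\<in>F. diff ep e g = 0} \<subseteq> {\<lambda>_. 0}"
    using assms(1) unfolding pins_def flat_iff_diff by (auto simp: fun_eq_iff)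
  then have "card {g \<in> ?U. \<forall>e\<in>F. diff ep e g = 0} \<le> 1"
    by (rule card_le_1_if_subset_singleton)
  moreover have "card ?U \<le> 2 ^ card F * card {g \<in> ?U. \<forall>e\<in>F. diff ep e g = 0}"
    using card_kernels_ge[OF assms(4) bit_subspace_supported(1)[of "V - R"], where s = "diff ep"]
      diff_form[OF assms(5)] assms(2) by blast
  ultimately have "card ?U \<le> 2 ^ card F"
    by (rule le_mult_le_1[rotated])
  then have "card (V - R) \<le> card F"
    using bit_subspace_supported(2)[of "V - R"] assms(2) by simp
  then show ?thesis using card_Diff_subset[of R V] assms(2,3) finite_subset[of R V] by simp
qed

lemma divergence_form:
  "bit_form (\<lambda>x. divergence ep F x v)"
  by (simp add: bit_form_def divergence_def distrib_right sum.distrib)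

lemma indep_card:
  assumes "indep ep V R F" "finite V" "finite F"
  shows "card F \<le> card (V - R)"
proof -
  let ?U = "{x :: 'a \<Rightarrow> bit. \<forall>i. i \<notin> F \<longrightarrow> x i = 0}"
  let ?K = "{x \<in> ?U. \<forall>v\<in>V - R. divergence ep F x v = 0}"
  have "?K \<subseteq> {\<lambda>_. 0}" using assms(1) unfolding indep_def by (auto simp: fun_eq_iff)
  then have "card ?K \<le> 1" by (rule card_le_1_if_subset_singleton)
  moreover have "card ?U \<le> 2 ^ card (V - R) * card ?K"
    using card_kernels_ge[OF finite_Diff[OF assms(2)] bit_subspace_supported(1)[OF assms(3)] divergence_form]
    by (rule conjunct1)
  ultimately have "card ?U \<le> 2 ^ card (V - R)"
    by (rule le_mult_le_1[rotated])
  then show ?thesis using bit_subspace_supported(2)[OF assms(3)] by simp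
qed

text \<open>A square matrix with trivial kernel has no relation among its rows. By summation by
  parts, a relation \<open>x\<close> involving \<open>e0\<close> would make \<open>e0\<close>
  redundant for pinning, and too few edges would remain.\<close>

lemma pins_imp_indep:
  assumes "pins ep V R F" "card F = card (V - R)" "finite V" "R \<subseteq> V" "finite F" "edges_within ep V F"
  shows "indep ep V R F"
  unfolding indep_def
proof (intro allI impI ballI, rule ccontr)
  fix x e0 assume div0: "\<forall>v\<in>V - R. divergence ep F x v = 0" and e0: "e0 \<in> F" "x e0 \<noteq> 0"
  have "pins ep V R (F - {e0})"
    unfolding pins_def
  proof (intro allI impI)
    fix g assume g: "flat ep (F - {e0}) g \<and> (\<forall>x\<in>R. g x = 0)"
    have "0 = (\<Sum>v\<in>V. g v * divergence ep F x v)"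
      using g div0 by (intro sum.neutral[symmetric]) auto
    also have "\<dots> = (\<Sum>e\<in>F. x e * diff ep e g)" using assms by (simp add: sum_divergence)
    also have "\<dots> = x e0 * diff ep e0 g"
      using g e0 assms(5) unfolding flat_iff_diff by (subst sum.remove[of _ e0]) auto
    finally have "diff ep e0 g = 0" using e0(2) by simp
    then have "flat ep F g" using g unfolding flat_iff_diff by blast
    then show "\<forall>x\<in>V. g x = 0" using g assms(1) unfolding pins_def by blast
  qed
  then have "card V \<le> card R + card (F - {e0})"
    using assms by (intro pins_card[of ep]) (auto intro: edges_within_mono)
  moreover have "card (V - R) = card V - card R" "card R \<le> card V"
    using assms by (auto simp: card_Diff_subset finite_subset card_mono)
  moreover have "card F > 0" using e0 assms(5) card_gt_0_iff by blast
  ultimately show False using assms(2,5) e0 by simp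
qed

text \<open>The transposed argument: a flat potential \<open>g\<close> with
  \<open>g v0 \<noteq> 0\<close> makes the equation at \<open>v0\<close> redundant, so
  \<open>F\<close> stays independent after \<open>v0\<close> joins \<open>R\<close>, against the
  dimension count.\<close>

lemma indep_imp_pins:
  assumes "indep ep V R F" "card F = card (V - R)" "finite V" "R \<subseteq> V" "finite F" "edges_within ep V F"
  shows "pins ep V R F"
  unfolding pins_def
proof (intro allI impI ballI, rule ccontr)
  fix g v0 assume g: "flat ep F g \<and> (\<forall>x\<in>R. g x = 0)" and v0: "v0 \<in> V" "g v0 \<noteq> 0"
  have "indep ep V (insert v0 R) F"
    unfolding indep_def
  proof (intro allI impI)
    fix x assume x: "\<forall>v\<in>V - insert v0 R. divergence ep F x v = 0"
    have "0 = (\<Sum>e\<in>F. x e * diff ep e g)"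
      using g unfolding flat_iff_diff by (intro sum.neutral[symmetric]) auto
    also have "\<dots> = (\<Sum>v\<in>V. g v * divergence ep F x v)" using assms by (simp add: sum_divergence)
    also have "\<dots> = g v0 * divergence ep F x v0"
      using assms(3) v0 x g by (subst sum.remove[of _ v0]) (auto intro!: sum.neutral)
    finally have "divergence ep F x v0 = 0" using v0(2) by simp
    then show "\<forall>e\<in>F. x e = 0" using x assms(1) unfolding indep_def by blast
  qed
  then have "card F \<le> card (V - insert v0 R)" using assms by (intro indep_card) auto
  also have "\<dots> < card (V - R)" using v0 g assms(3) by (intro psubset_card_mono) auto
  finally show False using assms(2) by simp
qed

section \<open>Parities of forest counts as nonsingularity of a bordered matrix\<close>

lemma divergence_form_Inr:
  "bit_form (\<lambda>u. divergence ep F (\<lambda>e. u (Inr e)) v)"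
  by (simp add: bit_form_def divergence_def distrib_right sum.distrib)

lemma bit_form_comp_Inl: "bit_form s \<Longrightarrow> bit_form (\<lambda>u. s (\<lambda>v. u (Inl v)))"
  by (simp add: bit_form_def)

lemma divergence_mono_neutral:
  assumes "finite E" "F \<subseteq> E" "\<And>e. e \<in> E - F \<Longrightarrow> x e = 0"
  shows "divergence ep E x v = divergence ep F x v"
  unfolding divergence_def using assms by (intro sum.mono_neutral_right) auto

lemma bit_sum_fun_eq_zero:
  "u = (\<lambda>_. 0) \<longleftrightarrow> (\<forall>v. u (Inl v) = 0) \<and> (\<forall>e. u (Inr e) = 0)"
  by (auto simp: fun_eq_iff) (metis sumE)

text \<open>The right-hand side is the nonsingularity of the matrix with the edge variables \<open>\<alpha>\<close> on the diagonal,
  bordered by incidence matrices with rows \<open>R\<close> and \<open>R'\<close> removed, at the point \<open>\<alpha>\<close> with zero set \<open>Z\<close>.\<close>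

lemma odd_card_common_pins:
  assumes V: "finite V" "R \<subseteq> V" "R' \<subseteq> V" "card R = card R'"
    and E: "finite E" "Z \<subseteq> E" "edges_within ep V E"
  shows "odd (card {F \<in> Pow E. Z \<subseteq> F \<and> card F + card R = card V \<and> pins ep V R F \<and> pins ep V R' F})
    \<longleftrightarrow> (\<forall>g x. (\<forall>v. v \<notin> V - R \<longrightarrow> g v = 0) \<and> (\<forall>e. e \<notin> E \<longrightarrow> x e = 0) \<and>
        (\<forall>v\<in>V - R'. divergence ep E x v = 0) \<and> (\<forall>e\<in>Z. diff ep e g = 0) \<and>
        (\<forall>e\<in>E - Z. diff ep e g = x e) \<longrightarrow> (\<forall>v. g v = 0) \<and> (\<forall>e. x e = 0))"
proof -
  have finR: "finite R" "finite R'" using V finite_subset by auto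
  have cR: "card R \<le> card V" "card (V - R) = card V - card R" "card (V - R') = card V - card R"
    using V finR by (auto simp: card_mono card_Diff_subset)
  \<comment> \<open>\<open>A\<close> indexes the unknowns, \<open>g\<close> on \<open>V - R\<close>
    and \<open>x\<close> on \<open>E\<close>; \<open>B\<close> indexes the equations imposed at
    once, divergence 0 on \<open>V - R'\<close> and coboundary 0 on \<open>Z\<close>. Since
    \<open>card R = card R'\<close>, the solution space \<open>U\<close> has dimension at least
    \<open>card (E - Z)\<close>.\<close>
  define A where "A = Inl ` (V - R) \<union> (Inr ` E :: ('a + 'b) set)"
  define B where "B = Inl ` (V - R') \<union> (Inr ` Z :: ('a + 'b) set)"
  have finZ: "finite Z" using E finite_subset by auto
  have finA: "finite A" "finite B" using V E finZ by (auto simp: A_def B_def)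
  have cA: "card A = card (V - R) + card E" "card B = card (V - R') + card Z"
    unfolding A_def B_def using V E finZ
    by (subst card_Un_disjoint; auto simp: card_image)+
  define U0 where "U0 = {u :: 'a + 'b \<Rightarrow> bit. \<forall>i. i \<notin> A \<longrightarrow> u i = 0}"
  define s where "s i u = (case i of Inl v \<Rightarrow> divergence ep E (\<lambda>e. u (Inr e)) v
      | Inr e \<Rightarrow> diff ep e (\<lambda>v. u (Inl v)))" for i and u :: "'a + 'b \<Rightarrow> bit"
  define U where "U = {u \<in> U0. \<forall>i\<in>B. s i u = 0}"
  have formE: "bit_form (\<lambda>u :: 'a + 'b \<Rightarrow> bit. diff ep e (\<lambda>v. u (Inl v)))" if "e \<in> E" for e
    using diff_form[OF E(3) that] by (rule bit_form_comp_Inl)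
  have s_simps: "s (Inl v) = (\<lambda>u. divergence ep E (\<lambda>e. u (Inr e)) v)"
      "s (Inr e) = (\<lambda>u. diff ep e (\<lambda>v. u (Inl v)))" for v e
    by (simp_all add: s_def fun_eq_iff)
  have forms: "bit_form (s i)" if "i \<in> B" for i
    using that formE E(2) divergence_form_Inr[of ep E]
    by (auto simp: B_def s_simps)
  have "card U0 \<le> 2 ^ card B * card U" and subU: "bit_subspace U"
    using card_kernels_ge[OF finA(2) bit_subspace_supported(1)[OF finA(1)] forms]
    unfolding U_def U0_def by auto
  moreover have "card U0 = 2 ^ card B * 2 ^ card (E - Z)"
    unfolding U0_def bit_subspace_supported(2)[OF finA(1)] cA power_add[symmetric]
    using cR E finZ card_mono[OF E(1,2)] by (simp add: card_Diff_subset)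
  ultimately have cU: "2 ^ card (E - Z) \<le> card U" by simp
  have U_iff: "u \<in> U \<longleftrightarrow> (\<forall>v. v \<notin> V - R \<longrightarrow> u (Inl v) = 0) \<and> (\<forall>e. e \<notin> E \<longrightarrow> u (Inr e) = 0) \<and>
        (\<forall>v\<in>V - R'. divergence ep E (\<lambda>e. u (Inr e)) v = 0) \<and> (\<forall>e\<in>Z. diff ep e (\<lambda>v. u (Inl v)) = 0)" for u
  proof -
    have "Inl v \<in> A \<longleftrightarrow> v \<in> V - R" "Inr e \<in> A \<longleftrightarrow> e \<in> E" for v e by (auto simp: A_def)
    then have "(\<forall>i. i \<notin> A \<longrightarrow> u i = 0) \<longleftrightarrow>
        (\<forall>v. v \<notin> V - R \<longrightarrow> u (Inl v) = 0) \<and> (\<forall>e. e \<notin> E \<longrightarrow> u (Inr e) = 0)"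
      unfolding split_sum_all by presburger
    moreover have "(\<forall>i\<in>B. s i u = 0) \<longleftrightarrow> (\<forall>v\<in>V - R'. divergence ep E (\<lambda>e. u (Inr e)) v = 0)
        \<and> (\<forall>e\<in>Z. diff ep e (\<lambda>v. u (Inl v)) = 0)"
      unfolding B_def ball_Un ball_simps s_def by simp
    ultimately show ?thesis unfolding U_def U0_def by blast
  qed
  have parity: "odd (card {S \<in> Pow (E - Z). \<forall>u\<in>U. (\<forall>e\<in>S. diff ep e (\<lambda>v. u (Inl v)) = 0) \<and>
       (\<forall>e\<in>E - Z - S. u (Inr e) = 0) \<longrightarrow> u = (\<lambda>_. 0)}) \<longleftrightarrow>
    (\<forall>u\<in>U. (\<forall>e\<in>E - Z. diff ep e (\<lambda>v. u (Inl v)) = u (Inr e)) \<longrightarrow> u = (\<lambda>_. 0))"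
    using odd_card_transversals[of "E - Z" U "\<lambda>e u. diff ep e (\<lambda>v. u (Inl v))" "\<lambda>e u. u (Inr e)"]
      subU cU formE E(1) by (simp add: bit_form_def)
  \<comment> \<open>For each edge outside \<open>Z\<close> a transversal demands coboundary 0 (the
    edge is in the forest) or \<open>x e = 0\<close> (it is not). This decouples \<open>g\<close>
    from \<open>x\<close>: the first is pinned by \<open>R\<close>, the second is independent
    relative to \<open>R'\<close>.\<close>
  have trans: "(\<forall>u\<in>U. (\<forall>e\<in>S. diff ep e (\<lambda>v. u (Inl v)) = 0) \<and>
       (\<forall>e\<in>E - Z - S. u (Inr e) = 0) \<longrightarrow> u = (\<lambda>_. 0)) \<longleftrightarrow>
       card (S \<union> Z) + card R = card V \<and> pins ep V R (S \<union> Z) \<and> pins ep V R' (S \<union> Z)"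
    (is "?L \<longleftrightarrow> ?Q") if S: "S \<subseteq> E - Z" for S
  proof -
    let ?F = "S \<union> Z"
    have F: "?F \<subseteq> E" "finite ?F" using S E finite_subset[of ?F E] by auto
    have FE: "edges_within ep V ?F" using E(3) F(1) by (rule edges_within_mono)
    have EF: "E - ?F = E - Z - S" by auto
    have "?L \<longleftrightarrow> pins ep V R ?F \<and> indep ep V R' ?F"
    proof
      assume L: ?L
      have "pins ep V R ?F"
        unfolding pins_def
      proof (intro allI impI)
        fix g assume g: "flat ep ?F g \<and> (\<forall>x\<in>R. g x = 0)"
        define h where "h v = (if v \<in> V then g v else 0)" for v
        define u where "u = case_sum h (\<lambda>_::'b. 0)"
        have hR: "v \<notin> V - R \<Longrightarrow> h v = 0" for v using g by (auto simp: h_def)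
        have dh: "diff ep e h = 0" if "e \<in> ?F" for e
          using diff_cong[OF FE that, of h g] g that unfolding flat_iff_diff h_def by simp
        have "u \<in> U"
          unfolding U_iff using hR dh by (simp add: u_def divergence_def)
        moreover have "\<forall>e\<in>S. diff ep e (\<lambda>v. u (Inl v)) = 0"
          using dh by (simp add: u_def)
        ultimately have "u = (\<lambda>_. 0)" using L by (simp add: u_def)
        then have "h v = 0" for v unfolding u_def by (metis sum.case(1))
        then show "\<forall>x\<in>V. g x = 0" unfolding h_def by metis
      qed
      moreover have "indep ep V R' ?F"
        unfolding indep_def
      proof (intro allI impI ballI)
        fix x e assume x: "\<forall>v\<in>V - R'. divergence ep ?F x v = 0" and e: "e \<in> ?F"
        define h where "h e = (if e \<in> ?F then x e else 0)" for e
        define u where "u = case_sum (\<lambda>_::'a. 0) h"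
        have h0: "e \<notin> ?F \<Longrightarrow> h e = 0" "e \<notin> E \<Longrightarrow> h e = 0" for e using F by (auto simp: h_def)
        have "divergence ep E h v = divergence ep ?F h v" for v
          using F E(1) by (intro divergence_mono_neutral) (auto simp: h_def)
        also have "divergence ep ?F h v = divergence ep ?F x v" for v
          unfolding divergence_def by (rule sum.cong) (auto simp: h_def)
        finally have dv: "divergence ep E h v = divergence ep ?F x v" for v .
        have z: "diff ep e (\<lambda>_. 0) = 0" for e by (simp add: diff_def)
        have "u \<in> U"
          unfolding U_iff using h0 x by (simp add: u_def dv z)
        moreover have "\<forall>e\<in>E - Z - S. u (Inr e) = 0" using h0 by (simp add: u_def)
        ultimately have "u = (\<lambda>_. 0)" using L by (simp add: u_def z)
        then have "h e = 0" for e unfolding u_def by (metis sum.case(2))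
        then show "x e = 0" using e unfolding h_def by metis
      qed
      ultimately show "pins ep V R ?F \<and> indep ep V R' ?F" ..
    next
      assume P: "pins ep V R ?F \<and> indep ep V R' ?F"
      show ?L
      proof (intro ballI impI)
        fix u assume u: "u \<in> U" and uS: "(\<forall>e\<in>S. diff ep e (\<lambda>v. u (Inl v)) = 0) \<and>
           (\<forall>e\<in>E - Z - S. u (Inr e) = 0)"
        have "flat ep ?F (\<lambda>v. u (Inl v))" using u uS unfolding flat_iff_diff U_iff by blast
        moreover have "\<forall>v\<in>R. u (Inl v) = 0" using u unfolding U_iff by blast
        ultimately have "\<forall>v\<in>V. u (Inl v) = 0"
          using P unfolding pins_def by blast
        moreover have "\<forall>e\<in>?F. u (Inr e) = 0"
        proof -
          have "divergence ep ?F (\<lambda>e. u (Inr e)) v = divergence ep E (\<lambda>e. u (Inr e)) v" for v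
            using uS F E(1) unfolding EF[symmetric] by (intro divergence_mono_neutral[symmetric]) auto
          then have "\<forall>v\<in>V - R'. divergence ep ?F (\<lambda>e. u (Inr e)) v = 0"
            using u unfolding U_iff by simp
          then show ?thesis using P unfolding indep_def by blast
        qed
        ultimately show "u = (\<lambda>_. 0)"
          using u uS EF unfolding bit_sum_fun_eq_zero U_iff by blast
      qed
    qed
    also have "\<dots> \<longleftrightarrow> ?Q"
    proof
      assume P: "pins ep V R ?F \<and> indep ep V R' ?F"
      have "card V \<le> card R + card ?F" using P pins_card V F FE by blast
      moreover have "card ?F \<le> card V - card R" using P indep_card[OF _ V(1) F(2)] cR by metis
      ultimately have c: "card ?F + card R = card V" using cR(1) by linarith
      then have "card ?F = card (V - R')" using cR(3) by linarith
      then have "pins ep V R' ?F" using P indep_imp_pins V F FE by blast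
      then show ?Q using P c by blast
    next
      assume Q: ?Q
      then have "card ?F = card (V - R')" using cR(3) by linarith
      then show "pins ep V R ?F \<and> indep ep V R' ?F" using Q pins_imp_indep V F FE by blast
    qed
    finally show ?thesis .
  qed
  let ?N = "{F \<in> Pow E. Z \<subseteq> F \<and> card F + card R = card V \<and> pins ep V R F \<and> pins ep V R' F}"
  let ?M = "{S \<in> Pow (E - Z). card (S \<union> Z) + card R = card V \<and> pins ep V R (S \<union> Z) \<and> pins ep V R' (S \<union> Z)}"
  have "bij_betw (\<lambda>S. S \<union> Z) ?M ?N"
  proof (rule bij_betwI[where g = "\<lambda>F. F - Z"])
    show "(\<lambda>F. F - Z) \<in> ?N \<rightarrow> ?M" by (auto simp: Un_absorb2)
  qed (use E(2) in auto)
  from bij_betw_same_card[OF this] have "card ?N = card ?M" by (rule sym)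
  also have "?M = {S \<in> Pow (E - Z). \<forall>u\<in>U. (\<forall>e\<in>S. diff ep e (\<lambda>v. u (Inl v)) = 0) \<and>
       (\<forall>e\<in>E - Z - S. u (Inr e) = 0) \<longrightarrow> u = (\<lambda>_. 0)}"
    using trans by blast
  finally have "odd (card ?N) \<longleftrightarrow>
    (\<forall>u\<in>U. (\<forall>e\<in>E - Z. diff ep e (\<lambda>v. u (Inl v)) = u (Inr e)) \<longrightarrow> u = (\<lambda>_. 0))"
    using parity by presburger
  also have "\<dots> \<longleftrightarrow> (\<forall>g x. case_sum g x \<in> U \<and> (\<forall>e\<in>E - Z. diff ep e g = x e) \<longrightarrow>
      (\<forall>v. g v = 0) \<and> (\<forall>e. x e = 0))"
  proof (intro iffI allI impI ballI)
    fix g x assume "\<forall>u\<in>U. (\<forall>e\<in>E - Z. diff ep e (\<lambda>v. u (Inl v)) = u (Inr e)) \<longrightarrow> u = (\<lambda>_. 0)"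
      and gx: "case_sum g x \<in> U \<and> (\<forall>e\<in>E - Z. diff ep e g = x e)"
    then have "case_sum g x = (\<lambda>_. 0)" by simp
    then show "(\<forall>v. g v = 0) \<and> (\<forall>e. x e = 0)" unfolding bit_sum_fun_eq_zero by simp
  next
    fix u assume *: "\<forall>g x. case_sum g x \<in> U \<and> (\<forall>e\<in>E - Z. diff ep e g = x e) \<longrightarrow>
      (\<forall>v. g v = 0) \<and> (\<forall>e. x e = 0)" and u: "u \<in> U"
      "\<forall>e\<in>E - Z. diff ep e (\<lambda>v. u (Inl v)) = u (Inr e)"
    have "case_sum (\<lambda>v. u (Inl v)) (\<lambda>e. u (Inr e)) = u"
      by (rule surjective_sum)
    then have "case_sum (\<lambda>v. u (Inl v)) (\<lambda>e. u (Inr e)) \<in> U" using u(1) by (simp only:)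
    from mp[OF spec[OF spec[OF *]] conjI[OF this u(2)]]
    show "u = (\<lambda>_. 0)" unfolding bit_sum_fun_eq_zero .
  qed
  finally show ?thesis unfolding U_iff by simp
qed

text \<open>If the spanning tree sum vanishes, a nonconstant potential \<open>g\<close> lies in the kernel. An odd number of
  forests separating \<open>a\<close> from \<open>b\<close> and \<open>c\<close> forces \<open>g a \<noteq> g b\<close> and \<open>g a \<noteq> g c\<close>, so with the same for \<open>b\<close> three
  bits would be pairwise distinct.\<close>

lemma forest_parity_rank_one:
  assumes V: "finite V" "a \<in> V" "b \<in> V" "c \<in> V"
    and E: "finite E" "Z \<subseteq> E" "edges_within ep V E"
    and fa: "odd (card {F \<in> Pow E. Z \<subseteq> F \<and> card F + 2 = card V \<and> pins ep V {a, b} F \<and> pins ep V {a, c} F})"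
    and fb: "odd (card {F \<in> Pow E. Z \<subseteq> F \<and> card F + 2 = card V \<and> pins ep V {b, a} F \<and> pins ep V {b, c} F})"
  shows "odd (card {F \<in> Pow E. Z \<subseteq> F \<and> card F + 1 = card V \<and> pins ep V {c} F})"
proof (rule ccontr)
  assume "\<not> ?thesis"
  moreover have "{F \<in> Pow E. Z \<subseteq> F \<and> card F + card {c} = card V \<and> pins ep V {c} F \<and> pins ep V {c} F} =
      {F \<in> Pow E. Z \<subseteq> F \<and> card F + 1 = card V \<and> pins ep V {c} F}" by auto
  moreover have "{c} \<subseteq> V" using V by simp
  ultimately have "\<not> (\<forall>g x. (\<forall>v. v \<notin> V - {c} \<longrightarrow> g v = 0) \<and> (\<forall>e. e \<notin> E \<longrightarrow> x e = 0) \<and>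
        (\<forall>v\<in>V - {c}. divergence ep E x v = 0) \<and> (\<forall>e\<in>Z. diff ep e g = 0) \<and>
        (\<forall>e\<in>E - Z. diff ep e g = x e) \<longrightarrow> (\<forall>v. g v = 0) \<and> (\<forall>e. x e = 0))"
    using odd_card_common_pins[of V "{c}" "{c}" E Z ep] V(1) E by presburger
  then obtain g x where g0: "\<And>v. v \<notin> V - {c} \<Longrightarrow> g v = 0" and x0: "\<And>e. e \<notin> E \<Longrightarrow> x e = 0"
    and div0: "\<And>v. v \<in> V - {c} \<Longrightarrow> divergence ep E x v = 0"
    and gZ: "\<And>e. e \<in> Z \<Longrightarrow> diff ep e g = 0" and gE: "\<And>e. e \<in> E - Z \<Longrightarrow> diff ep e g = x e"
    and ne: "\<not> ((\<forall>v. g v = 0) \<and> (\<forall>e. x e = 0))"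
    by blast
  \<comment> \<open>The constant 1 has coboundary 0, so the divergences sum to 0 over
    \<open>V\<close> and the one at \<open>c\<close> vanishes too. After this the equations for
    \<open>x\<close> no longer single out \<open>c\<close>.\<close>
  have "(\<Sum>v\<in>V. 1 * divergence ep E x v) = (\<Sum>e\<in>E. x e * diff ep e (\<lambda>_. 1))"
    using E V by (intro sum_divergence[symmetric])
  then have "(\<Sum>v\<in>V. divergence ep E x v) = 0" by (simp add: diff_def)
  then have "divergence ep E x c = 0"
    using V div0 by (subst (asm) sum.remove[of _ c]) auto
  with div0 have div: "divergence ep E x v = 0" if "v \<in> V" for v using that by blast
  have sep: "p \<noteq> q \<and> g p \<noteq> g q" if pqr: "p \<in> V" "q \<in> V" "r \<in> V"
    and f: "odd (card {F \<in> Pow E. Z \<subseteq> F \<and> card F + 2 = card V \<and> pins ep V {p, q} F \<and> pins ep V {p, r} F})"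
    for p q r
  proof -
    have "\<exists>F\<in>Pow E. card F + 2 = card V \<and> pins ep V {p, q} F \<and> pins ep V {p, r} F"
    proof (rule ccontr)
      assume "\<not> ?thesis"
      then have "{F \<in> Pow E. Z \<subseteq> F \<and> card F + 2 = card V \<and> pins ep V {p, q} F \<and> pins ep V {p, r} F} = {}"
        by blast
      then show False using f by (simp only: card.empty) simp
    qed
    then obtain F where F: "F \<subseteq> E" "card F + 2 = card V" "pins ep V {p, q} F" "pins ep V {p, r} F" by blast
    have "card V \<le> card {p, q} + card F" "card V \<le> card {p, r} + card F"
      using F pqr V E by (auto intro!: pins_card edges_within_mono[OF E(3)] intro: finite_subset)
    then have pq: "p \<noteq> q" "p \<noteq> r" using F(2) by auto
    have "g p \<noteq> g q"
    proof
      assume eq: "g p = g q"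
      \<comment> \<open>Shifting by the common value at \<open>p\<close> and \<open>q\<close> keeps
        the coboundary and makes the potential vanish at both. It then lies in the kernel of the
        matrix for \<open>{p, q}\<close> and \<open>{p, r}\<close>, which \<open>f\<close> makes
        nonsingular.\<close>
      define h where "h v = (if v \<in> V then g v + g p else 0)" for v
      have dh: "diff ep e h = diff ep e g" if "e \<in> E" for e
      proof -
        have "diff ep e h = diff ep e (\<lambda>v. g v + g p)"
          using diff_cong[OF E(3) that, of h "\<lambda>v. g v + g p"] by (simp add: h_def)
        also have "\<dots> = diff ep e g" by (simp add: diff_def)
        finally show ?thesis .
      qed
      have "h v = 0" if "v \<notin> V - {p, q}" for v using that eq by (auto simp: h_def)
      moreover have "diff ep e h = 0" if "e \<in> Z" for e using that E(2) gZ dh by auto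
      moreover have "diff ep e h = x e" if "e \<in> E - Z" for e using that gE dh by auto
      moreover have c2: "card {p, q} = 2" "card {p, r} = 2" using pq by auto
      moreover have "{p, q} \<subseteq> V" "{p, r} \<subseteq> V" using pqr by auto
      from iffD1[OF odd_card_common_pins[OF V(1) this _ E, unfolded c2, OF refl] f]
      have "(\<forall>v. v \<notin> V - {p, q} \<longrightarrow> h v = 0) \<and> (\<forall>e. e \<notin> E \<longrightarrow> x e = 0) \<and>
        (\<forall>v\<in>V - {p, r}. divergence ep E x v = 0) \<and> (\<forall>e\<in>Z. diff ep e h = 0) \<and>
        (\<forall>e\<in>E - Z. diff ep e h = x e) \<longrightarrow> (\<forall>v. h v = 0) \<and> (\<forall>e. x e = 0)"
        by blast
      ultimately have "(\<forall>v. h v = 0) \<and> (\<forall>e. x e = 0)" using x0 div by blast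
      then have hx: "h v = 0" "x e = 0" for v e by auto
      have "g v = g p" if "v \<in> V" for v using hx(1)[of v] that by (simp add: h_def)
      then have const: "v \<in> V \<Longrightarrow> g v = g p" for v .
      have "g c = g p" "g c = 0" using const[OF V(4)] g0[of c] by blast+
      then have "g v = 0" for v using const[of v] g0[of v] by (cases "v \<in> V") simp_all
      then show False using ne hx by blast
    qed
    then show ?thesis using pq by blast
  qed
  have "g a \<noteq> g b" "g a \<noteq> g c" "g b \<noteq> g c"
    using sep[of a b c] sep[of a c b, unfolded conj_commute[of "pins ep V {a, c} _"]]
      sep[of b c a, unfolded conj_commute[of "pins ep V {b, c} _"]] fa fb V by blast+
  then show False by (cases "g a"; cases "g b"; cases "g c") simp_all
qed

text \<open>Acyclicity is replaced by the number of edges; the second conjunct expresses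
  connectedness through flat functions.\<close>

definition span_tree :: "('e \<Rightarrow> 'v set) \<Rightarrow> 'v set \<Rightarrow> 'e set \<Rightarrow> bool" where
  "span_tree ep V T \<longleftrightarrow> card T + 1 = card V \<and> (\<forall>g. flat ep T g \<longrightarrow> (\<forall>x\<in>V. \<forall>y\<in>V. g x = g y))"

lemma pins_singleton_iff:
  assumes "c \<in> V"
  shows "pins ep V {c} T \<longleftrightarrow> (\<forall>g. flat ep T g \<longrightarrow> (\<forall>x\<in>V. \<forall>y\<in>V. g x = g y))"
proof (intro iffI allI impI ballI)
  fix g x y assume p: "pins ep V {c} T" and g: "flat ep T g" and xy: "x \<in> V" "y \<in> V"
  have "\<forall>x\<in>V. g x + g c = 0"
    using p[unfolded pins_def, rule_format, of "\<lambda>x. g x + g c"] flat_add_const[OF g] by simp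
  then show "g x = g y" using xy by simp
next
  assume "\<forall>g. flat ep T g \<longrightarrow> (\<forall>x\<in>V. \<forall>y\<in>V. g x = g y)"
  then show "pins ep V {c} T" unfolding pins_def using assms by (metis singletonI)
qed

lemma span_tree_iff_pins:
  "c \<in> V \<Longrightarrow> span_tree ep V T \<longleftrightarrow> card T + 1 = card V \<and> pins ep V {c} T"
  unfolding span_tree_def by (simp only: pins_singleton_iff)

section \<open>Paths, cycles and agreement with the graph-theoretic definitions\<close>

definition reachable_by :: "('e \<Rightarrow> 'v set) \<Rightarrow> 'e set \<Rightarrow> 'v \<Rightarrow> 'v \<Rightarrow> bool" where
  "reachable_by ep D = (\<lambda>x y. \<exists>e\<in>D. ep e = {x, y})\<^sup>*\<^sup>*"

lemma flat_reachable:
  assumes "reachable_by ep D x y" "flat ep D g"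
  shows "g x = g y"
  using assms(1) unfolding reachable_by_def
proof (induction rule: rtranclp_induct)
  case (step y z)
  then obtain e where "e \<in> D" "ep e = {y, z}" by blast
  then have "g y = g z" using assms(2) unfolding flat_def by blast
  with step show ?case by simp
qed simp

text \<open>The indicator of the vertices reachable from \<open>x\<close> is flat, hence a
  legitimate test function.\<close>

lemma reachable_if_flat:
  assumes "\<And>g. flat ep D g \<Longrightarrow> g x = g y" "edges_within ep V D"
  shows "reachable_by ep D x y"
proof -
  define g where "g z = (of_bool (reachable_by ep D x z) :: bit)" for z
  have "flat ep D g"
    unfolding flat_def
  proof (intro ballI)
    fix e p q assume e: "e \<in> D" "p \<in> ep e" "q \<in> ep e"
    show "g p = g q"
    proof (cases "p = q")
      case False
      obtain x' y' where "ep e = {x', y'}" using e(1) assms(2) unfolding edges_within_def by blast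
      then have "ep e = {p, q}" "ep e = {q, p}" using e False by auto
      then have "reachable_by ep D x p \<longleftrightarrow> reachable_by ep D x q"
        unfolding reachable_by_def using e(1) by (blast intro: rtranclp.rtrancl_into_rtrancl)
      then show ?thesis by (simp add: g_def)
    qed simp
  qed
  then have "g x = g y" by (rule assms(1))
  moreover have "g x = 1" by (simp add: g_def reachable_by_def)
  ultimately show ?thesis by (simp add: g_def split: if_splits)
qed

lemma simple_path_exists:
  assumes "reachable_by ep D p q"
  shows "\<exists>xs es. length xs = Suc (length es) \<and> distinct xs \<and> xs ! 0 = p \<and> xs ! length es = q \<and>
    set es \<subseteq> D \<and> (\<forall>i<length es. ep (es ! i) = {xs ! i, xs ! Suc i})"
  using assms unfolding reachable_by_def
proof (induction rule: rtranclp_induct)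
  case base
  show ?case by (intro exI[of _ "[p]"] exI[of _ "[]"]) simp
next
  case (step y z)
  then obtain xs es f where P: "length xs = Suc (length es)" "distinct xs" "xs ! 0 = p"
    "xs ! length es = y" "set es \<subseteq> D" "\<And>i. i < length es \<Longrightarrow> ep (es ! i) = {xs ! i, xs ! Suc i}"
    and f: "f \<in> D" "ep f = {y, z}" by blast
  show ?case
  proof (cases "z \<in> set xs")
    \<comment> \<open>The new edge returns to a vertex of the path, which is cut back to that
      vertex.\<close>
    case True
    then obtain k where k: "k < length xs" "xs ! k = z" by (auto simp: in_set_conv_nth)
    show ?thesis
    proof (intro exI conjI)
      show "length (take (Suc k) xs) = Suc (length (take k es))" using k P(1) by simp
      show "distinct (take (Suc k) xs)" using P(2) by simp
      show "take (Suc k) xs ! 0 = p" using P(3) by simp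
      show "take (Suc k) xs ! length (take k es) = z" using k P(1) by simp
      show "set (take k es) \<subseteq> D" using P(5) by (meson set_take_subset subset_trans)
      show "\<forall>i<length (take k es). ep (take k es ! i) = {take (Suc k) xs ! i, take (Suc k) xs ! Suc i}"
        using P(6) by simp
    qed
  next
    case False
    show ?thesis
    proof (intro exI conjI)
      show "length (xs @ [z]) = Suc (length (es @ [f]))" using P(1) by simp
      show "distinct (xs @ [z])" using P(2) False by simp
      show "(xs @ [z]) ! 0 = p" using P(1,3) by (simp add: nth_append)
      show "(xs @ [z]) ! length (es @ [f]) = z" using P(1) by (simp add: nth_append)
      show "set (es @ [f]) \<subseteq> D" using P(5) f by simp
      show "\<forall>i<length (es @ [f]). ep ((es @ [f]) ! i) = {(xs @ [z]) ! i, (xs @ [z]) ! Suc i}"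
        using P(1,4,6) f by (auto simp: nth_append less_Suc_eq)
    qed
  qed
qed

lemma finite_multigraph_edges_within:
  "finite_multigraph G \<Longrightarrow> edges_within (ends G) (vertices G) (edges G)"
  by (simp add: finite_multigraph_def edges_within_def)

lemma connected_graph_iff_flat:
  assumes "edges_within (ends G) (vertices G) (edges G)"
  shows "connected_graph G \<longleftrightarrow> vertices G \<noteq> {} \<and>
    (\<forall>g. flat (ends G) (edges G) g \<longrightarrow> (\<forall>x\<in>vertices G. \<forall>y\<in>vertices G. g x = g y))"
proof -
  have adj: "(adjacent G)\<^sup>*\<^sup>* = reachable_by (ends G) (edges G)"
    by (simp add: reachable_by_def adjacent_def[abs_def])
  show ?thesis
    unfolding connected_graph_def adj
    using flat_reachable[of "ends G" "edges G"] reachable_if_flat[OF _ assms] by blast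
qed

text \<open>The rest of the cycle already connects the two ends of its first edge.\<close>

lemma cycle_flat:
  assumes "is_cycle G xs es" "flat (ends G) (edges G - {es ! 0}) g"
  shows "flat (ends G) (edges G) g"
proof -
  define n where "n = length es"
  have n: "n > 0" "length xs = n" "distinct es" "set es \<subseteq> edges G"
    "\<And>i. i < n \<Longrightarrow> ends G (es ! i) = {xs ! i, xs ! (Suc i mod n)}"
    using assms(1) unfolding is_cycle_def n_def by auto
  have step: "g (xs ! i) = g (xs ! (Suc i mod n))" if "i < n" "i > 0" for i
  proof -
    have "es ! i \<noteq> es ! 0" using n that unfolding n_def by (simp add: nth_eq_iff_index_eq)
    moreover have "es ! i \<in> edges G" using n that unfolding n_def by auto
    ultimately have "es ! i \<in> edges G - {es ! 0}" by blast
    then show ?thesis using assms(2) n(5)[OF that(1)] unfolding flat_def by blast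
  qed
  have const: "g (xs ! (Suc i mod n)) = g (xs ! (Suc 0 mod n))" if "i < n" for i
    using that
  proof (induction i)
    case (Suc i)
    then have "Suc i mod n = Suc i" by simp
    then show ?case using Suc step[of "Suc i"] by simp
  qed simp
  have "g (xs ! 0) = g (xs ! (Suc 0 mod n))" using const[of "n - 1"] n(1) by simp
  moreover have "ends G (es ! 0) = {xs ! 0, xs ! (Suc 0 mod n)}" using n(1,5) by blast
  ultimately have "flat (ends G) (insert (es ! 0) (edges G - {es ! 0})) g"
    using assms(2) flat_insert[of "ends G" "es ! 0" "xs ! 0" "xs ! (Suc 0 mod n)"] by blast
  then show ?thesis by (rule flat_mono) auto
qed

text \<open>A simple path from \<open>p\<close> to \<open>q\<close> that avoids \<open>e\<close>
  closes up with \<open>e\<close>. If \<open>p = q\<close> the path is trivial and the cycle is the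
  loop \<open>e\<close>.\<close>

lemma cycle_if_redundant_edge:
  assumes e: "e \<in> edges G" "ends G e = {p, q}"
    and ew: "edges_within (ends G) (vertices G) (edges G)"
    and red: "\<And>g. flat (ends G) (edges G - {e}) g \<Longrightarrow> g p = g q"
  shows "\<exists>xs es. is_cycle G xs es"
proof -
  have "reachable_by (ends G) (edges G - {e}) p q"
    using red edges_within_mono[OF ew] by (intro reachable_if_flat[of "ends G" _ p q "vertices G"]) auto
  from simple_path_exists[OF this] obtain xs es where
    P: "length xs = Suc (length es)" "distinct xs" "xs ! 0 = p"
    "xs ! length es = q" "set es \<subseteq> edges G - {e}"
    "\<And>i. i < length es \<Longrightarrow> ends G (es ! i) = {xs ! i, xs ! Suc i}" by blast
  have "distinct es"
    unfolding distinct_conv_nth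
  proof (intro allI impI notI)
    fix i j assume ij: "i < length es" "j < length es" "i \<noteq> j" "es ! i = es ! j"
    then have "{xs ! i, xs ! Suc i} = {xs ! j, xs ! Suc j}" using P(6) by metis
    then show False
      using ij P(1,2) by (auto simp: doubleton_eq_iff nth_eq_iff_index_eq)
  qed
  moreover have "set xs \<subseteq> vertices G"
  proof
    fix x assume "x \<in> set xs"
    then obtain i where i: "i < length xs" "x = xs ! i" by (auto simp: in_set_conv_nth)
    show "x \<in> vertices G"
    proof (cases "i < length es")
      case True
      then have "es ! i \<in> edges G" using P(5) nth_mem by blast
      moreover have "x \<in> ends G (es ! i)" using P(6)[OF True] i(2) by simp
      ultimately show ?thesis using ew unfolding edges_within_def by fastforce
    next
      case False
      then have "x = q" using i P(1,4) by (metis less_SucE)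
      then show ?thesis using e ew unfolding edges_within_def by fastforce
    qed
  qed
  moreover have "\<forall>i<length (es @ [e]). ends G ((es @ [e]) ! i) = {xs ! i, xs ! (Suc i mod length (es @ [e]))}"
  proof (intro allI impI)
    fix i assume "i < length (es @ [e])"
    then consider "i < length es" | "i = length es" by fastforce
    then show "ends G ((es @ [e]) ! i) = {xs ! i, xs ! (Suc i mod length (es @ [e]))}"
    proof cases
      case 1
      then have "Suc i mod length (es @ [e]) = Suc i" by (intro mod_less) simp
      then show ?thesis using P(6)[OF 1] 1 by (simp only: nth_append if_True)
    next
      case 2
      then show ?thesis using P(3,4) e(2) by (simp add: insert_commute)
    qed
  qed
  ultimately have "is_cycle G xs (es @ [e])"
    using P(1,2,5) e(1) unfolding is_cycle_def by auto
  then show ?thesis by blast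
qed

text \<open>A linear relation among the edges of a connected graph makes an edge redundant and thus
  yields a cycle; without cycles independence bounds the number of edges. Conversely an edge of a
  cycle could be deleted, leaving too few edges to connect the vertices.\<close>

lemma is_tree_iff_span_tree:
  assumes fin: "finite (vertices G)" "finite (edges G)"
    and ew: "edges_within (ends G) (vertices G) (edges G)"
  shows "is_tree G \<longleftrightarrow> span_tree (ends G) (vertices G) (edges G)"
proof
  assume t: "is_tree G"
  then obtain c where c: "c \<in> vertices G" unfolding is_tree_def connected_graph_def by blast
  have pins: "pins (ends G) (vertices G) {c} (edges G)"
    using t unfolding pins_singleton_iff[OF c] is_tree_def connected_graph_iff_flat[OF ew] by blast
  then have "card (vertices G) \<le> card (edges G) + 1"
    using pins_card[OF pins fin(1) _ fin(2) ew] c by simp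
  moreover have "indep (ends G) (vertices G) {c} (edges G)"
    unfolding indep_def
  proof (intro allI impI ballI, rule ccontr)
    fix x e assume div0: "\<forall>v\<in>vertices G - {c}. divergence (ends G) (edges G) x v = 0"
      and e: "e \<in> edges G" "x e \<noteq> 0"
    obtain p q where pq: "ends G e = {p, q}" using e ew unfolding edges_within_def by blast
    have "\<exists>xs es. is_cycle G xs es"
    proof (rule cycle_if_redundant_edge[OF e(1) pq ew])
      fix g assume g: "flat (ends G) (edges G - {e}) g"
      define h where "h v = g v + g c" for v
      have h: "flat (ends G) (edges G - {e}) h" unfolding h_def using g by (rule flat_add_const)
      have "0 = (\<Sum>v\<in>vertices G. h v * divergence (ends G) (edges G) x v)"
      proof (rule sum.neutral[symmetric], rule ballI)
        fix v assume "v \<in> vertices G"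
        then show "h v * divergence (ends G) (edges G) x v = 0"
          using div0 by (cases "v = c") (simp_all add: h_def)
      qed
      also have "\<dots> = (\<Sum>e\<in>edges G. x e * diff (ends G) e h)" using sum_divergence[OF ew fin(1)] by simp
      also have "\<dots> = x e * diff (ends G) e h"
        using h e(1) fin(2) unfolding flat_iff_diff by (subst sum.remove[of _ e]) auto
      finally have "h p + h q = 0" using e(2) diff_ends[of "ends G" e p q h] pq by simp
      then show "g p = g q" by (simp add: h_def)
    qed
    then show False using t unfolding is_tree_def by blast
  qed
  then have "card (edges G) \<le> card (vertices G - {c})" using indep_card fin by blast
  moreover have "card (vertices G - {c}) + 1 = card (vertices G)"
    using c fin by (metis Suc_eq_plus1 card_Suc_Diff1)
  ultimately show "span_tree (ends G) (vertices G) (edges G)"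
    unfolding span_tree_iff_pins[OF c] using pins by linarith
next
  assume s: "span_tree (ends G) (vertices G) (edges G)"
  then have "card (vertices G) \<noteq> 0" unfolding span_tree_def by linarith
  then obtain c where c: "c \<in> vertices G" by fastforce
  have "\<nexists>xs es. is_cycle G xs es"
  proof
    assume "\<exists>xs es. is_cycle G xs es"
    then obtain xs es where cyc: "is_cycle G xs es" by blast
    let ?e = "es ! 0"
    have e: "?e \<in> edges G" using cyc unfolding is_cycle_def by auto
    have "pins (ends G) (vertices G) {c} (edges G - {?e})"
      using s cycle_flat[OF cyc] unfolding span_tree_def pins_singleton_iff[OF c] by blast
    from pins_card[OF this fin(1) _ _ edges_within_mono[OF ew]] c fin
    have "card (vertices G) \<le> 1 + card (edges G - {?e})" by simp
    moreover have "card (edges G) > 0" using e fin card_gt_0_iff by blast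
    ultimately show False using s e fin unfolding span_tree_def by simp
  qed
  then show "is_tree G"
    using s c unfolding is_tree_def connected_graph_iff_flat[OF ew] span_tree_def by blast
qed

lemma spanning_trees_eq:
  assumes "finite_multigraph G"
  shows "spanning_trees G = {T \<in> Pow (edges G). span_tree (ends G) (vertices G) T}"
proof -
  have "is_tree (G\<lparr>edges := T\<rparr>) \<longleftrightarrow> span_tree (ends G) (vertices G) T" if "T \<subseteq> edges G" for T
  proof -
    have "edges_within (ends G) (vertices G) T"
      using finite_multigraph_edges_within[OF assms] that by (rule edges_within_mono)
    moreover have "finite (vertices G)" "finite T"
      using assms that finite_subset[OF that] by (simp_all add: finite_multigraph_def)
    ultimately show ?thesis using is_tree_iff_span_tree[of "G\<lparr>edges := T\<rparr>"] by simp
  qed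
  then show ?thesis unfolding spanning_trees_def by blast
qed

text \<open>A point over the field with two elements is given by the set \<open>Z\<close> of its
  zero coordinates, and the monomial of a tree \<open>T\<close> has the value 1 there exactly if
  \<open>Z \<subseteq> T\<close>.\<close>

lemma point_count_bit_eq:
  fixes G :: "('v, 'e) multigraph"
  assumes "finite_multigraph G"
  shows "point_count TYPE(bit) G = card {Z \<in> Pow (edges G).
    even (card {T \<in> Pow (edges G). Z \<subseteq> T \<and> span_tree (ends G) (vertices G) T})}"
proof -
  let ?E = "edges G" and ?ST = "spanning_trees G"
  have fin: "finite ?E" using assms by (simp add: finite_multigraph_def)
  have finST: "finite ?ST" unfolding spanning_trees_eq[OF assms] using fin by simp
  have k: "kirchhoff G \<alpha> = of_nat (card {T \<in> ?ST. {e \<in> ?E. \<alpha> e = 0} \<subseteq> T})" for \<alpha> :: "'e \<Rightarrow> bit"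
  proof -
    have "(\<Prod>e\<in>?E - T. \<alpha> e) = of_bool ({e \<in> ?E. \<alpha> e = 0} \<subseteq> T)" for T
    proof (cases "{e \<in> ?E. \<alpha> e = 0} \<subseteq> T")
      case True
      then have "\<alpha> e = 1" if "e \<in> ?E - T" for e using that bit_not_zero_iff by blast
      then show ?thesis using True by simp
    next
      case False
      then obtain e where "e \<in> ?E - T" "\<alpha> e = 0" by blast
      then show ?thesis using False fin by (subst prod_zero) auto
    qed
    then show ?thesis unfolding kirchhoff_def using finST by (simp add: Int_def)
  qed
  have zero: "(of_nat n :: bit) = 0 \<longleftrightarrow> even n" for n
    by (induction n) (auto simp: bit_not_zero_iff)
  have "bij_betw (\<lambda>\<alpha>. {e \<in> ?E. \<alpha> e = 0})
      {\<alpha> \<in> ?E \<rightarrow>\<^sub>E (UNIV :: bit set). kirchhoff G \<alpha> = 0}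
      {Z \<in> Pow ?E. even (card {T \<in> ?ST. Z \<subseteq> T})}"
  proof (rule bij_betwI[where g = "\<lambda>Z. \<lambda>e\<in>?E. of_bool (e \<notin> Z)"])
    show "(\<lambda>Z. \<lambda>e\<in>?E. of_bool (e \<notin> Z)) \<in> {Z \<in> Pow ?E. even (card {T \<in> ?ST. Z \<subseteq> T})} \<rightarrow>
      {\<alpha> \<in> ?E \<rightarrow>\<^sub>E (UNIV :: bit set). kirchhoff G \<alpha> = 0}"
    proof
      fix Z assume Z: "Z \<in> {Z \<in> Pow ?E. even (card {T \<in> ?ST. Z \<subseteq> T})}"
      have "{e \<in> ?E. (\<lambda>e\<in>?E. of_bool (e \<notin> Z)) e = (0::bit)} = Z" using Z by auto
      then have "kirchhoff G (\<lambda>e\<in>?E. of_bool (e \<notin> Z) :: bit) = 0"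
        unfolding k zero using Z by simp
      then show "(\<lambda>e\<in>?E. of_bool (e \<notin> Z)) \<in> {\<alpha> \<in> ?E \<rightarrow>\<^sub>E (UNIV :: bit set). kirchhoff G \<alpha> = 0}"
        by simp
    qed
  next
    fix \<alpha> assume \<alpha>: "\<alpha> \<in> {\<alpha> \<in> ?E \<rightarrow>\<^sub>E (UNIV :: bit set). kirchhoff G \<alpha> = 0}"
    show "(\<lambda>e\<in>?E. of_bool (e \<notin> {e \<in> ?E. \<alpha> e = 0})) = \<alpha>"
    proof (rule ext)
      fix e show "(\<lambda>e\<in>?E. of_bool (e \<notin> {e \<in> ?E. \<alpha> e = 0})) e = \<alpha> e"
      proof (cases "e \<in> ?E")
        case True
        then show ?thesis by (cases "\<alpha> e") simp_all
      next
        case False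
        then have "\<alpha> e = undefined" using \<alpha> by (intro PiE_arb) auto
        then show ?thesis using False by simp
      qed
    qed
  qed (auto simp: k zero)
  from bij_betw_same_card[OF this] show ?thesis
    unfolding point_count_def spanning_trees_eq[OF assms] by (simp only: mem_Collect_eq conj_ac)
qed

text \<open>Normalising a potential to 0 at \<open>w\<close> turns the edges at \<open>w\<close>
  into the condition that it vanishes at the neighbours. The map \<open>\<nu>\<close> need not be
  injective, which admits parallel edges.\<close>

lemma span_tree_star:
  assumes "finite V" "w \<notin> V" "edges_within ep V F" "finite F" "finite A" "F \<inter> A = {}"
    and star: "\<And>j. j \<in> A \<Longrightarrow> ep j = {w, \<nu> j} \<and> \<nu> j \<in> V"
  shows "span_tree ep (insert w V) (F \<union> A) \<longleftrightarrow> card F + card A = card V \<and> pins ep V (\<nu> ` A) F"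
proof -
  have flat: "flat ep (F \<union> A) g \<longleftrightarrow> flat ep F g \<and> (\<forall>j\<in>A. g (\<nu> j) = g w)" for g
    unfolding flat_iff_diff ball_Un using diff_ends[of ep _ w "\<nu> _" g] star by auto
  have "(\<forall>g. flat ep (F \<union> A) g \<longrightarrow> (\<forall>x\<in>insert w V. \<forall>y\<in>insert w V. g x = g y)) \<longleftrightarrow> pins ep V (\<nu> ` A) F"
    (is "?L \<longleftrightarrow> ?R")
  proof
    assume L: ?L
    show ?R
      unfolding pins_def
    proof (intro allI impI)
      fix g assume g: "flat ep F g \<and> (\<forall>x\<in>\<nu> ` A. g x = 0)"
      define h where "h = g(w := 0)"
      have hV: "h v = g v" if "v \<in> V" for v using that assms(2) by (auto simp: h_def)
      have "flat ep F h"
        using g diff_cong[OF assms(3), of _ h g] hV unfolding flat_iff_diff by simp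
      moreover have "\<forall>j\<in>A. h (\<nu> j) = h w" using g hV star by (auto simp: h_def)
      ultimately have "\<forall>x\<in>insert w V. \<forall>y\<in>insert w V. h x = h y" using L flat by blast
      then show "\<forall>x\<in>V. g x = 0" using hV by (metis fun_upd_same h_def insertCI)
    qed
  next
    assume R: ?R
    show ?L
    proof (intro allI impI)
      fix g assume g: "flat ep (F \<union> A) g"
      have "flat ep F (\<lambda>x. g x + g w)" using g flat by (intro flat_add_const) blast
      moreover have "\<forall>x\<in>\<nu> ` A. g x + g w = 0" using g flat by simp
      ultimately have "\<forall>x\<in>V. g x + g w = 0" using R unfolding pins_def by blast
      then have "g x = g w" if "x \<in> insert w V" for x using that by auto
      then show "\<forall>x\<in>insert w V. \<forall>y\<in>insert w V. g x = g y" by metis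
    qed
  qed
  then show ?thesis
    unfolding span_tree_def using assms by (auto simp: card_Un_disjoint)
qed

section \<open>Resolving a vertex of a 4-regular graph\<close>

definition binds :: "('e \<Rightarrow> 'v set) \<Rightarrow> 'v set \<Rightarrow> 'e set \<Rightarrow> (('v \<Rightarrow> bit) \<Rightarrow> bool) \<Rightarrow> bool" where
  "binds ep V T P \<longleftrightarrow> (\<forall>g. flat ep T g \<and> P g \<longrightarrow> (\<forall>x\<in>V. \<forall>y\<in>V. g x = g y))"

lemma pins_iff_binds:
  assumes "p \<in> R" "R \<subseteq> V"
  shows "pins ep V R T \<longleftrightarrow> binds ep V T (\<lambda>g. \<forall>r\<in>R. g r = g p)"
proof
  assume p: "pins ep V R T"
  show "binds ep V T (\<lambda>g. \<forall>r\<in>R. g r = g p)"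
    unfolding binds_def
  proof (intro allI impI ballI)
    fix g x y assume g: "flat ep T g \<and> (\<forall>r\<in>R. g r = g p)" and xy: "x \<in> V" "y \<in> V"
    have "flat ep T (\<lambda>x. g x + g p)" using g by (intro flat_add_const) blast
    moreover have "\<forall>r\<in>R. g r + g p = 0" using g by simp
    ultimately have "\<forall>x\<in>V. g x + g p = 0" using p unfolding pins_def by blast
    then show "g x = g y" using xy by simp
  qed
next
  assume b: "binds ep V T (\<lambda>g. \<forall>r\<in>R. g r = g p)"
  show "pins ep V R T"
    unfolding pins_def
  proof (intro allI impI ballI)
    fix g x assume g: "flat ep T g \<and> (\<forall>x\<in>R. g x = 0)" and x: "x \<in> V"
    then have "\<forall>r\<in>R. g r = g p" using assms by simp
    then have "g x = g p" using b g x assms unfolding binds_def by blast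
    then show "g x = 0" using g assms by simp
  qed
qed

lemma pins_empty: "x \<in> V \<Longrightarrow> \<not> pins ep V {} T"
  unfolding pins_def by (auto simp: flat_iff_diff diff_def intro!: exI[of _ "\<lambda>_. 1"])

definition glued :: "('e \<Rightarrow> 'v set) \<Rightarrow> 'e set \<Rightarrow> 'v \<Rightarrow> 'v \<Rightarrow> bool" where
  "glued ep T p q \<longleftrightarrow> (\<forall>g. flat ep T g \<longrightarrow> g p = g q)"

lemma glued_sym: "glued ep T p q \<longleftrightarrow> glued ep T q p"
  unfolding glued_def by metis

definition bind3 :: "('e \<Rightarrow> 'v set) \<Rightarrow> 'v set \<Rightarrow> 'e set \<Rightarrow> 'v \<Rightarrow> 'v \<Rightarrow> 'v \<Rightarrow> bool" where
  "bind3 ep V T p q r \<longleftrightarrow> binds ep V T (\<lambda>g. g p = g q \<and> g q = g r)"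

definition bind22 :: "('e \<Rightarrow> 'v set) \<Rightarrow> 'v set \<Rightarrow> 'e set \<Rightarrow> 'v \<Rightarrow> 'v \<Rightarrow> 'v \<Rightarrow> 'v \<Rightarrow> bool" where
  "bind22 ep V T p q r s \<longleftrightarrow> binds ep V T (\<lambda>g. g p = g q \<and> g r = g s)"

lemma flat_comp3:
  assumes "flat ep T g1" "flat ep T g2" "flat ep T g3"
  shows "flat ep T (\<lambda>x. f (g1 x) (g2 x) (g3 x))"
  unfolding flat_def
proof (intro ballI)
  fix e x y assume "e \<in> T" "x \<in> ep e" "y \<in> ep e"
  then have "g1 x = g1 y" "g2 x = g2 y" "g3 x = g3 y" using assms unfolding flat_def by blast+
  then show "f (g1 x) (g2 x) (g3 x) = f (g1 y) (g2 y) (g3 y)" by simp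
qed

lemma isolate_vertex:
  assumes "\<not> glued ep T p q" "\<not> glued ep T p r" "\<not> glued ep T p s"
  shows "\<exists>h. flat ep T h \<and> h p = 0 \<and> h q = 1 \<and> h r = 1 \<and> h s = 1"
proof -
  obtain g1 g2 g3 where g: "flat ep T g1" "flat ep T g2" "flat ep T g3"
    and ne: "g1 p \<noteq> g1 q" "g2 p \<noteq> g2 r" "g3 p \<noteq> g3 s"
    using assms unfolding glued_def by blast
  define h where "h x = (of_bool (g1 x \<noteq> g1 p \<or> g2 x \<noteq> g2 p \<or> g3 x \<noteq> g3 p) :: bit)" for x
  have "flat ep T h" unfolding h_def
    by (rule flat_comp3[OF g, of "\<lambda>a b c. of_bool (a \<noteq> g1 p \<or> b \<noteq> g2 p \<or> c \<noteq> g3 p)"])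
  moreover have "h p = 0 \<and> h q = 1 \<and> h r = 1 \<and> h s = 1" using ne by (simp add: h_def)
  ultimately show ?thesis by blast
qed

lemma not_bind3_if_isolated:
  assumes "\<not> glued ep T s p" "\<not> glued ep T s q" "\<not> glued ep T s r" "p \<in> V" "s \<in> V"
  shows "\<not> bind3 ep V T p q r"
proof -
  obtain h where "flat ep T h" "h s = 0" "h p = 1" "h q = 1" "h r = 1"
    using isolate_vertex[OF assms(1-3)] by blast
  then show ?thesis unfolding bind3_def binds_def using assms(4,5) by (metis zero_neq_one)
qed

text \<open>Among the four vertices the product \<open>h * k\<close> vanishes exactly at
  \<open>r\<close> and \<open>s\<close>: it respects both pairs but separates them from each
  other.\<close>

lemma not_bind22_if_isolated:
  assumes "\<not> glued ep T r p" "\<not> glued ep T r q" "\<not> glued ep T r s"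
    "\<not> glued ep T s p" "\<not> glued ep T s q" "p \<in> V" "r \<in> V"
  shows "\<not> bind22 ep V T p q r s"
proof -
  obtain h where h: "flat ep T h" "h r = 0" "h p = 1" "h q = 1" "h s = 1"
    using isolate_vertex[OF assms(1-3)] by blast
  have "\<not> glued ep T s r" using assms(3) glued_sym by metis
  then obtain k where k: "flat ep T k" "k s = 0" "k p = 1" "k q = 1" "k r = 1"
    using isolate_vertex[OF assms(4,5), of r] by blast
  have "flat ep T (\<lambda>x. h x * k x)" using flat_comp3[OF h(1) k(1) k(1), of "\<lambda>a b c. a * b"] .
  moreover have "h p * k p = h q * k q \<and> h r * k r = h s * k s" "h p * k p \<noteq> h r * k r"
    using h k by simp_all
  ultimately show ?thesis unfolding bind22_def binds_def using assms(6,7) by blast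
qed

text \<open>With \<open>card T + 3 = card V\<close> at least three components remain, and one
  identification merges only two.\<close>

lemma not_binds_pair:
  assumes fin: "finite V" "finite T" and ew: "edges_within ep V T" and c: "card T + 3 = card V"
    and pr: "p \<in> V" "r \<in> V"
  shows "\<not> binds ep V T (\<lambda>g. g p = g r)"
proof
  assume b: "binds ep V T (\<lambda>g. g p = g r)"
  have "pins ep V {p, r} T"
    using b pins_iff_binds[of p "{p, r}" V ep T] pr unfolding binds_def by simp
  from pins_card[OF this fin(1) _ fin(2) ew] pr have "card V \<le> card {p, r} + card T" by simp
  moreover have "card {p, r} \<le> 2" by (simp add: card_insert_if)
  ultimately show False using c by linarith
qed

lemma binds_cong:
  "(\<And>g. flat ep T g \<Longrightarrow> P g \<longleftrightarrow> Q g) \<Longrightarrow> binds ep V T P \<longleftrightarrow> binds ep V T Q"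
  unfolding binds_def by blast

text \<open>Identifying \<open>p\<close> with \<open>q\<close> gains nothing. Triples and matchings
  containing this pair fall one identification short, and the other two triples and two matchings
  all impose the same conditions.\<close>

lemma glued_binds:
  assumes fin: "finite V" "finite T" and ew: "edges_within ep V T" and c: "card T + 3 = card V"
    and V: "p \<in> V" "q \<in> V" "r \<in> V" "s \<in> V" and gl: "glued ep T p q"
  shows "\<not> bind3 ep V T p q r" "\<not> bind3 ep V T p q s" "\<not> bind22 ep V T p q r s"
    "bind3 ep V T p r s \<longleftrightarrow> bind22 ep V T p r q s" "bind3 ep V T q r s \<longleftrightarrow> bind22 ep V T p r q s"
    "bind22 ep V T p s q r \<longleftrightarrow> bind22 ep V T p r q s"
proof -
  note np = not_binds_pair[OF fin ew c]
  have eq: "g p = g q" if "flat ep T g" for g using gl that unfolding glued_def by blast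
  have "bind3 ep V T p q r \<longleftrightarrow> binds ep V T (\<lambda>g. g p = g r)"
    unfolding bind3_def bind22_def by (rule binds_cong) (use eq in metis)
  then show "\<not> bind3 ep V T p q r" using np[OF V(1,3)] by blast
  have "bind3 ep V T p q s \<longleftrightarrow> binds ep V T (\<lambda>g. g p = g s)"
    unfolding bind3_def bind22_def by (rule binds_cong) (use eq in metis)
  then show "\<not> bind3 ep V T p q s" using np[OF V(1,4)] by blast
  have "bind22 ep V T p q r s \<longleftrightarrow> binds ep V T (\<lambda>g. g r = g s)"
    unfolding bind3_def bind22_def by (rule binds_cong) (use eq in metis)
  then show "\<not> bind22 ep V T p q r s" using np[OF V(3,4)] by blast
  show "bind3 ep V T p r s \<longleftrightarrow> bind22 ep V T p r q s" "bind3 ep V T q r s \<longleftrightarrow> bind22 ep V T p r q s"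
    "bind22 ep V T p s q r \<longleftrightarrow> bind22 ep V T p r q s"
    unfolding bind3_def bind22_def by (rule binds_cong; use eq in metis)+
qed

text \<open>Both sides vanish unless two of the four vertices lie in the same component.\<close>

lemma triples_eq_matchings:
  assumes fin: "finite V" "finite T" and ew: "edges_within ep V T" and c: "card T + 3 = card V"
    and V: "p \<in> V" "q \<in> V" "r \<in> V" "s \<in> V"
  shows "of_bool (bind3 ep V T p q r) + of_bool (bind3 ep V T p q s) + of_bool (bind3 ep V T p r s) +
      of_bool (bind3 ep V T q r s) =
    (of_bool (bind22 ep V T p q r s) + of_bool (bind22 ep V T p r q s) + of_bool (bind22 ep V T p s q r) :: nat)"
proof -
  note gb = glued_binds[OF fin ew c]
  have s3: "bind3 ep V T q p r = bind3 ep V T p q r" "bind3 ep V T q p s = bind3 ep V T p q s"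
    "bind3 ep V T r p s = bind3 ep V T p r s" "bind3 ep V T r q s = bind3 ep V T q r s"
    "bind3 ep V T p r q = bind3 ep V T p q r" "bind3 ep V T p s q = bind3 ep V T p q s"
    "bind3 ep V T p s r = bind3 ep V T p r s" "bind3 ep V T q s r = bind3 ep V T q r s"
    "bind3 ep V T q r p = bind3 ep V T p q r" "bind3 ep V T q s p = bind3 ep V T p q s"
    "bind3 ep V T r s p = bind3 ep V T p r s" "bind3 ep V T r s q = bind3 ep V T q r s"
    "bind3 ep V T r p q = bind3 ep V T p q r" "bind3 ep V T s p q = bind3 ep V T p q s"
    "bind3 ep V T s p r = bind3 ep V T p r s" "bind3 ep V T s q r = bind3 ep V T q r s"
    unfolding bind3_def bind22_def by (rule binds_cong; metis)+
  have s22: "bind22 ep V T p s r q = bind22 ep V T p s q r" "bind22 ep V T q r p s = bind22 ep V T p s q r"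
    "bind22 ep V T r q s p = bind22 ep V T p s q r" "bind22 ep V T q r s p = bind22 ep V T p s q r"
    "bind22 ep V T p q s r = bind22 ep V T p q r s" "bind22 ep V T q p r s = bind22 ep V T p q r s"
    "bind22 ep V T q p s r = bind22 ep V T p q r s" "bind22 ep V T r s p q = bind22 ep V T p q r s"
    "bind22 ep V T p r s q = bind22 ep V T p r q s" "bind22 ep V T q s r p = bind22 ep V T p r q s"
    "bind22 ep V T q s p r = bind22 ep V T p r q s" "bind22 ep V T r p s q = bind22 ep V T p r q s"
    unfolding bind3_def bind22_def by (rule binds_cong; metis)+
  consider "glued ep T p q" | "glued ep T p r" | "glued ep T p s" | "glued ep T q r" | "glued ep T q s"
    | "glued ep T r s" | "\<not> glued ep T p q" "\<not> glued ep T p r" "\<not> glued ep T p s" "\<not> glued ep T q r"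
      "\<not> glued ep T q s" "\<not> glued ep T r s" by blast
  then show ?thesis
  proof cases
    \<comment> \<open>Both sides are twice the indicator of one condition; the other five pairs
      reduce to this one by the symmetries \<open>s3\<close> and \<open>s22\<close>.\<close>
    case 1
    show ?thesis using gb[OF V(1,2,3,4) 1] unfolding s3 s22 by simp
  next
    case 2
    show ?thesis using gb[OF V(1,3,2,4) 2] unfolding s3 s22 by simp
  next
    case 3
    show ?thesis using gb[OF V(1,4,2,3) 3] unfolding s3 s22 by simp
  next
    case 4
    show ?thesis using gb[OF V(2,3,1,4) 4] unfolding s3 s22 by simp
  next
    case 5
    show ?thesis using gb[OF V(2,4,1,3) 5] unfolding s3 s22 by simp
  next
    case 6
    show ?thesis using gb[OF V(3,4,1,2) 6] unfolding s3 s22 by simp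
  next
    case 7
    have sym: "\<not> glued ep T q p" "\<not> glued ep T r p" "\<not> glued ep T s p"
      "\<not> glued ep T r q" "\<not> glued ep T s q" "\<not> glued ep T s r"
      using 7 glued_sym by metis+
    have "\<not> bind3 ep V T p q r" "\<not> bind3 ep V T p q s" "\<not> bind3 ep V T p r s" "\<not> bind3 ep V T q r s"
      using not_bind3_if_isolated[of ep T s p q r V] not_bind3_if_isolated[of ep T r p q s V]
        not_bind3_if_isolated[of ep T q p r s V] not_bind3_if_isolated[of ep T p q r s V] 7 sym V by simp_all
    moreover have "\<not> bind22 ep V T p q r s" "\<not> bind22 ep V T p r q s" "\<not> bind22 ep V T p s q r"
      using not_bind22_if_isolated[of ep T r p q s V] not_bind22_if_isolated[of ep T q p r s V]
        not_bind22_if_isolated[of ep T q p s r V] 7 sym V by simp_all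
    ultimately show ?thesis by simp
  qed
qed

section \<open>Ordered partitions of the edges into two spanning trees\<close>

definition bipart :: "('e set \<Rightarrow> 'e set \<Rightarrow> bool) \<Rightarrow> 'e set \<Rightarrow> nat" where
  "bipart R N = card {A \<in> Pow N. R A (N - A)}"

definition tree_pairs :: "('e \<Rightarrow> 'v set) \<Rightarrow> 'v set \<Rightarrow> 'e set \<Rightarrow> nat" where
  "tree_pairs ep V = bipart (\<lambda>S T. span_tree ep V S \<and> span_tree ep V T)"

text \<open>Edge sets that become spanning trees once the listed vertices are joined.\<close>

definition tree2 :: "('e \<Rightarrow> 'v set) \<Rightarrow> 'v set \<Rightarrow> 'v \<Rightarrow> 'v \<Rightarrow> 'e set \<Rightarrow> bool" where
  "tree2 ep V p q T \<longleftrightarrow> card T + 2 = card V \<and> binds ep V T (\<lambda>g. g p = g q)"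

definition tree3 :: "('e \<Rightarrow> 'v set) \<Rightarrow> 'v set \<Rightarrow> 'v \<Rightarrow> 'v \<Rightarrow> 'v \<Rightarrow> 'e set \<Rightarrow> bool" where
  "tree3 ep V p q r T \<longleftrightarrow> card T + 3 = card V \<and> bind3 ep V T p q r"

definition tree22 :: "('e \<Rightarrow> 'v set) \<Rightarrow> 'v set \<Rightarrow> 'v \<Rightarrow> 'v \<Rightarrow> 'v \<Rightarrow> 'v \<Rightarrow> 'e set \<Rightarrow> bool" where
  "tree22 ep V p q r s T \<longleftrightarrow> card T + 3 = card V \<and> bind22 ep V T p q r s"

lemma tree3_eq_tree22:
  assumes "finite V" "finite T" "edges_within ep V T" "p \<in> V" "q \<in> V" "r \<in> V" "s \<in> V"
  shows "of_bool (tree3 ep V p q r T) + of_bool (tree3 ep V p q s T) + of_bool (tree3 ep V p r s T) +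
      of_bool (tree3 ep V q r s T) =
    (of_bool (tree22 ep V p q r s T) + of_bool (tree22 ep V p r q s T) + of_bool (tree22 ep V p s q r T) :: nat)"
  using triples_eq_matchings[OF assms(1-3) _ assms(4-7)] unfolding tree3_def tree22_def
  by (cases "card T + 3 = card V") simp_all

text \<open>Absorbing \<open>f\<close> into an argument of \<open>R\<close> preserves the shape of
  the count, so named edges can be distributed one at a time.\<close>

lemma bipart_insert:
  assumes "finite N" "f \<notin> N"
  shows "bipart R (insert f N) = bipart (\<lambda>A B. R A (insert f B)) N + bipart (\<lambda>A. R (insert f A)) N"
proof -
  have "insert f N - A = insert f (N - A) \<and> insert f N - insert f A = N - A" if "A \<in> Pow N" for A
    using assms that by auto
  then have "{A \<in> Pow N. R A (insert f N - A)} = {A \<in> Pow N. R A (insert f (N - A))}"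
    "{A \<in> Pow N. R (insert f A) (insert f N - insert f A)} = {A \<in> Pow N. R (insert f A) (N - A)}"
    by (metis (lifting))+
  then show ?thesis unfolding bipart_def card_Pow_insert_filter[OF assms] by (simp only:)
qed

lemma bipart_empty: "bipart R {} = of_bool (R {} {})"
  unfolding bipart_def by (cases "R {} {}") (simp_all add: Collect_conv_if)

lemma bipart_Un:
  assumes "finite E" "finite N" "E \<inter> N = {}"
  shows "bipart R (E \<union> N) = (\<Sum>T\<in>Pow E. bipart (\<lambda>A B. R (T \<union> A) ((E - T) \<union> B)) N)"
  using assms(2,3)
proof (induction N arbitrary: R rule: finite_induct)
  case empty
  show ?case unfolding bipart_empty using assms(1) by (simp add: bipart_def Int_def)
next
  case (insert f N)
  then have "f \<notin> E \<union> N" "finite (E \<union> N)" "E \<inter> N = {}" using assms(1) by auto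
  then show ?case
    using insert.hyps insert.IH by (simp add: bipart_insert sum.distrib)
qed

context
  fixes ep :: "'e \<Rightarrow> 'v set" and V :: "'v set" and w :: 'v and T :: "'e set"
  assumes base: "finite V" "w \<notin> V" "edges_within ep V T" "finite T"
begin

lemma span_tree_star0: "x \<in> V \<Longrightarrow> \<not> span_tree ep (insert w V) T"
  using span_tree_star[OF base finite.emptyI] pins_empty[of x V ep T] by simp

lemma span_tree_star1:
  assumes "f \<notin> T" "ep f = {w, p}" "p \<in> V"
  shows "span_tree ep (insert w V) (insert f T) \<longleftrightarrow> span_tree ep V T"
  using span_tree_star[OF base, of "{f}" "\<lambda>_. p"] assms
  by (simp add: span_tree_iff_pins[of p V ep T])

lemma span_tree_star2:
  assumes "f1 \<notin> T" "ep f1 = {w, p1}" "p1 \<in> V" "f2 \<notin> T" "ep f2 = {w, p2}" "p2 \<in> V" "f1 \<noteq> f2"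
  shows "span_tree ep (insert w V) (insert f1 (insert f2 T)) \<longleftrightarrow> tree2 ep V p1 p2 T"
proof -
  let ?\<nu> = "\<lambda>j. if j = f1 then p1 else p2"
  have im: "?\<nu> ` {f1, f2} = {p1, p2}" using assms(7) by auto
  have "span_tree ep (insert w V) (T \<union> {f1, f2}) \<longleftrightarrow>
      card T + card {f1, f2} = card V \<and> pins ep V (?\<nu> ` {f1, f2}) T"
    by (rule span_tree_star[OF base]) (use assms in auto)
  moreover have "pins ep V {p1, p2} T \<longleftrightarrow> binds ep V T (\<lambda>g. g p1 = g p2)"
    using assms(3,6) by (subst pins_iff_binds[of p1]) (auto intro!: binds_cong)
  ultimately show ?thesis unfolding im tree2_def using assms(7) by simp
qed

lemma span_tree_star3:
  assumes "f1 \<notin> T" "ep f1 = {w, p1}" "p1 \<in> V" "f2 \<notin> T" "ep f2 = {w, p2}" "p2 \<in> V"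
    "f3 \<notin> T" "ep f3 = {w, p3}" "p3 \<in> V" "f1 \<noteq> f2" "f1 \<noteq> f3" "f2 \<noteq> f3"
  shows "span_tree ep (insert w V) (insert f1 (insert f2 (insert f3 T))) \<longleftrightarrow> tree3 ep V p1 p2 p3 T"
proof -
  let ?\<nu> = "\<lambda>j. if j = f1 then p1 else if j = f2 then p2 else p3"
  have im: "?\<nu> ` {f1, f2, f3} = {p1, p2, p3}" using assms(10-12) by auto
  have "span_tree ep (insert w V) (T \<union> {f1, f2, f3}) \<longleftrightarrow>
      card T + card {f1, f2, f3} = card V \<and> pins ep V (?\<nu> ` {f1, f2, f3}) T"
    by (rule span_tree_star[OF base]) (use assms in auto)
  moreover have "pins ep V {p1, p2, p3} T \<longleftrightarrow> bind3 ep V T p1 p2 p3"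
    unfolding bind3_def using assms(3,6,9) by (subst pins_iff_binds[of p1]) (auto intro!: binds_cong)
  ultimately show ?thesis unfolding im tree3_def using assms(10-12) by (simp add: numeral_3_eq_3)
qed

end

context
  fixes ep :: "'e \<Rightarrow> 'v set" and V :: "'v set" and w :: 'v and E :: "'e set"
  assumes base: "finite V" "w \<notin> V" "edges_within ep V E" "finite E" "V \<noteq> {}"
begin

lemma star_rules:
  assumes "T \<subseteq> E"
  shows "\<not> span_tree ep (insert w V) T"
    and "f1 \<notin> E \<Longrightarrow> ep f1 = {w, p1} \<Longrightarrow> p1 \<in> V \<Longrightarrow>
      span_tree ep (insert w V) (insert f1 T) \<longleftrightarrow> span_tree ep V T"
    and "f1 \<notin> E \<Longrightarrow> ep f1 = {w, p1} \<Longrightarrow> p1 \<in> V \<Longrightarrow> f2 \<notin> E \<Longrightarrow> ep f2 = {w, p2} \<Longrightarrow> p2 \<in> V \<Longrightarrow>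
      f1 \<noteq> f2 \<Longrightarrow> span_tree ep (insert w V) (insert f1 (insert f2 T)) \<longleftrightarrow> tree2 ep V p1 p2 T"
    and "f1 \<notin> E \<Longrightarrow> ep f1 = {w, p1} \<Longrightarrow> p1 \<in> V \<Longrightarrow> f2 \<notin> E \<Longrightarrow> ep f2 = {w, p2} \<Longrightarrow> p2 \<in> V \<Longrightarrow>
      f3 \<notin> E \<Longrightarrow> ep f3 = {w, p3} \<Longrightarrow> p3 \<in> V \<Longrightarrow> f1 \<noteq> f2 \<Longrightarrow> f1 \<noteq> f3 \<Longrightarrow> f2 \<noteq> f3 \<Longrightarrow>
      span_tree ep (insert w V) (insert f1 (insert f2 (insert f3 T))) \<longleftrightarrow> tree3 ep V p1 p2 p3 T"
proof -
  have T: "edges_within ep V T" "finite T"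
    using edges_within_mono[OF base(3) assms] finite_subset[OF assms base(4)] by blast+
  obtain x where "x \<in> V" using base(5) by blast
  then show "\<not> span_tree ep (insert w V) T" using span_tree_star0[OF base(1,2) T] by blast
  assume f1: "f1 \<notin> E" "ep f1 = {w, p1}" "p1 \<in> V"
  have n1: "f1 \<notin> T" using f1 assms by blast
  show "span_tree ep (insert w V) (insert f1 T) \<longleftrightarrow> span_tree ep V T"
    using span_tree_star1[OF base(1,2) T n1 f1(2,3)] .
  assume f2: "f2 \<notin> E" "ep f2 = {w, p2}" "p2 \<in> V"
  have n2: "f2 \<notin> T" using f2 assms by blast
  show "span_tree ep (insert w V) (insert f1 (insert f2 T)) \<longleftrightarrow> tree2 ep V p1 p2 T" if "f1 \<noteq> f2"
    using span_tree_star2[OF base(1,2) T n1 f1(2,3) n2 f2(2,3) that] .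
  assume f3: "f3 \<notin> E" "ep f3 = {w, p3}" "p3 \<in> V" "f1 \<noteq> f2" "f1 \<noteq> f3" "f2 \<noteq> f3"
  have n3: "f3 \<notin> T" using f3 assms by blast
  show "span_tree ep (insert w V) (insert f1 (insert f2 (insert f3 T))) \<longleftrightarrow> tree3 ep V p1 p2 p3 T"
    using span_tree_star3[OF base(1,2) T n1 f1(2,3) n2 f2(2,3) n3 f3(2-)] .
qed

text \<open>The 14 summands are the ways to distribute four edges at \<open>w\<close> over two
  trees, except the two ways that leave \<open>w\<close> isolated in one of them. A tree given one,
  two or three of them restricts to a tree, a \<open>tree2\<close> or a \<open>tree3\<close> on
  \<open>V\<close>.\<close>

lemma tree_pairs_star4:
  assumes "distinct [f1, f2, f3, f4]" "f1 \<notin> E" "f2 \<notin> E" "f3 \<notin> E" "f4 \<notin> E"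
    and "ep f1 = {w, p1}" "ep f2 = {w, p2}" "ep f3 = {w, p3}" "ep f4 = {w, p4}"
    and "p1 \<in> V" "p2 \<in> V" "p3 \<in> V" "p4 \<in> V"
  shows "tree_pairs ep (insert w V) (E \<union> {f1, f2, f3, f4}) = (\<Sum>T\<in>Pow E.
     of_bool (span_tree ep V T \<and> tree3 ep V p2 p3 p4 (E - T)) + of_bool (span_tree ep V T \<and> tree3 ep V p1 p3 p4 (E - T))
   + of_bool (span_tree ep V T \<and> tree3 ep V p1 p2 p4 (E - T)) + of_bool (span_tree ep V T \<and> tree3 ep V p1 p2 p3 (E - T))
   + of_bool (tree2 ep V p1 p2 T \<and> tree2 ep V p3 p4 (E - T)) + of_bool (tree2 ep V p1 p3 T \<and> tree2 ep V p2 p4 (E - T))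
   + of_bool (tree2 ep V p1 p4 T \<and> tree2 ep V p2 p3 (E - T)) + of_bool (tree2 ep V p2 p3 T \<and> tree2 ep V p1 p4 (E - T))
   + of_bool (tree2 ep V p2 p4 T \<and> tree2 ep V p1 p3 (E - T)) + of_bool (tree2 ep V p3 p4 T \<and> tree2 ep V p1 p2 (E - T))
   + of_bool (tree3 ep V p2 p3 p4 T \<and> span_tree ep V (E - T)) + of_bool (tree3 ep V p1 p3 p4 T \<and> span_tree ep V (E - T))
   + of_bool (tree3 ep V p1 p2 p4 T \<and> span_tree ep V (E - T)) + of_bool (tree3 ep V p1 p2 p3 T \<and> span_tree ep V (E - T)))"
proof -
  have "E \<inter> {f1, f2, f3, f4} = {}" "finite {f1, f2, f3, f4}" using assms by blast+
  then show ?thesis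
    unfolding tree_pairs_def bipart_Un[OF base(4) \<open>finite {f1, f2, f3, f4}\<close> \<open>E \<inter> {f1, f2, f3, f4} = {}\<close>] using assms
    by (auto intro!: sum.cong simp: bipart_insert bipart_empty star_rules simp del: of_bool_conj)
qed

lemma tree_pairs_star3:
  assumes "distinct [f1, f2, f3]" "f1 \<notin> E" "f2 \<notin> E" "f3 \<notin> E"
    and "ep f1 = {w, p1}" "ep f2 = {w, p2}" "ep f3 = {w, p3}"
    and "p1 \<in> V" "p2 \<in> V" "p3 \<in> V"
  shows "tree_pairs ep (insert w V) (E \<union> {f1, f2, f3}) = (\<Sum>T\<in>Pow E.
     of_bool (span_tree ep V T \<and> tree2 ep V p2 p3 (E - T)) + of_bool (span_tree ep V T \<and> tree2 ep V p1 p3 (E - T))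
   + of_bool (span_tree ep V T \<and> tree2 ep V p1 p2 (E - T)) + of_bool (tree2 ep V p2 p3 T \<and> span_tree ep V (E - T))
   + of_bool (tree2 ep V p1 p3 T \<and> span_tree ep V (E - T)) + of_bool (tree2 ep V p1 p2 T \<and> span_tree ep V (E - T)))"
proof -
  have "E \<inter> {f1, f2, f3} = {}" "finite {f1, f2, f3}" using assms by blast+
  then show ?thesis
    unfolding tree_pairs_def bipart_Un[OF base(4) \<open>finite {f1, f2, f3}\<close> \<open>E \<inter> {f1, f2, f3} = {}\<close>] using assms
    by (auto intro!: sum.cong simp: bipart_insert bipart_empty star_rules simp del: of_bool_conj)
qed

text \<open>Each tree needs one of the two edges, and \<open>w\<close> is a leaf of both; the factor
  is the choice of who gets which.\<close>

lemma tree_pairs_star2: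
  assumes "f1 \<noteq> f2" "f1 \<notin> E" "f2 \<notin> E" "ep f1 = {w, p1}" "ep f2 = {w, p2}" "p1 \<in> V" "p2 \<in> V"
  shows "tree_pairs ep (insert w V) (E \<union> {f1, f2}) = 2 * tree_pairs ep V E"
proof -
  have "E \<inter> {f1, f2} = {}" using assms by blast
  from bipart_Un[OF base(4) _ this]
  have "tree_pairs ep (insert w V) (E \<union> {f1, f2}) =
     (\<Sum>T\<in>Pow E. of_bool (span_tree ep V T \<and> span_tree ep V (E - T)) + of_bool (span_tree ep V T \<and> span_tree ep V (E - T)))"
    unfolding tree_pairs_def using assms
    by (auto intro!: sum.cong simp: bipart_insert bipart_empty star_rules simp del: of_bool_conj)
  also have "\<dots> = 2 * tree_pairs ep V E"
    using bipart_Un[OF base(4) finite.emptyI, of "\<lambda>S T. span_tree ep V S \<and> span_tree ep V T"]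
    unfolding tree_pairs_def bipart_empty by (simp add: sum.distrib del: of_bool_conj)
  finally show ?thesis .
qed

text \<open>Both trees would need an edge at \<open>w\<close>.\<close>

lemma tree_pairs_star1:
  assumes "f \<notin> E" "ep f = {w, p}" "p \<in> V"
  shows "tree_pairs ep (insert w V) (E \<union> {f}) = 0"
proof -
  have "E \<inter> {f} = {}" "finite {f}" using assms by blast+
  then show ?thesis
    unfolding tree_pairs_def bipart_Un[OF base(4) \<open>finite {f}\<close> \<open>E \<inter> {f} = {}\<close>] using assms
    by (auto intro!: sum.neutral simp: bipart_insert bipart_empty star_rules)
qed

lemma tree_pairs_star0: "tree_pairs ep (insert w V) E = 0"
  unfolding tree_pairs_def bipart_def using star_rules(1) by auto

end

definition rewire :: "('e \<Rightarrow> 'v set) \<Rightarrow> 'e \<Rightarrow> 'e \<Rightarrow> 'v \<Rightarrow> 'v \<Rightarrow> 'v \<Rightarrow> 'v \<Rightarrow> 'e \<Rightarrow> 'v set" where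
  "rewire ep a b p q r s = ep(a := {p, q}, b := {r, s})"

context
  fixes ep :: "'e \<Rightarrow> 'v set" and V :: "'v set" and E :: "'e set" and a b :: 'e and p q r s :: 'v
  assumes base: "finite E" "a \<notin> E" "b \<notin> E" "a \<noteq> b"
begin

lemma rewire_rules:
  assumes "T \<subseteq> E"
  shows "span_tree (rewire ep a b p q r s) V T \<longleftrightarrow> span_tree ep V T"
    and "span_tree (rewire ep a b p q r s) V (insert a T) \<longleftrightarrow> tree2 ep V p q T"
    and "span_tree (rewire ep a b p q r s) V (insert b T) \<longleftrightarrow> tree2 ep V r s T"
    and "span_tree (rewire ep a b p q r s) V (insert a (insert b T)) \<longleftrightarrow> tree22 ep V p q r s T"
proof -
  let ?ep = "rewire ep a b p q r s"
  have n: "a \<notin> T" "b \<notin> T" "finite T" using assms base finite_subset by auto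
  have flat: "flat ?ep T g \<longleftrightarrow> flat ep T g" for g
  proof -
    have "?ep e = ep e" if "e \<in> T" for e using that n by (auto simp: rewire_def)
    then show ?thesis unfolding flat_def by simp
  qed
  have ab: "?ep a = {p, q}" "?ep b = {r, s}" using base(4) by (auto simp: rewire_def)
  note fi = flat_insert[of ?ep, OF ab(1)] flat_insert[of ?ep, OF ab(2)]
  show "span_tree ?ep V T \<longleftrightarrow> span_tree ep V T"
    unfolding span_tree_def flat by simp
  show "span_tree ?ep V (insert a T) \<longleftrightarrow> tree2 ep V p q T"
    unfolding span_tree_def fi flat tree2_def binds_def using n by simp
  show "span_tree ?ep V (insert b T) \<longleftrightarrow> tree2 ep V r s T"
    unfolding span_tree_def fi flat tree2_def binds_def using n by simp
  show "span_tree ?ep V (insert a (insert b T)) \<longleftrightarrow> tree22 ep V p q r s T"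
    unfolding span_tree_def fi flat tree22_def bind22_def binds_def using n base(4)
    by (auto simp: numeral_3_eq_3)
qed

lemma tree_pairs_rewire_both:
  "tree_pairs (rewire ep a b p q r s) V (E \<union> {a, b}) = (\<Sum>T\<in>Pow E.
     of_bool (span_tree ep V T \<and> tree22 ep V p q r s (E - T)) + of_bool (tree2 ep V p q T \<and> tree2 ep V r s (E - T))
   + of_bool (tree2 ep V r s T \<and> tree2 ep V p q (E - T)) + of_bool (tree22 ep V p q r s T \<and> span_tree ep V (E - T)))"
proof -
  have "E \<inter> {a, b} = {}" "finite {a, b}" using base by blast+
  then show ?thesis
    unfolding tree_pairs_def bipart_Un[OF base(1) \<open>finite {a, b}\<close> \<open>E \<inter> {a, b} = {}\<close>] using base
    by (auto intro!: sum.cong simp: bipart_insert bipart_empty rewire_rules simp del: of_bool_conj)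
qed

lemma tree_pairs_rewire_left:
  "tree_pairs (rewire ep a b p q r s) V (E \<union> {a}) = (\<Sum>T\<in>Pow E.
     of_bool (span_tree ep V T \<and> tree2 ep V p q (E - T)) + of_bool (tree2 ep V p q T \<and> span_tree ep V (E - T)))"
proof -
  have "E \<inter> {a} = {}" "finite {a}" using base by blast+
  then show ?thesis
    unfolding tree_pairs_def bipart_Un[OF base(1) \<open>finite {a}\<close> \<open>E \<inter> {a} = {}\<close>] using base
    by (auto intro!: sum.cong simp: bipart_insert bipart_empty rewire_rules simp del: of_bool_conj)
qed

lemma tree_pairs_rewire_right:
  "tree_pairs (rewire ep a b p q r s) V (E \<union> {b}) = (\<Sum>T\<in>Pow E.
     of_bool (span_tree ep V T \<and> tree2 ep V r s (E - T)) + of_bool (tree2 ep V r s T \<and> span_tree ep V (E - T)))"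
proof -
  have "E \<inter> {b} = {}" "finite {b}" using base by blast+
  then show ?thesis
    unfolding tree_pairs_def bipart_Un[OF base(1) \<open>finite {b}\<close> \<open>E \<inter> {b} = {}\<close>] using base
    by (auto intro!: sum.cong simp: bipart_insert bipart_empty rewire_rules simp del: of_bool_conj)
qed

lemma tree_pairs_rewire_none: "tree_pairs (rewire ep a b p q r s) V E = tree_pairs ep V E"
  unfolding tree_pairs_def bipart_def by (intro arg_cong[where f = card]) (auto simp: rewire_rules)

end

section \<open>4-regular multigraphs with a deleted vertex\<close>

definition incidences :: "('e \<Rightarrow> 'v set) \<Rightarrow> 'e \<Rightarrow> 'v \<Rightarrow> nat" where
  "incidences ep e y = of_bool (y \<in> ep e) + of_bool (ep e = {y})"

definition quartic :: "('e \<Rightarrow> 'v set) \<Rightarrow> 'v set \<Rightarrow> 'e set \<Rightarrow> bool" where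
  "quartic ep V E \<longleftrightarrow> finite V \<and> finite E \<and> edges_within ep V E \<and> (\<forall>y\<in>V. (\<Sum>e\<in>E. incidences ep e y) = 4)"

definition avoiding :: "('e \<Rightarrow> 'v set) \<Rightarrow> 'e set \<Rightarrow> 'v \<Rightarrow> 'e set" where
  "avoiding ep E v = {e \<in> E. v \<notin> ep e}"

definition pairs_without :: "('e \<Rightarrow> 'v set) \<Rightarrow> 'v set \<Rightarrow> 'e set \<Rightarrow> 'v \<Rightarrow> nat" where
  "pairs_without ep V E v = tree_pairs ep (V - {v}) (avoiding ep E v)"

lemma incidences_pair: "ep e = {p, q} \<Longrightarrow> incidences ep e y = of_bool (y = p) + of_bool (y = q)"
  unfolding incidences_def by auto

lemma quartic_card_edges:
  assumes "quartic ep V E"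
  shows "card E = 2 * card V"
proof -
  have q: "finite V" "finite E" "edges_within ep V E" "\<And>y. y \<in> V \<Longrightarrow> (\<Sum>e\<in>E. incidences ep e y) = 4"
    using assms unfolding quartic_def by auto
  have two: "(\<Sum>y\<in>V. incidences ep e y) = 2" if e: "e \<in> E" for e
  proof -
    obtain p q where "p \<in> V" "q \<in> V" "ep e = {p, q}" using q(3) e unfolding edges_within_def by blast
    then have "(\<Sum>y\<in>V. incidences ep e y) = (\<Sum>y\<in>V. if y = p then 1 else 0) + (\<Sum>y\<in>V. if y = q then 1 else 0)"
      by (simp only: incidences_pair[of ep e p q] sum.distrib of_bool_def)
    then show ?thesis using q(1) \<open>p \<in> V\<close> \<open>q \<in> V\<close> by (simp only: sum.delta if_True one_add_one)
  qed
  have "(\<Sum>y\<in>V. \<Sum>e\<in>E. incidences ep e y) = (\<Sum>e\<in>E. \<Sum>y\<in>V. incidences ep e y)" by (rule sum.swap)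
  moreover have "(\<Sum>y\<in>V. \<Sum>e\<in>E. incidences ep e y) = 4 * card V" by (simp add: q(4))
  moreover have "(\<Sum>e\<in>E. \<Sum>y\<in>V. incidences ep e y) = 2 * card E" by (simp add: two)
  ultimately show ?thesis by linarith
qed

text \<open>Of the four half-edges at \<open>v\<close>, a loop uses two, so each loop spares one
  edge from deletion.\<close>

lemma card_avoiding:
  assumes "quartic ep V E" "v \<in> V"
  shows "card (avoiding ep E v) + 4 = 2 * card V + card {e \<in> E. ep e = {v}}"
proof -
  have fin: "finite E" using assms by (simp add: quartic_def)
  have "4 = (\<Sum>e\<in>E. of_bool (v \<in> ep e) + of_bool (ep e = {v}) :: nat)"
    using assms by (simp add: quartic_def incidences_def)
  also have "\<dots> = card {e \<in> E. v \<in> ep e} + card {e \<in> E. ep e = {v}}"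
    using fin by (simp add: sum.distrib Int_def)
  finally have "4 = card {e \<in> E. v \<in> ep e} + card {e \<in> E. ep e = {v}}" .
  moreover have "card E = card {e \<in> E. v \<in> ep e} + card (avoiding ep E v)"
  proof -
    have "E = {e \<in> E. v \<in> ep e} \<union> avoiding ep E v" unfolding avoiding_def by blast
    then show ?thesis using fin by (subst card_Un_disjoint[symmetric]) (auto simp: avoiding_def)
  qed
  ultimately show ?thesis using quartic_card_edges[OF assms(1)] by linarith
qed

lemma tree_pairs_card:
  assumes "tree_pairs ep V E \<noteq> 0" "finite E"
  shows "card E + 2 = 2 * card V"
proof -
  have "\<exists>T \<in> Pow E. span_tree ep V T \<and> span_tree ep V (E - T)"
  proof (rule ccontr)
    assume "\<not> ?thesis"
    then have "{T \<in> Pow E. span_tree ep V T \<and> span_tree ep V (E - T)} = {}" by blast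
    then show False using assms(1) unfolding tree_pairs_def bipart_def by (simp only: card.empty)
  qed
  then obtain T where T: "T \<subseteq> E" "card T + 1 = card V" "card (E - T) + 1 = card V"
    unfolding span_tree_def by blast
  then have "card (E - T) = card E - card T" "card T \<le> card E"
    using assms(2) by (auto simp: card_Diff_subset finite_subset card_mono)
  then show ?thesis using T by linarith
qed

text \<open>Two spanning trees on \<open>V - {v}\<close> use exactly \<open>2 * card V - 4\<close>
  edges; a loop at \<open>v\<close> leaves more than that.\<close>

lemma pairs_without_loop:
  assumes "quartic ep V E" "v \<in> V" "e \<in> E" "ep e = {v}"
  shows "pairs_without ep V E v = 0"
proof (rule ccontr)
  assume ne: "pairs_without ep V E v \<noteq> 0"
  have fin: "finite E" "finite V" using assms by (auto simp: quartic_def)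
  then have "card (avoiding ep E v) + 2 = 2 * card (V - {v})"
    using ne unfolding pairs_without_def by (intro tree_pairs_card) (auto simp: avoiding_def)
  moreover have "card (V - {v}) + 1 = card V"
    using assms(2) fin by (metis Suc_eq_plus1 card_Suc_Diff1)
  moreover have "card {e \<in> E. ep e = {v}} > 0" using assms fin by (auto simp: card_gt_0_iff)
  ultimately show False using card_avoiding[OF assms(1,2)] by linarith
qed

lemma span_tree_no_loop:
  assumes "span_tree ep V T" "finite V" "finite T" "edges_within ep V T" "e \<in> T"
  shows "ep e \<noteq> {x}"
proof
  assume e: "ep e = {x}"
  have flat: "flat ep T g \<longleftrightarrow> flat ep (T - {e}) g" for g
  proof -
    have "diff ep e g = 0" using e by (simp add: diff_def)
    then show ?thesis unfolding flat_iff_diff by blast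
  qed
  obtain c where c: "c \<in> V" using assms(4,5) unfolding edges_within_def by blast
  have "pins ep V {c} (T - {e})"
    using assms(1) unfolding span_tree_def pins_singleton_iff[OF c] flat[symmetric] by (rule conjunct2)
  from pins_card[OF this assms(2) _ _ edges_within_mono[OF assms(4)]] c assms(3)
  have "card V \<le> 1 + card (T - {e})" by simp
  moreover have "card (T - {e}) + 1 = card T"
    using assms(3,5) by (metis Suc_eq_plus1 card_Suc_Diff1)
  ultimately show False using assms(1) unfolding span_tree_def by linarith
qed

lemma tree_pairs_loop:
  assumes "finite V" "finite E" "edges_within ep V E" "e \<in> E" "ep e = {x}"
  shows "tree_pairs ep V E = 0"
proof -
  have "\<not> (span_tree ep V T \<and> span_tree ep V (E - T))" if "T \<subseteq> E" for T
    using span_tree_no_loop[of ep V T e x] span_tree_no_loop[of ep V "E - T" e x] assms that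
      edges_within_mono[OF assms(3)] finite_subset[OF that assms(2)] by blast
  then have "{T \<in> Pow E. span_tree ep V T \<and> span_tree ep V (E - T)} = {}" by blast
  then show ?thesis unfolding tree_pairs_def bipart_def by (simp only: card.empty)
qed

lemma edges_within_avoiding:
  assumes "edges_within ep V E"
  shows "edges_within ep (V - {v}) (avoiding ep E v)"
  unfolding edges_within_def
proof
  fix e assume e: "e \<in> avoiding ep E v"
  then obtain p q where "p \<in> V" "q \<in> V" "ep e = {p, q}"
    using assms unfolding edges_within_def avoiding_def by blast
  moreover from this e have "p \<noteq> v" "q \<noteq> v" by (auto simp: avoiding_def)
  ultimately show "\<exists>p\<in>V - {v}. \<exists>q\<in>V - {v}. ep e = {p, q}" by blast
qed

lemma pairs_without_other_loop:
  assumes "quartic ep V E" "e \<in> E" "ep e = {x}" "x \<noteq> v"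
  shows "pairs_without ep V E v = 0"
  unfolding pairs_without_def
proof (rule tree_pairs_loop[OF _ _ edges_within_avoiding])
  show "e \<in> avoiding ep E v" using assms by (simp add: avoiding_def)
qed (use assms in \<open>auto simp: quartic_def avoiding_def\<close>)

text \<open>In a resolution of \<open>x\<close>, the two new edges reuse the names \<open>a\<close> and \<open>b\<close> of edges at \<open>x\<close>.\<close>

locale quartic_star =
  fixes ep :: "'e \<Rightarrow> 'v set" and V :: "'v set" and E :: "'e set" and x :: 'v
    and a b :: 'e and \<nu> :: "'e \<Rightarrow> 'v"
  assumes quartic: "quartic ep V E" and x: "x \<in> V"
    and ab: "a \<in> E" "b \<in> E" "x \<in> ep a" "x \<in> ep b" "a \<noteq> b"
    and star: "\<And>f. f \<in> E \<Longrightarrow> x \<in> ep f \<Longrightarrow> ep f = {x, \<nu> f} \<and> \<nu> f \<in> V - {x}"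
begin

lemma fin: "finite V" "finite E" and ew: "edges_within ep V E"
  using quartic by (auto simp: quartic_def)

definition rest :: "'e set" where "rest = avoiding ep E x"

lemma ab_rest: "a \<notin> rest" "b \<notin> rest" "finite rest"
  using ab fin by (auto simp: rest_def avoiding_def)

definition transition :: "'v \<Rightarrow> 'v \<Rightarrow> 'v \<Rightarrow> 'v \<Rightarrow> 'e \<Rightarrow> 'v set" where
  "transition p q r s = rewire ep a b p q r s"

lemma transition_simps:
  "transition p q r s a = {p, q}" "transition p q r s b = {r, s}"
  "e \<in> rest \<Longrightarrow> transition p q r s e = ep e"
  using ab ab_rest by (auto simp: transition_def rewire_def)

lemma edges_within_rest: "edges_within ep (V - {x}) rest"
  unfolding rest_def by (rule edges_within_avoiding[OF ew])

lemma quartic_transition: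
  assumes f: "distinct [f1, f2, f3, f4]" "{f \<in> E. x \<in> ep f} = {f1, f2, f3, f4}"
    and p: "mset [\<nu> f1, \<nu> f2, \<nu> f3, \<nu> f4] = mset [p, q, r, s]"
  shows "quartic (transition p q r s) (V - {x}) (rest \<union> {a, b})"
proof -
  have set: "set [\<nu> f1, \<nu> f2, \<nu> f3, \<nu> f4] = set [p, q, r, s]" using p by (rule mset_eq_setD)
  have "f \<in> E \<and> x \<in> ep f" if "f \<in> {f1, f2, f3, f4}" for f using f(2) that by blast
  then have st: "ep f = {x, \<nu> f} \<and> \<nu> f \<in> V - {x}" if "f \<in> {f1, f2, f3, f4}" for f using that star by blast
  then have "set [\<nu> f1, \<nu> f2, \<nu> f3, \<nu> f4] \<subseteq> V - {x}" by auto
  then have pV: "p \<in> V - {x}" "q \<in> V - {x}" "r \<in> V - {x}" "s \<in> V - {x}" unfolding set by auto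
  have E: "E = rest \<union> {f1, f2, f3, f4}" unfolding rest_def avoiding_def using f(2) by blast
  have disj: "rest \<inter> {f1, f2, f3, f4} = {}" unfolding rest_def avoiding_def using f(2) by blast
  have "edges_within (transition p q r s) (V - {x}) (rest \<union> {a, b})"
    unfolding edges_within_def
  proof
    fix e assume "e \<in> rest \<union> {a, b}"
    then consider "e \<in> rest" | "e = a" | "e = b" by blast
    then show "\<exists>u\<in>V - {x}. \<exists>v\<in>V - {x}. transition p q r s e = {u, v}"
    proof cases
      case 1
      then show ?thesis using edges_within_rest transition_simps(3) unfolding edges_within_def by simp
    next
      case 2
      then show ?thesis using pV transition_simps(1) by blast
    next
      case 3
      then show ?thesis using pV transition_simps(2) by blast
    qed
  qed
  moreover have "(\<Sum>e\<in>rest \<union> {a, b}. incidences (transition p q r s) e y) = 4" if y: "y \<in> V - {x}" for y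
  proof -
    have "(\<Sum>e\<in>rest \<union> {a, b}. incidences (transition p q r s) e y) =
        (\<Sum>e\<in>rest. incidences (transition p q r s) e y) + (\<Sum>e\<in>{a, b}. incidences (transition p q r s) e y)"
      using ab_rest by (intro sum.union_disjoint) auto
    also have "(\<Sum>e\<in>rest. incidences (transition p q r s) e y) = (\<Sum>e\<in>rest. incidences ep e y)"
      by (rule sum.cong) (auto simp: incidences_def transition_simps)
    also have "(\<Sum>e\<in>{a, b}. incidences (transition p q r s) e y) =
        sum_list (map (\<lambda>z. of_bool (y = z)) [p, q, r, s])"
    proof -
      have "incidences (transition p q r s) a y = of_bool (y = p) + of_bool (y = q)"
        "incidences (transition p q r s) b y = of_bool (y = r) + of_bool (y = s)"
        using incidences_pair[of "transition p q r s" a p q y] incidences_pair[of "transition p q r s" b r s y]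
          transition_simps(1,2)[of p q r s] by blast+
      then show ?thesis using ab(5) by simp
    qed
    \<comment> \<open>The new edges take over the half-edges of the old neighbours. Comparing
      multisets keeps degrees correct when neighbours coincide.\<close>
    also have "\<dots> = sum_list (map (\<lambda>z. of_bool (y = z)) [\<nu> f1, \<nu> f2, \<nu> f3, \<nu> f4])"
    proof -
      have "mset (map (\<lambda>z. of_bool (y = z) :: nat) [p, q, r, s]) =
          mset (map (\<lambda>z. of_bool (y = z)) [\<nu> f1, \<nu> f2, \<nu> f3, \<nu> f4])"
        unfolding mset_map p by simp
      from arg_cong[OF this, of sum_mset] show ?thesis by (simp only: sum_mset_sum_list)
    qed
    also have "\<dots> = (\<Sum>e\<in>{f1, f2, f3, f4}. of_bool (y = \<nu> e))"
      using f(1) by simp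
    also have "\<dots> = (\<Sum>e\<in>{f1, f2, f3, f4}. incidences ep e y)"
    proof (rule sum.cong[OF refl])
      fix e assume "e \<in> {f1, f2, f3, f4}"
      then have "ep e = {x, \<nu> e}" using st by blast
      then show "of_bool (y = \<nu> e) = incidences ep e y" using y incidences_pair[of ep e x "\<nu> e" y] by simp
    qed
    also have "(\<Sum>e\<in>rest. incidences ep e y) + \<dots> = (\<Sum>e\<in>rest \<union> {f1, f2, f3, f4}. incidences ep e y)"
      using disj ab_rest(3) by (intro sum.union_disjoint[symmetric]) auto
    also have "rest \<union> {f1, f2, f3, f4} = E" using E by (rule sym)
    also have "(\<Sum>e\<in>E. incidences ep e y) = 4" using quartic y by (simp add: quartic_def)
    finally show ?thesis .
  qed
  ultimately show ?thesis using fin ab_rest(3) by (simp add: quartic_def)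
qed

end

context quartic_star
begin

definition resolved :: "'v \<Rightarrow> 'v \<Rightarrow> 'v \<Rightarrow> 'v \<Rightarrow> 'v \<Rightarrow> nat" where
  "resolved v p q r s = pairs_without (transition p q r s) (V - {x}) (rest \<union> {a, b}) v"

lemma avoiding_transition:
  "avoiding (transition p q r s) (rest \<union> {a, b}) v =
    avoiding ep rest v \<union> (if v \<in> {p, q} then {} else {a}) \<union> (if v \<in> {r, s} then {} else {b})"
proof -
  have "e \<in> avoiding (transition p q r s) (rest \<union> {a, b}) v \<longleftrightarrow>
    e \<in> avoiding ep rest v \<or> (e = a \<and> v \<notin> {p, q}) \<or> (e = b \<and> v \<notin> {r, s})" for e
    using ab_rest ab(5) transition_simps(3)[of e p q r s] unfolding avoiding_def
    by (cases "e = a"; cases "e = b") (auto simp: transition_simps(1,2))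
  then show ?thesis by auto
qed

lemma avoiding_rest: "finite (avoiding ep rest v)" "a \<notin> avoiding ep rest v" "b \<notin> avoiding ep rest v"
  using ab_rest by (auto simp: avoiding_def)

lemmas rewire_counts =
  tree_pairs_rewire_both[OF avoiding_rest ab(5)] tree_pairs_rewire_left[OF avoiding_rest ab(5)]
  tree_pairs_rewire_right[OF avoiding_rest ab(5)] tree_pairs_rewire_none[OF avoiding_rest ab(5)]

lemma resolved_both:
  assumes "v \<notin> {p, q}" "v \<notin> {r, s}"
  shows "resolved v p q r s = tree_pairs (rewire ep a b p q r s) (V - {x} - {v}) (avoiding ep rest v \<union> {a, b})"
  using assms unfolding resolved_def pairs_without_def avoiding_transition
  by (simp add: transition_def insert_commute)

lemma resolved_left:
  assumes "v \<notin> {p, q}" "v \<in> {r, s}"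
  shows "resolved v p q r s = tree_pairs (rewire ep a b p q r s) (V - {x} - {v}) (avoiding ep rest v \<union> {a})"
  using assms unfolding resolved_def pairs_without_def avoiding_transition by (simp add: transition_def)

lemma resolved_right:
  assumes "v \<in> {p, q}" "v \<notin> {r, s}"
  shows "resolved v p q r s = tree_pairs (rewire ep a b p q r s) (V - {x} - {v}) (avoiding ep rest v \<union> {b})"
  using assms unfolding resolved_def pairs_without_def avoiding_transition by (simp add: transition_def)

lemma resolved_none:
  assumes "v \<in> {p, q}" "v \<in> {r, s}"
  shows "resolved v p q r s = tree_pairs (rewire ep a b p q r s) (V - {x} - {v}) (avoiding ep rest v)"
  using assms unfolding resolved_def pairs_without_def avoiding_transition by (simp add: transition_def)

lemma tree22_commute: "tree22 ep' W r s p q T \<longleftrightarrow> tree22 ep' W p q r s T"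
  unfolding tree22_def bind22_def by (simp add: conj_commute)

text \<open>The edge names \<open>a\<close> and \<open>b\<close> play different roles in
  \<open>rewire\<close>, but they have disappeared from the expansions \<open>rewire_counts\<close>,
  whose summands are visibly symmetric.\<close>

lemma resolved_commute: "resolved v r s p q = resolved v p q r s"
proof -
  consider "v \<notin> {p, q}" "v \<notin> {r, s}" | "v \<notin> {p, q}" "v \<in> {r, s}" | "v \<in> {p, q}" "v \<notin> {r, s}"
    | "v \<in> {p, q}" "v \<in> {r, s}" by blast
  then show ?thesis
  proof cases
    case 1
    show ?thesis
      unfolding resolved_both[OF 1] resolved_both[OF 1(2,1)] rewire_counts
      by (rule sum.cong[OF refl]) (simp add: tree22_commute[of _ _ r s p q] del: of_bool_conj)
  next
    case 2
    show ?thesis unfolding resolved_left[OF 2] resolved_right[OF 2(2,1)] rewire_counts ..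
  next
    case 3
    show ?thesis unfolding resolved_right[OF 3] resolved_left[OF 3(2,1)] rewire_counts ..
  next
    case 4
    show ?thesis unfolding resolved_none[OF 4] resolved_none[OF 4(2,1)] rewire_counts ..
  qed
qed

lemma resolved_flip: "resolved v q p r s = resolved v p q r s" "resolved v p q s r = resolved v p q r s"
  unfolding resolved_def transition_def rewire_def by (simp_all add: insert_commute)

text \<open>The sum over the three perfect matchings of the four half-edges at \<open>x\<close>. The
  swaps below are adjacent transpositions and make it independent of the order of the edges.\<close>

definition resolution :: "'v \<Rightarrow> 'e \<Rightarrow> 'e \<Rightarrow> 'e \<Rightarrow> 'e \<Rightarrow> nat" where
  "resolution v f1 f2 f3 f4 = resolved v (\<nu> f1) (\<nu> f2) (\<nu> f3) (\<nu> f4) +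
    resolved v (\<nu> f1) (\<nu> f3) (\<nu> f2) (\<nu> f4) + resolved v (\<nu> f1) (\<nu> f4) (\<nu> f2) (\<nu> f3)"

lemma resolution_swap12: "resolution v f2 f1 f3 f4 = resolution v f1 f2 f3 f4"
  unfolding resolution_def
  using resolved_flip(1)[of v "\<nu> f2" "\<nu> f1" "\<nu> f3" "\<nu> f4"]
    resolved_commute[of v "\<nu> f2" "\<nu> f3" "\<nu> f1" "\<nu> f4"] resolved_commute[of v "\<nu> f2" "\<nu> f4" "\<nu> f1" "\<nu> f3"]
  by linarith

lemma resolution_swap23: "resolution v f1 f3 f2 f4 = resolution v f1 f2 f3 f4"
  unfolding resolution_def using resolved_flip(2)[of v "\<nu> f1" "\<nu> f4" "\<nu> f2" "\<nu> f3"] by linarith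

lemma resolution_swap34: "resolution v f1 f2 f4 f3 = resolution v f1 f2 f3 f4"
  unfolding resolution_def using resolved_flip(2)[of v "\<nu> f1" "\<nu> f2" "\<nu> f3" "\<nu> f4"] by linarith

text \<open>The cases are the numbers of edges from \<open>x\<close> to the deleted vertex
  \<open>v\<close>; listing these edges last leaves five cases instead of sixteen.\<close>

lemma pairs_without_eq_resolution_sorted:
  assumes v: "v \<in> V" "v \<noteq> x" and ne: "V - {x} - {v} \<noteq> {}"
    and f: "distinct [f1, f2, f3, f4]" "{f \<in> E. x \<in> ep f} = {f1, f2, f3, f4}"
    and sorted: "\<nu> f1 = v \<Longrightarrow> \<nu> f2 = v" "\<nu> f2 = v \<Longrightarrow> \<nu> f3 = v" "\<nu> f3 = v \<Longrightarrow> \<nu> f4 = v"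
  shows "pairs_without ep V E v = resolution v f1 f2 f3 f4"
proof -
  let ?V = "V - {x} - {v}" and ?E = "avoiding ep rest v"
  have fE: "f \<in> E \<and> x \<in> ep f" if "f \<in> {f1, f2, f3, f4}" for f using f(2) that by blast
  have st: "ep f = {x, \<nu> f} \<and> \<nu> f \<in> V - {x}" if "f \<in> {f1, f2, f3, f4}" for f
    using fE[OF that] star by blast
  have e: "ep f1 = {x, \<nu> f1}" "ep f2 = {x, \<nu> f2}" "ep f3 = {x, \<nu> f3}" "ep f4 = {x, \<nu> f4}"
    and \<nu>V: "\<nu> f1 \<in> V - {x}" "\<nu> f2 \<in> V - {x}" "\<nu> f3 \<in> V - {x}" "\<nu> f4 \<in> V - {x}"
    using st by blast+
  have base: "finite ?V" "x \<notin> ?V" "edges_within ep ?V ?E" "finite ?E" "?V \<noteq> {}"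
    using fin edges_within_avoiding[OF edges_within_rest] avoiding_rest ne by auto
  have nE: "f1 \<notin> ?E" "f2 \<notin> ?E" "f3 \<notin> ?E" "f4 \<notin> ?E"
    using fE unfolding rest_def avoiding_def by blast+
  have V: "V - {v} = insert x ?V" using x v by blast
  have E: "avoiding ep E v = ?E \<union> {f \<in> {f1, f2, f3, f4}. \<nu> f \<noteq> v}"
  proof (intro set_eqI iffI)
    fix g assume g: "g \<in> avoiding ep E v"
    show "g \<in> ?E \<union> {f \<in> {f1, f2, f3, f4}. \<nu> f \<noteq> v}"
    proof (cases "x \<in> ep g")
      case True
      then have "g \<in> {f1, f2, f3, f4}" using g f(2) unfolding avoiding_def by blast
      moreover from this have "\<nu> g \<noteq> v" using g st unfolding avoiding_def by blast
      ultimately show ?thesis by blast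
    next
      case False
      then show ?thesis using g unfolding avoiding_def rest_def by blast
    qed
  next
    fix g assume "g \<in> ?E \<union> {f \<in> {f1, f2, f3, f4}. \<nu> f \<noteq> v}"
    then consider "g \<in> ?E" | "g \<in> {f1, f2, f3, f4}" "\<nu> g \<noteq> v" by blast
    then show "g \<in> avoiding ep E v"
    proof cases
      case 1
      then show ?thesis unfolding avoiding_def rest_def by blast
    next
      case 2
      then show ?thesis using fE[OF 2(1)] st[OF 2(1)] v unfolding avoiding_def by auto
    qed
  qed
  have d: "f1 \<noteq> f2" "f1 \<noteq> f3" "f1 \<noteq> f4" "f2 \<noteq> f3" "f2 \<noteq> f4" "f3 \<noteq> f4" using f(1) by auto
  \<comment> \<open>A matching that pairs two half-edges leading to \<open>v\<close> creates a loop
    at \<open>v\<close>.\<close>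
  have loop0: "resolved v p q v v = 0" if "mset [\<nu> f1, \<nu> f2, \<nu> f3, \<nu> f4] = mset [p, q, v, v]" for p q
    unfolding resolved_def
    by (rule pairs_without_loop[OF quartic_transition[OF f that], of v b])
      (use v in \<open>auto simp: transition_simps\<close>)
  consider (0) "\<nu> f1 \<noteq> v" "\<nu> f2 \<noteq> v" "\<nu> f3 \<noteq> v" "\<nu> f4 \<noteq> v"
    | (1) "\<nu> f1 \<noteq> v" "\<nu> f2 \<noteq> v" "\<nu> f3 \<noteq> v" "\<nu> f4 = v"
    | (2) "\<nu> f1 \<noteq> v" "\<nu> f2 \<noteq> v" "\<nu> f3 = v" "\<nu> f4 = v"
    | (3) "\<nu> f1 \<noteq> v" "\<nu> f2 = v" "\<nu> f3 = v" "\<nu> f4 = v"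
    | (4) "\<nu> f1 = v" "\<nu> f2 = v" "\<nu> f3 = v" "\<nu> f4 = v"
    using sorted by blast
  then show ?thesis
  proof cases
    case 0
    have p: "\<nu> f1 \<in> ?V" "\<nu> f2 \<in> ?V" "\<nu> f3 \<in> ?V" "\<nu> f4 \<in> ?V" using 0 \<nu>V by auto
    have "{f \<in> {f1, f2, f3, f4}. \<nu> f \<noteq> v} = {f1, f2, f3, f4}" using 0 by auto
    then have "pairs_without ep V E v = tree_pairs ep (insert x ?V) (?E \<union> {f1, f2, f3, f4})"
      unfolding pairs_without_def E V by simp
    also have "\<dots> = resolution v f1 f2 f3 f4"
    proof -
      have r: "resolved v (\<nu> f1) (\<nu> f2) (\<nu> f3) (\<nu> f4) = tree_pairs (rewire ep a b (\<nu> f1) (\<nu> f2) (\<nu> f3) (\<nu> f4)) ?V (?E \<union> {a, b})"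
        "resolved v (\<nu> f1) (\<nu> f3) (\<nu> f2) (\<nu> f4) = tree_pairs (rewire ep a b (\<nu> f1) (\<nu> f3) (\<nu> f2) (\<nu> f4)) ?V (?E \<union> {a, b})"
        "resolved v (\<nu> f1) (\<nu> f4) (\<nu> f2) (\<nu> f3) = tree_pairs (rewire ep a b (\<nu> f1) (\<nu> f4) (\<nu> f2) (\<nu> f3)) ?V (?E \<union> {a, b})"
        using 0 by (intro resolved_both; blast)+
      show ?thesis
        unfolding tree_pairs_star4[OF base f(1) nE e p] resolution_def r rewire_counts sum.distrib[symmetric]
      proof (rule sum.cong[OF refl], goal_cases)
        case (1 T)
        then have T: "T \<subseteq> ?E" "?E - T \<subseteq> ?E" by auto
        have Tf: "finite T" "edges_within ep ?V T" "finite (?E - T)" "edges_within ep ?V (?E - T)"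
          using finite_subset[OF T(1) base(4)] edges_within_mono[OF base(3) T(1)]
            edges_within_mono[OF base(3) T(2)] base(4) by auto
        \<comment> \<open>The six products of two \<open>tree2\<close> conditions agree term by
          term. The products of a tree with a \<open>tree3\<close> are exchanged for those with a
          \<open>tree22\<close> by applying \<open>M\<close> to the part that is not the
          tree.\<close>
        note M = tree3_eq_tree22[OF base(1) Tf(1,2) p] tree3_eq_tree22[OF base(1) Tf(3,4) p]
        let ?n = "\<lambda>P. of_bool P :: nat"
        let ?t = "span_tree ep ?V" and ?t3 = "tree3 ep ?V" and ?t22 = "tree22 ep ?V (\<nu> f1)"
        have "?n (?t T) * (?n (?t3 (\<nu> f1) (\<nu> f2) (\<nu> f3) (?E - T)) + ?n (?t3 (\<nu> f1) (\<nu> f2) (\<nu> f4) (?E - T))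
           + ?n (?t3 (\<nu> f1) (\<nu> f3) (\<nu> f4) (?E - T)) + ?n (?t3 (\<nu> f2) (\<nu> f3) (\<nu> f4) (?E - T)))
           = ?n (?t T) * (?n (?t22 (\<nu> f2) (\<nu> f3) (\<nu> f4) (?E - T)) + ?n (?t22 (\<nu> f3) (\<nu> f2) (\<nu> f4) (?E - T))
           + ?n (?t22 (\<nu> f4) (\<nu> f2) (\<nu> f3) (?E - T)))"
          by (simp only: M)
        moreover have "?n (?t (?E - T)) * (?n (?t3 (\<nu> f1) (\<nu> f2) (\<nu> f3) T) + ?n (?t3 (\<nu> f1) (\<nu> f2) (\<nu> f4) T)
           + ?n (?t3 (\<nu> f1) (\<nu> f3) (\<nu> f4) T) + ?n (?t3 (\<nu> f2) (\<nu> f3) (\<nu> f4) T))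
           = ?n (?t (?E - T)) * (?n (?t22 (\<nu> f2) (\<nu> f3) (\<nu> f4) T) + ?n (?t22 (\<nu> f3) (\<nu> f2) (\<nu> f4) T)
           + ?n (?t22 (\<nu> f4) (\<nu> f2) (\<nu> f3) T))"
          by (simp only: M)
        ultimately show ?case
          by (simp only: of_bool_conj distrib_left mult.commute[of _ "of_bool (span_tree ep ?V (?E - T))"])
      qed
    qed
    finally show ?thesis .
  next
    case 1
    have p: "\<nu> f1 \<in> ?V" "\<nu> f2 \<in> ?V" "\<nu> f3 \<in> ?V" using 1 \<nu>V by auto
    have "{f \<in> {f1, f2, f3, f4}. \<nu> f \<noteq> v} = {f1, f2, f3}" using 1 by auto
    then have "pairs_without ep V E v = tree_pairs ep (insert x ?V) (?E \<union> {f1, f2, f3})"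
      unfolding pairs_without_def E V by simp
    moreover have "resolved v (\<nu> f1) (\<nu> f2) (\<nu> f3) (\<nu> f4) = tree_pairs (rewire ep a b (\<nu> f1) (\<nu> f2) (\<nu> f3) (\<nu> f4)) ?V (?E \<union> {a})"
      "resolved v (\<nu> f1) (\<nu> f3) (\<nu> f2) (\<nu> f4) = tree_pairs (rewire ep a b (\<nu> f1) (\<nu> f3) (\<nu> f2) (\<nu> f4)) ?V (?E \<union> {a})"
      using 1 by (intro resolved_left; blast)+
    moreover have "resolved v (\<nu> f1) (\<nu> f4) (\<nu> f2) (\<nu> f3) = tree_pairs (rewire ep a b (\<nu> f1) (\<nu> f4) (\<nu> f2) (\<nu> f3)) ?V (?E \<union> {b})"
      using 1 by (intro resolved_right; blast)
    moreover have "distinct [f1, f2, f3]" using f(1) by simp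
    ultimately show ?thesis
      unfolding resolution_def using tree_pairs_star3[OF base _ nE(1-3) e(1-3) p]
      by (simp only: rewire_counts sum.distrib)
  next
    case 2
    \<comment> \<open>One matching creates a loop at \<open>v\<close> and contributes 0. In the
      other two both new edges end at \<open>v\<close> and are deleted with it, which accounts for
      the factor 2.\<close>
    have p: "\<nu> f1 \<in> ?V" "\<nu> f2 \<in> ?V" using 2 \<nu>V by auto
    have "{f \<in> {f1, f2, f3, f4}. \<nu> f \<noteq> v} = {f1, f2}" using 2 by auto
    then have "pairs_without ep V E v = tree_pairs ep (insert x ?V) (?E \<union> {f1, f2})"
      unfolding pairs_without_def E V by simp
    also have "\<dots> = 2 * tree_pairs ep ?V ?E"
      using tree_pairs_star2[OF base d(1) nE(1,2) e(1,2) p] .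
    moreover have "resolved v (\<nu> f1) (\<nu> f2) (\<nu> f3) (\<nu> f4) = 0"
      using loop0[of "\<nu> f1" "\<nu> f2"] 2 by simp
    moreover have "resolved v (\<nu> f1) (\<nu> f3) (\<nu> f2) (\<nu> f4) = tree_pairs (rewire ep a b (\<nu> f1) (\<nu> f3) (\<nu> f2) (\<nu> f4)) ?V ?E"
      "resolved v (\<nu> f1) (\<nu> f4) (\<nu> f2) (\<nu> f3) = tree_pairs (rewire ep a b (\<nu> f1) (\<nu> f4) (\<nu> f2) (\<nu> f3)) ?V ?E"
      using 2 by (intro resolved_none; simp)+
    ultimately show ?thesis unfolding resolution_def by (simp add: rewire_counts)
  next
    case 3
    have p: "\<nu> f1 \<in> ?V" using 3 \<nu>V by auto
    have "{f \<in> {f1, f2, f3, f4}. \<nu> f \<noteq> v} = {f1}" using 3 by auto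
    then have "pairs_without ep V E v = tree_pairs ep (insert x ?V) (?E \<union> {f1})"
      unfolding pairs_without_def E V by simp
    also have "\<dots> = 0" using tree_pairs_star1[OF base nE(1) e(1) p] .
    moreover have "resolved v (\<nu> f1) v v v = 0" using loop0[of "\<nu> f1" v] 3 by simp
    ultimately show ?thesis unfolding resolution_def using 3 by simp
  next
    case 4
    have "{f \<in> {f1, f2, f3, f4}. \<nu> f \<noteq> v} = {}" using 4 by auto
    then have "pairs_without ep V E v = tree_pairs ep (insert x ?V) ?E"
      unfolding pairs_without_def E V by (simp only: Un_empty_right)
    also have "\<dots> = 0" using tree_pairs_star0[OF base] .
    moreover have "resolved v v v v v = 0" using loop0[of v v] 4 by simp
    ultimately show ?thesis unfolding resolution_def using 4 by simp
  qed
qed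

lemma pairs_without_eq_resolution:
  assumes v: "v \<in> V" "v \<noteq> x" and ne: "V - {x} - {v} \<noteq> {}"
    and f: "distinct [f1, f2, f3, f4]" "{f \<in> E. x \<in> ep f} = {f1, f2, f3, f4}"
  shows "pairs_without ep V E v = resolution v f1 f2 f3 f4"
proof -
  have sorted: "pairs_without ep V E v = resolution v g1 g2 g3 g4"
    if "distinct [g1, g2, g3, g4]" "{g1, g2, g3, g4} = {f1, f2, f3, f4}"
      "\<nu> g1 = v \<Longrightarrow> \<nu> g2 = v" "\<nu> g2 = v \<Longrightarrow> \<nu> g3 = v" "\<nu> g3 = v \<Longrightarrow> \<nu> g4 = v" for g1 g2 g3 g4
    using pairs_without_eq_resolution_sorted[OF v ne that(1)] f(2) that by blast
  let ?r = "resolution v f1 f2 f3 f4"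
  have r: "resolution v f1 f2 f4 f3 = ?r" "resolution v f1 f3 f2 f4 = ?r" "resolution v f2 f1 f3 f4 = ?r"
    by (rule resolution_swap34 resolution_swap23 resolution_swap12)+
  have r2: "resolution v f1 f3 f4 f2 = ?r" "resolution v f1 f4 f2 f3 = ?r"
    "resolution v f2 f3 f1 f4 = ?r" "resolution v f3 f1 f2 f4 = ?r" "resolution v f2 f1 f4 f3 = ?r"
    using resolution_swap34[of v f1 f3 f4 f2] resolution_swap23[of v f1 f2 f4 f3]
      resolution_swap23[of v f2 f1 f3 f4] resolution_swap12[of v f1 f3 f2 f4]
      resolution_swap34[of v f2 f1 f3 f4] r by simp_all
  have r3: "resolution v f2 f3 f4 f1 = ?r" "resolution v f2 f4 f1 f3 = ?r" "resolution v f3 f1 f4 f2 = ?r"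
      "resolution v f4 f1 f2 f3 = ?r"
    using resolution_swap34[of v f2 f3 f1 f4] resolution_swap23[of v f2 f1 f4 f3]
      resolution_swap12[of v f1 f3 f4 f2] resolution_swap12[of v f1 f4 f2 f3] r r2 by simp_all
  have r4: "resolution v f3 f4 f1 f2 = ?r"
    using resolution_swap23[of v f3 f1 f4 f2] r3 by simp
  have d: "f1 \<noteq> f2" "f1 \<noteq> f3" "f1 \<noteq> f4" "f2 \<noteq> f3" "f2 \<noteq> f4" "f3 \<noteq> f4" using f(1) by auto
  define goal where "goal \<longleftrightarrow> pairs_without ep V E v = ?r"
  have perm: "(\<nu> g1 = v \<longrightarrow> \<nu> g2 = v) \<and> (\<nu> g2 = v \<longrightarrow> \<nu> g3 = v) \<and> (\<nu> g3 = v \<longrightarrow> \<nu> g4 = v) \<longrightarrow> goal"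
    if "{g1, g2, g3, g4} = {f1, f2, f3, f4}" "resolution v g1 g2 g3 g4 = ?r" for g1 g2 g3 g4
  proof -
    have "set [g1, g2, g3, g4] = set [f1, f2, f3, f4]" using that(1) by simp
    then have "card (set [g1, g2, g3, g4]) = length [g1, g2, g3, g4]"
      using distinct_card[OF f(1)] by (simp only: list.size)
    then have "distinct [g1, g2, g3, g4]" by (rule card_distinct)
    then show ?thesis unfolding goal_def using sorted[OF _ that(1)] that(2) by simp
  qed
  \<comment> \<open>One arrangement for every possible set of edges leading to \<open>v\<close> that
    is not already at the end: three single edges, five pairs and three triples.\<close>
  have set: "{f1, f2, f4, f3} = {f1, f2, f3, f4}" "{f1, f3, f4, f2} = {f1, f2, f3, f4}"
    "{f2, f3, f4, f1} = {f1, f2, f3, f4}" "{f1, f3, f2, f4} = {f1, f2, f3, f4}" "{f1, f4, f2, f3} = {f1, f2, f3, f4}"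
    "{f2, f3, f1, f4} = {f1, f2, f3, f4}" "{f2, f4, f1, f3} = {f1, f2, f3, f4}" "{f3, f4, f1, f2} = {f1, f2, f3, f4}"
    "{f2, f1, f3, f4} = {f1, f2, f3, f4}" "{f3, f1, f2, f4} = {f1, f2, f3, f4}" "{f4, f1, f2, f3} = {f1, f2, f3, f4}"
    by auto
  have goal
    using perm[OF refl refl] perm[OF set(1) r(1)] perm[OF set(2) r2(1)] perm[OF set(3) r3(1)]
      perm[OF set(4) r(2)] perm[OF set(5) r2(2)] perm[OF set(6) r2(3)] perm[OF set(7) r3(2)]
      perm[OF set(8) r4] perm[OF set(9) r(3)] perm[OF set(10) r2(4)] perm[OF set(11) r3(4)]
    by argo
  then show ?thesis unfolding goal_def .
qed

end

theorem pairs_without_independent: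
  assumes "quartic ep V E" "v \<in> V" "w \<in> V"
  shows "pairs_without ep V E v = pairs_without ep V E w"
  using assms
proof (induction "card V" arbitrary: ep V E rule: less_induct)
  case less
  note q = less.prems(1)
  have fin: "finite V" "finite E" and ew: "edges_within ep V E" using q by (auto simp: quartic_def)
  show ?case
  proof (cases "v = w")
    case False
    show ?thesis
    proof (cases "V \<subseteq> {v, w}")
      case True
      then have V: "V = {v, w}" using less.prems by blast
      \<comment> \<open>On one vertex the empty set is the only spanning tree, so the count is 1
        unless a loop at the other vertex survives. By 4-regularity \<open>v\<close> and
        \<open>w\<close> carry equally many loops.\<close>
      have one: "pairs_without ep V E u = of_bool (avoiding ep E u = {})" if "V - {u} = {u'}" for u u'
      proof -
        have finA: "finite (avoiding ep E u)" using fin by (simp add: avoiding_def)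
        have "span_tree ep {u'} T \<longleftrightarrow> T = {}" if "finite T" for T
          using that unfolding span_tree_def by auto
        then have "T \<in> Pow (avoiding ep E u) \<and> span_tree ep {u'} T \<and> span_tree ep {u'} (avoiding ep E u - T) \<longleftrightarrow>
            T = {} \<and> avoiding ep E u = {}" for T
          using finA finite_subset[OF _ finA, of T] by auto
        then show ?thesis
          unfolding pairs_without_def tree_pairs_def bipart_def that by simp
      qed
      have "avoiding ep E v = {e \<in> E. ep e = {w}}" "avoiding ep E w = {e \<in> E. ep e = {v}}"
        using ew False unfolding V edges_within_def avoiding_def by auto
      moreover have "card (avoiding ep E v) + 4 = 4 + card {e \<in> E. ep e = {v}}"
        "card (avoiding ep E w) + 4 = 4 + card {e \<in> E. ep e = {w}}"
        using card_avoiding[OF q less.prems(2)] card_avoiding[OF q less.prems(3)] False unfolding V by simp_all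
      moreover have "finite (avoiding ep E v)" "finite (avoiding ep E w)"
        using fin by (simp_all add: avoiding_def)
      ultimately have "avoiding ep E v = {} \<longleftrightarrow> avoiding ep E w = {}"
        by (metis add.commute add_left_cancel card_eq_0_iff)
      moreover have "V - {v} = {w}" "V - {w} = {v}" using V False by auto
      ultimately show ?thesis using one by simp
    next
      case nsub: False
      then obtain x where xV: "x \<in> V" "x \<noteq> v" "x \<noteq> w" by blast
      show ?thesis
      \<comment> \<open>A loop at \<open>x\<close> survives both deletions and makes both counts 0;
        otherwise \<open>x\<close> has four edges to other vertices and can be resolved.\<close>
      proof (cases "\<exists>e\<in>E. ep e = {x}")
        case True
        then show ?thesis using pairs_without_other_loop[OF q] xV by metis
      next
        case no_loop: False
        have "\<exists>p. ep f = {x, p} \<and> p \<in> V - {x}" if f: "f \<in> E" "x \<in> ep f" for f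
        proof -
          obtain p r where pr: "p \<in> V" "r \<in> V" "ep f = {p, r}"
            using ew f unfolding edges_within_def by blast
          moreover have "p \<noteq> r" using no_loop f pr by auto
          ultimately show ?thesis using f(2) by (auto simp: insert_commute)
        qed
        then obtain \<nu> where \<nu>: "\<And>f. f \<in> E \<Longrightarrow> x \<in> ep f \<Longrightarrow> ep f = {x, \<nu> f} \<and> \<nu> f \<in> V - {x}" by metis
        have "card {f \<in> E. x \<in> ep f} = 4"
        proof -
          have "4 = (\<Sum>e\<in>E. incidences ep e x)" using q xV by (simp add: quartic_def)
          also have "\<dots> = (\<Sum>e\<in>E. of_bool (x \<in> ep e))"
            by (rule sum.cong) (use no_loop in \<open>auto simp: incidences_def\<close>)
          also have "\<dots> = card {f \<in> E. x \<in> ep f}" using fin by (simp add: Int_def)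
          finally show ?thesis by simp
        qed
        then obtain f1 f2 f3 f4 where f: "distinct [f1, f2, f3, f4]" "{f \<in> E. x \<in> ep f} = {f1, f2, f3, f4}"
        proof -
          assume a: thesis if "distinct [f1, f2, f3, f4]" "{f \<in> E. x \<in> ep f} = {f1, f2, f3, f4}" for f1 f2 f3 f4
          obtain xs where xs: "set xs = {f \<in> E. x \<in> ep f}" "distinct xs"
            using fin finite_distinct_list[of "{f \<in> E. x \<in> ep f}"] by auto
          then have "length xs = 4" using distinct_card[of xs] \<open>card {f \<in> E. x \<in> ep f} = 4\<close> by simp
          then obtain f1 f2 f3 f4 where "xs = [f1, f2, f3, f4]"
            by (auto simp: numeral_eq_Suc length_Suc_conv)
          then show thesis using a[of f1 f2 f3 f4] xs by simp
        qed
        have fE: "f1 \<in> E" "x \<in> ep f1" "f2 \<in> E" "x \<in> ep f2" using f(2) by blast+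
        interpret quartic_star ep V E x f1 f2 \<nu>
          using q xV(1) fE f(1) \<nu> by unfold_locales auto
        have "card (V - {x}) < card V" by (rule card_Diff1_less[OF fin(1) xV(1)])
        have IH: "resolved v p r s t = resolved w p r s t"
          if "mset [\<nu> f1, \<nu> f2, \<nu> f3, \<nu> f4] = mset [p, r, s, t]" for p r s t
          unfolding resolved_def
          by (rule less.hyps[OF _ quartic_transition[OF f that]])
            (use \<open>card (V - {x}) < card V\<close> less.prems xV in auto)
        have "resolution v f1 f2 f3 f4 = resolution w f1 f2 f3 f4"
          unfolding resolution_def by (simp add: IH)
        moreover have "V - {x} - {v} \<noteq> {}" "V - {x} - {w} \<noteq> {}"
          using less.prems xV False by auto
        ultimately show ?thesis
          using pairs_without_eq_resolution[of v f1 f2 f3 f4] pairs_without_eq_resolution[of w f1 f2 f3 f4]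
            less.prems xV f by simp
      qed
    qed
  qed simp
qed

section \<open>Counting zeros modulo 8\<close>

text \<open>The value, before reduction modulo 2, of the polynomial \<open>\<Sum>F | P F. \<Prod>e\<in>E - F. \<alpha> e\<close> at the point \<open>\<alpha>\<close> with
  zero set \<open>Z\<close>.\<close>

definition above :: "'e set \<Rightarrow> ('e set \<Rightarrow> bool) \<Rightarrow> 'e set \<Rightarrow> nat" where
  "above E P Z = card {F \<in> Pow E. Z \<subseteq> F \<and> P F}"

definition zero_count :: "('e \<Rightarrow> 'v set) \<Rightarrow> 'v set \<Rightarrow> 'e set \<Rightarrow> nat" where
  "zero_count ep V E = card {Z \<in> Pow E. even (above E (span_tree ep V) Z)}"

lemma above_cong: "(\<And>F. F \<subseteq> E \<Longrightarrow> P F \<longleftrightarrow> Q F) \<Longrightarrow> above E P Z = above E Q Z"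
  unfolding above_def by (rule arg_cong[where f = card]) blast

lemma above_add:
  assumes "finite E" "\<And>F. F \<subseteq> E \<Longrightarrow> of_bool (P F) = (of_bool (Q F) + of_bool (R F) :: nat)"
  shows "above E P Z = above E Q Z + above E R Z"
proof -
  have ab: "above E S Z = (\<Sum>F\<in>Pow E. of_bool (Z \<subseteq> F) * of_bool (S F))" for S
    unfolding above_def using assms(1) by (simp add: of_bool_conj[symmetric] Int_def del: of_bool_conj)
  have "(\<Sum>F\<in>Pow E. of_bool (Z \<subseteq> F) * of_bool (P F)) =
    (\<Sum>F\<in>Pow E. of_bool (Z \<subseteq> F) * of_bool (Q F) + of_bool (Z \<subseteq> F) * of_bool (R F) :: nat)"
  proof (rule sum.cong[OF refl])
    fix F assume "F \<in> Pow E"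
    then show "of_bool (Z \<subseteq> F) * of_bool (P F) =
      (of_bool (Z \<subseteq> F) * of_bool (Q F) + of_bool (Z \<subseteq> F) * of_bool (R F) :: nat)"
      using assms(2)[of F] by (simp only: PowD distrib_left)
  qed
  then show ?thesis unfolding ab by (simp only: sum.distrib)
qed

lemma card_Pow_Un_filter:
  assumes "finite E" "finite N" "E \<inter> N = {}"
  shows "card {X \<in> Pow (E \<union> N). P X} = (\<Sum>T\<in>Pow E. card {A \<in> Pow N. P (T \<union> A)})"
  using bipart_Un[OF assms, of "\<lambda>A _. P A"] unfolding bipart_def .

text \<open>With \<open>pow_sum\<close>, a wrapper that lets \<open>pow_rules\<close> expand counts
  over the subsets of a few named edges one edge at a time.\<close>

definition pow_count :: "('e set \<Rightarrow> bool) \<Rightarrow> 'e set \<Rightarrow> nat" where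
  "pow_count P N = card {A \<in> Pow N. P A}"

definition pow_sum :: "('e set \<Rightarrow> nat) \<Rightarrow> 'e set \<Rightarrow> nat" where
  "pow_sum f N = (\<Sum>A\<in>Pow N. f A)"

lemma pow_count_empty: "pow_count P {} = of_bool (P {})"
  unfolding pow_count_def by (cases "P {}") (simp_all add: Collect_conv_if)

lemma pow_count_insert:
  "finite N \<Longrightarrow> f \<notin> N \<Longrightarrow> pow_count P (insert f N) = pow_count P N + pow_count (\<lambda>A. P (insert f A)) N"
  unfolding pow_count_def by (rule card_Pow_insert_filter)

lemma pow_sum_empty: "pow_sum f {} = f {}"
  by (simp add: pow_sum_def)

lemma pow_sum_insert:
  "finite N \<Longrightarrow> e \<notin> N \<Longrightarrow> pow_sum f (insert e N) = pow_sum f N + pow_sum (\<lambda>A. f (insert e A)) N"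
  unfolding pow_sum_def by (rule sum_Pow_insert)

lemmas pow_rules = pow_count_empty pow_count_insert pow_sum_empty pow_sum_insert

text \<open>\<open>Z\<close> and \<open>Y\<close> are the zero sets of a point on \<open>E\<close>
  and on \<open>J\<close>, and \<open>A\<close> is the part of a tree in \<open>J\<close>. The
  monomial of the tree survives on \<open>J\<close> only if \<open>Y \<subseteq> A\<close>.\<close>

lemma zero_count_Un:
  assumes "finite E" "finite J" "E \<inter> J = {}"
  shows "zero_count ep V (E \<union> J) = (\<Sum>Z\<in>Pow E. pow_count (\<lambda>Y.
    even (pow_sum (\<lambda>A. if Y \<subseteq> A then above E (\<lambda>F. span_tree ep V (F \<union> A)) Z else 0) J)) J)"
proof -
  have "above (E \<union> J) (span_tree ep V) (Z \<union> Y) =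
    (\<Sum>A\<in>Pow J. if Y \<subseteq> A then above E (\<lambda>F. span_tree ep V (F \<union> A)) Z else 0)"
    if "Z \<subseteq> E" "Y \<subseteq> J" for Z Y
  proof -
    have "above (E \<union> J) (span_tree ep V) (Z \<union> Y) =
        card {X \<in> Pow (J \<union> E). Z \<union> Y \<subseteq> X \<and> span_tree ep V X}"
      unfolding above_def by (simp add: Un_commute)
    also have "\<dots> = (\<Sum>A\<in>Pow J. card {F \<in> Pow E. Z \<union> Y \<subseteq> A \<union> F \<and> span_tree ep V (A \<union> F)})"
      using assms by (intro card_Pow_Un_filter) auto
    also have "\<dots> = (\<Sum>A\<in>Pow J. if Y \<subseteq> A then above E (\<lambda>F. span_tree ep V (F \<union> A)) Z else 0)"
    proof (rule sum.cong[OF refl])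
      fix A assume A: "A \<in> Pow J"
      have "Z \<union> Y \<subseteq> A \<union> F \<longleftrightarrow> Z \<subseteq> F \<and> Y \<subseteq> A" if "F \<in> Pow E" for F
        using that A \<open>Z \<subseteq> E\<close> \<open>Y \<subseteq> J\<close> assms(3) by blast
      then have "{F \<in> Pow E. Z \<union> Y \<subseteq> A \<union> F \<and> span_tree ep V (A \<union> F)} =
          (if Y \<subseteq> A then {F \<in> Pow E. Z \<subseteq> F \<and> span_tree ep V (F \<union> A)} else {})"
        by (auto simp: Un_commute)
      then show "card {F \<in> Pow E. Z \<union> Y \<subseteq> A \<union> F \<and> span_tree ep V (A \<union> F)} =
          (if Y \<subseteq> A then above E (\<lambda>F. span_tree ep V (F \<union> A)) Z else 0)"
        by (simp add: above_def)
    qed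
    finally show ?thesis .
  qed
  then have "{Y \<in> Pow J. even (above (E \<union> J) (span_tree ep V) (Z \<union> Y))} = {Y \<in> Pow J.
    even (\<Sum>A\<in>Pow J. if Y \<subseteq> A then above E (\<lambda>F. span_tree ep V (F \<union> A)) Z else 0)}"
    if "Z \<in> Pow E" for Z using that by auto
  then show ?thesis
    unfolding zero_count_def card_Pow_Un_filter[OF assms] pow_count_def pow_sum_def
    by (intro sum.cong refl arg_cong[where f = card]) blast
qed

section \<open>Zeros in the variables of the edges at one vertex\<close>

context
  fixes ep :: "'e \<Rightarrow> 'v set" and V :: "'v set" and w :: 'v and E :: "'e set"
  assumes base: "finite V" "w \<notin> V" "edges_within ep V E" "finite E" "V \<noteq> {}"
begin

abbreviation trees :: "'e set \<Rightarrow> nat" where "trees \<equiv> above E (span_tree ep V)"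

abbreviation trees2 :: "'v \<Rightarrow> 'v \<Rightarrow> 'e set \<Rightarrow> nat" where "trees2 p q \<equiv> above E (tree2 ep V p q)"

lemma above_star_rules:
  shows "above E (span_tree ep (insert w V)) Z = 0"
    and "f1 \<notin> E \<Longrightarrow> ep f1 = {w, p1} \<Longrightarrow> p1 \<in> V \<Longrightarrow>
      above E (\<lambda>F. span_tree ep (insert w V) (insert f1 F)) Z = trees Z"
    and "f1 \<notin> E \<Longrightarrow> ep f1 = {w, p1} \<Longrightarrow> p1 \<in> V \<Longrightarrow> f2 \<notin> E \<Longrightarrow> ep f2 = {w, p2} \<Longrightarrow> p2 \<in> V \<Longrightarrow>
      f1 \<noteq> f2 \<Longrightarrow> above E (\<lambda>F. span_tree ep (insert w V) (insert f1 (insert f2 F))) Z = trees2 p1 p2 Z"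
    and "f1 \<notin> E \<Longrightarrow> ep f1 = {w, p1} \<Longrightarrow> p1 \<in> V \<Longrightarrow> f2 \<notin> E \<Longrightarrow> ep f2 = {w, p2} \<Longrightarrow> p2 \<in> V \<Longrightarrow>
      f3 \<notin> E \<Longrightarrow> ep f3 = {w, p3} \<Longrightarrow> p3 \<in> V \<Longrightarrow> f1 \<noteq> f2 \<Longrightarrow> f1 \<noteq> f3 \<Longrightarrow> f2 \<noteq> f3 \<Longrightarrow>
      above E (\<lambda>F. span_tree ep (insert w V) (insert f1 (insert f2 (insert f3 F)))) Z = above E (tree3 ep V p1 p2 p3) Z"
proof -
  show "above E (span_tree ep (insert w V)) Z = 0"
    using above_cong[of E "span_tree ep (insert w V)" "\<lambda>_. False" Z] star_rules(1)[OF base]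
    by (simp add: above_def)
qed (rule above_cong, rule star_rules[OF base]; assumption)+

lemma zero_count_star1:
  assumes "f1 \<notin> E" "ep f1 = {w, p1}" "p1 \<in> V"
  shows "zero_count ep (insert w V) (E \<union> {f1}) = (\<Sum>Z\<in>Pow E. if odd (trees Z) then 0 else 2)"
proof -
  have "E \<inter> {f1} = {}" "finite {f1}" using assms by blast+
  note Un = zero_count_Un[OF base(4) \<open>finite {f1}\<close> \<open>E \<inter> {f1} = {}\<close>]
  show ?thesis
    unfolding Un using assms
    by (intro sum.cong refl)
      (simp add: pow_rules above_star_rules)
qed

text \<open>For fixed \<open>Z\<close> the polynomial is \<open>f0 (x1 + x2) + d\<close> with
  constants \<open>f0\<close>, \<open>d\<close>: it has 2 zeros if \<open>f0 = 1\<close>, and 4 or 0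
  otherwise.\<close>

lemma zero_count_star2:
  assumes "f1 \<notin> E" "ep f1 = {w, p1}" "p1 \<in> V" "f2 \<notin> E" "ep f2 = {w, p2}" "p2 \<in> V" "f1 \<noteq> f2"
  shows "zero_count ep (insert w V) (E \<union> {f1, f2}) =
    (\<Sum>Z\<in>Pow E. if odd (trees Z) then 2 else if odd (trees2 p1 p2 Z) then 0 else 4)"
proof -
  have "E \<inter> {f1, f2} = {}" "finite {f1, f2}" using assms by blast+
  note Un = zero_count_Un[OF base(4) \<open>finite {f1, f2}\<close> \<open>E \<inter> {f1, f2} = {}\<close>]
  show ?thesis
    unfolding Un using assms
    by (intro sum.cong refl)
      (simp add: pow_rules above_star_rules)
qed

text \<open>For fixed \<open>Z\<close>, if \<open>f0 = 1\<close> the polynomial is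
  \<open>x1 x2 + x1 x3 + x2 x3\<close> plus an affine part, and the parity condition
  \<open>ev\<close> on its linear coefficients forces exactly 4 zeros. If \<open>f0 = 0\<close> a
  nonconstant affine polynomial also has 4.\<close>

lemma zero_count_star3:
  assumes "f1 \<notin> E" "ep f1 = {w, p1}" "p1 \<in> V" "f2 \<notin> E" "ep f2 = {w, p2}" "p2 \<in> V"
    "f3 \<notin> E" "ep f3 = {w, p3}" "p3 \<in> V" "f1 \<noteq> f2" "f1 \<noteq> f3" "f2 \<noteq> f3"
    and ev: "\<And>Z. Z \<subseteq> E \<Longrightarrow> even (trees2 p1 p2 Z + trees2 p1 p3 Z + trees2 p2 p3 Z)"
  shows "zero_count ep (insert w V) (E \<union> {f1, f2, f3}) =
    (\<Sum>Z\<in>Pow E. if odd (trees Z) \<or> odd (trees2 p1 p2 Z) \<or> odd (trees2 p1 p3 Z) \<or> odd (trees2 p2 p3 Z)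
      then 4 else if odd (above E (tree3 ep V p1 p2 p3) Z) then 0 else 8)"
proof -
  have "E \<inter> {f1, f2, f3} = {}" "finite {f1, f2, f3}" using assms by blast+
  note Un = zero_count_Un[OF base(4) \<open>finite {f1, f2, f3}\<close> \<open>E \<inter> {f1, f2, f3} = {}\<close>]
  show ?thesis
    unfolding Un
  proof (rule sum.cong[OF refl], goal_cases)
    case (1 Z)
    then have evZ: "even (trees2 p1 p2 Z + trees2 p1 p3 Z + trees2 p2 p3 Z)" using ev by blast
    show ?case
      using assms(1-12) evZ
      by (simp add: pow_rules above_star_rules) auto
  qed
qed

end

lemma four_mult_mod_8_cong: "even x = even y \<Longrightarrow> 4 * x mod 8 = 4 * y mod (8 :: nat)"
  by presburger

lemma sum_card_swap:
  assumes "finite A" "finite B"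
  shows "(\<Sum>a\<in>A. card {b \<in> B. R a b}) = (\<Sum>b\<in>B. card {a \<in> A. R a b})"
proof -
  have "(\<Sum>a\<in>A. card {b \<in> B. R a b}) = (\<Sum>a\<in>A. \<Sum>b\<in>B. of_bool (R a b))"
    using assms by (simp add: Int_def)
  also have "\<dots> = (\<Sum>b\<in>B. \<Sum>a\<in>A. of_bool (R a b))" by (rule sum.swap)
  also have "\<dots> = (\<Sum>b\<in>B. card {a \<in> A. R a b})" using assms by (simp add: Int_def)
  finally show ?thesis .
qed

text \<open>Only the coefficient of the product of all variables survives in a sum over all points.\<close>

lemma odd_sum_above_product:
  assumes "finite E"
  shows "odd (\<Sum>Z\<in>Pow E. above E P Z * above E Q Z) \<longleftrightarrow>
    odd (card {s \<in> Pow E \<times> Pow E. P (fst s) \<and> Q (snd s) \<and> fst s \<inter> snd s = {}})"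
proof -
  define S where "S = {s \<in> Pow E \<times> Pow E. P (fst s) \<and> Q (snd s)}"
  have finS: "finite S" using assms by (simp add: S_def)
  have "above E P Z * above E Q Z = card {s \<in> S. Z \<subseteq> fst s \<inter> snd s}" for Z
  proof -
    have "{s \<in> S. Z \<subseteq> fst s \<inter> snd s} = {F \<in> Pow E. Z \<subseteq> F \<and> P F} \<times> {F \<in> Pow E. Z \<subseteq> F \<and> Q F}"
      unfolding S_def by auto
    then show ?thesis by (simp only: above_def card_cartesian_product)
  qed
  \<comment> \<open>After swapping the sums a pair is counted once for each subset of its
    intersection, which is odd only if the intersection is empty.\<close>
  then have "(\<Sum>Z\<in>Pow E. above E P Z * above E Q Z) = (\<Sum>s\<in>S. card {Z \<in> Pow E. Z \<subseteq> fst s \<inter> snd s})"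
    using sum_card_swap[of "Pow E" S "\<lambda>Z s. Z \<subseteq> fst s \<inter> snd s"] assms finS by simp
  also have "\<dots> = (\<Sum>s\<in>S. 2 ^ card (fst s \<inter> snd s))"
  proof (rule sum.cong[OF refl])
    fix s assume "s \<in> S"
    then have sub: "fst s \<inter> snd s \<subseteq> E" by (auto simp: S_def)
    then have "{Z \<in> Pow E. Z \<subseteq> fst s \<inter> snd s} = Pow (fst s \<inter> snd s)" by blast
    then show "card {Z \<in> Pow E. Z \<subseteq> fst s \<inter> snd s} = 2 ^ card (fst s \<inter> snd s)"
      using card_Pow[OF finite_subset[OF sub assms]] by (simp only:)
  qed
  finally have "odd (\<Sum>Z\<in>Pow E. above E P Z * above E Q Z) \<longleftrightarrow>
      odd (card {s \<in> S. odd (2 ^ card (fst s \<inter> snd s) :: nat)})"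
    by (simp only: even_sum_iff[OF finS])
  also have "{s \<in> S. odd (2 ^ card (fst s \<inter> snd s) :: nat)} =
      {s \<in> Pow E \<times> Pow E. P (fst s) \<and> Q (snd s) \<and> fst s \<inter> snd s = {}}"
  proof -
    have "odd (2 ^ card (fst s \<inter> snd s) :: nat) \<longleftrightarrow> fst s \<inter> snd s = {}" if "s \<in> S" for s
    proof -
      have "finite (fst s \<inter> snd s)" using that assms finite_subset[of "fst s" E] by (auto simp: S_def)
      then show ?thesis by (simp add: card_eq_0_iff)
    qed
    then show ?thesis unfolding S_def by blast
  qed
  finally show ?thesis .
qed

text \<open>The empty set stands for the product of all variables, so this is the case of a
  polynomial without that monomial. It is multiplied by the constant 1, represented by the single
  set \<open>E\<close>.\<close>

lemma even_sum_above:
  assumes "finite E" "\<not> P {}"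
  shows "even (\<Sum>Z\<in>Pow E. above E P Z)"
proof -
  have "above E (\<lambda>F. F = E) Z = 1" if "Z \<in> Pow E" for Z
  proof -
    have "{F \<in> Pow E. Z \<subseteq> F \<and> F = E} = {E}" using that by auto
    then show ?thesis by (simp add: above_def)
  qed
  then have "(\<Sum>Z\<in>Pow E. above E P Z) = (\<Sum>Z\<in>Pow E. above E P Z * above E (\<lambda>F. F = E) Z)"
    by (intro sum.cong) simp_all
  moreover have "{s \<in> Pow E \<times> Pow E. P (fst s) \<and> snd s = E \<and> fst s \<inter> snd s = {}} = {}"
    using assms(2) by (auto simp: Int_absorb2)
  ultimately show ?thesis
    using odd_sum_above_product[OF assms(1), of P "\<lambda>F. F = E"] by (metis (no_types, lifting) card.empty even_zero)
qed

section \<open>Forests with two components\<close>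

lemma tree2_sym: "tree2 ep V q p F \<longleftrightarrow> tree2 ep V p q F"
  unfolding tree2_def by (simp add: eq_commute)

lemma tree2_iff_pins:
  assumes "p \<in> V" "q \<in> V"
  shows "tree2 ep V p q F \<longleftrightarrow> card F + 2 = card V \<and> pins ep V {p, q} F"
proof -
  have "pins ep V {p, q} F \<longleftrightarrow> binds ep V F (\<lambda>g. \<forall>r\<in>{p, q}. g r = g p)"
    using assms by (intro pins_iff_binds) auto
  also have "\<dots> \<longleftrightarrow> binds ep V F (\<lambda>g. g p = g q)" by (rule binds_cong) auto
  finally show ?thesis unfolding tree2_def by blast
qed

lemma tree2_distinct:
  assumes "tree2 ep V p q F" "finite V" "finite F" "edges_within ep V F" "p \<in> V"
  shows "p \<noteq> q"
proof
  assume "p = q"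
  then have "card F + 2 = card V" "pins ep V {p} F" using tree2_iff_pins[of p V q ep F] assms by auto
  then show False using pins_card[of ep V "{p}" F] assms by simp
qed

text \<open>\<open>F\<close> has two components, one containing \<open>p\<close> and the other
  \<open>q\<close>; the potential \<open>g\<close> telling them apart shows with which of them
  \<open>r\<close> lies.\<close>

lemma tree2_exclusive:
  assumes t: "tree2 ep V p q F" and fin: "finite V" "finite F" and ew: "edges_within ep V F"
    and V: "p \<in> V" "q \<in> V" "r \<in> V"
  shows "tree2 ep V p r F \<noteq> tree2 ep V q r F"
proof -
  have c: "card F + 2 = card V" and b: "binds ep V F (\<lambda>g. g p = g q)" using t by (auto simp: tree2_def)
  have "\<exists>g. flat ep F g \<and> g p \<noteq> g q"
  proof (rule ccontr)
    assume "\<not> ?thesis"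
    then have "pins ep V {p} F" using b unfolding pins_singleton_iff[OF V(1)] binds_def by blast
    then show False using pins_card[of ep V "{p}" F] fin ew V c by simp
  qed
  then obtain g where g: "flat ep F g" "g p \<noteq> g q" by blast
  have key: "\<not> binds ep V F (\<lambda>h. h u = h r) \<and> binds ep V F (\<lambda>h. h v = h r)"
    if u: "{u, v} = {p, q}" "g r = g u" for u v
  proof
    have uv: "u \<in> V" "v \<in> V" "g u \<noteq> g v" using u(1) V g(2) by (auto simp: doubleton_eq_iff)
    have b': "binds ep V F (\<lambda>h. h u = h v)"
      using b u(1) by (auto simp: doubleton_eq_iff eq_commute)
    show "\<not> binds ep V F (\<lambda>h. h u = h r)" using g(1) u(2) uv unfolding binds_def by metis
    show "binds ep V F (\<lambda>h. h v = h r)"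
      unfolding binds_def
    proof (intro allI impI)
      fix h assume h: "flat ep F h \<and> h v = h r"
      have "h u = h v"
      proof (rule ccontr)
        \<comment> \<open>Modulo 2 two potentials that both separate \<open>u\<close> and
          \<open>v\<close> have a sum that identifies them. The sum is therefore constant on
          \<open>V\<close>, and \<open>h v = h r\<close> carries over to \<open>g\<close>.\<close>
        assume ne: "h u \<noteq> h v"
        have "flat ep F (\<lambda>x. h x + g x)" using h g(1) by (intro flat_add) auto
        moreover have "h u + g u = h v + g v"
          using ne uv(3) by (cases "h u"; cases "h v"; cases "g u"; cases "g v") simp_all
        ultimately have "h r + g r = h v + g v" using b' uv V unfolding binds_def by blast
        then have "g r = g v" using h by (cases "h r"; cases "g r"; cases "g v") simp_all
        then show False using u(2) uv(3) by simp
      qed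
      then show "\<forall>x\<in>V. \<forall>y\<in>V. h x = h y" using b' h unfolding binds_def by blast
    qed
  qed
  have "g r = g p \<or> g r = g q" using g(2) by (cases "g r"; cases "g p"; cases "g q") simp_all
  then show ?thesis
    using key[of p q] key[of q p] c unfolding tree2_def by (auto simp: insert_commute)
qed

context
  fixes ep :: "'e \<Rightarrow> 'v set" and V :: "'v set" and w :: 'v and E :: "'e set" and p q r :: 'v
  assumes base: "finite V" "w \<notin> V" "edges_within ep V E" "finite E" "V \<noteq> {}"
    and V: "p \<in> V" "q \<in> V" "r \<in> V"
begin

text \<open>The forests of \<open>f1 + f2 + f3\<close>: by exclusiveness exactly two of the three
  conditions hold, and they tell which of \<open>p\<close>, \<open>q\<close>, \<open>r\<close> is
  separated from the other two.\<close>

definition split_forest :: "'e set \<Rightarrow> bool" where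
  "split_forest F \<longleftrightarrow> tree2 ep V p q F \<or> tree2 ep V p r F \<or> tree2 ep V q r F"

lemma subset_edges: "F \<subseteq> E \<Longrightarrow> finite F" "F \<subseteq> E \<Longrightarrow> edges_within ep V F"
  by (rule finite_subset[OF _ base(4)], assumption) (rule edges_within_mono[OF base(3)])

lemma tree2_exclusive_triple:
  assumes "F \<subseteq> E"
  shows "tree2 ep V p q F \<Longrightarrow> tree2 ep V p r F \<noteq> tree2 ep V q r F"
    "tree2 ep V p r F \<Longrightarrow> tree2 ep V p q F \<noteq> tree2 ep V q r F"
    "tree2 ep V q r F \<Longrightarrow> tree2 ep V p q F \<noteq> tree2 ep V p r F"
  using tree2_exclusive[of ep V p q F r] tree2_exclusive[of ep V p r F q] tree2_exclusive[of ep V q r F p]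
    base(1) subset_edges[OF assms] V by (simp_all add: tree2_sym[of ep V q p] tree2_sym[of ep V r q] tree2_sym[of ep V r p])

abbreviation "forest_p \<equiv> above E (\<lambda>F. tree2 ep V p q F \<and> tree2 ep V p r F)"
abbreviation "forest_q \<equiv> above E (\<lambda>F. tree2 ep V p q F \<and> tree2 ep V q r F)"
abbreviation "forest_r \<equiv> above E (\<lambda>F. tree2 ep V p r F \<and> tree2 ep V q r F)"

lemma trees2_eq:
  "above E (tree2 ep V p q) Z = forest_p Z + forest_q Z"
  "above E (tree2 ep V p r) Z = forest_p Z + forest_r Z"
  "above E (tree2 ep V q r) Z = forest_q Z + forest_r Z"
  "above E split_forest Z = forest_p Z + above E (\<lambda>F. tree2 ep V q r F) Z"
proof -
  have "of_bool (tree2 ep V p q F) = (of_bool (tree2 ep V p q F \<and> tree2 ep V p r F) + of_bool (tree2 ep V p q F \<and> tree2 ep V q r F) :: nat)"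
    "of_bool (tree2 ep V p r F) = (of_bool (tree2 ep V p q F \<and> tree2 ep V p r F) + of_bool (tree2 ep V p r F \<and> tree2 ep V q r F) :: nat)"
    "of_bool (tree2 ep V q r F) = (of_bool (tree2 ep V p q F \<and> tree2 ep V q r F) + of_bool (tree2 ep V p r F \<and> tree2 ep V q r F) :: nat)"
    "of_bool (split_forest F) = (of_bool (tree2 ep V p q F \<and> tree2 ep V p r F) + of_bool (tree2 ep V q r F) :: nat)"
    if "F \<subseteq> E" for F
    using tree2_exclusive_triple[OF that] unfolding split_forest_def
    by (cases "tree2 ep V p q F"; cases "tree2 ep V p r F"; cases "tree2 ep V q r F"; simp)+
  note eqs = this
  show "above E (tree2 ep V p q) Z = forest_p Z + forest_q Z"
    "above E (tree2 ep V p r) Z = forest_p Z + forest_r Z"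
    "above E (tree2 ep V q r) Z = forest_q Z + forest_r Z"
    "above E split_forest Z = forest_p Z + above E (\<lambda>F. tree2 ep V q r F) Z"
    by (rule above_add[OF base(4)], erule eqs)+
qed

lemma odd_trees_if:
  assumes Z: "Z \<subseteq> E"
  shows "odd (forest_p Z) \<Longrightarrow> odd (forest_q Z) \<Longrightarrow> odd (above E (span_tree ep V) Z)"
    and "odd (forest_p Z) \<Longrightarrow> odd (forest_r Z) \<Longrightarrow> odd (above E (span_tree ep V) Z)"
    and "odd (forest_q Z) \<Longrightarrow> odd (forest_r Z) \<Longrightarrow> odd (above E (span_tree ep V) Z)"
proof -
  have tr: "above E (span_tree ep V) Z = card {F \<in> Pow E. Z \<subseteq> F \<and> card F + 1 = card V \<and> pins ep V {c} F}"
    if "c \<in> V" for c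
    unfolding above_def span_tree_iff_pins[OF that] ..
  have fo: "above E (\<lambda>F. tree2 ep V a b F \<and> tree2 ep V a c F) Z =
      card {F \<in> Pow E. Z \<subseteq> F \<and> card F + 2 = card V \<and> pins ep V {a, b} F \<and> pins ep V {a, c} F}"
    if "a \<in> V" "b \<in> V" "c \<in> V" for a b c
    unfolding above_def tree2_iff_pins[OF that(1,2)] tree2_iff_pins[OF that(1,3)]
    by (intro arg_cong[where f = card] Collect_cong) blast
  have X: "odd (above E (\<lambda>F. tree2 ep V a b F \<and> tree2 ep V a c F) Z) \<Longrightarrow>
      odd (above E (\<lambda>F. tree2 ep V b a F \<and> tree2 ep V b c F) Z) \<Longrightarrow> odd (above E (span_tree ep V) Z)"
    if "a \<in> V" "b \<in> V" "c \<in> V" for a b c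
    unfolding tr[OF that(3)] fo[OF that(1,2,3)] fo[OF that(2,1,3)]
    by (rule forest_parity_rank_one[OF base(1) that base(4) Z base(3)])
  show "odd (forest_p Z) \<Longrightarrow> odd (forest_q Z) \<Longrightarrow> odd (above E (span_tree ep V) Z)"
    using X[of p q r] V by (simp add: tree2_sym[of ep V q p])
  show "odd (forest_p Z) \<Longrightarrow> odd (forest_r Z) \<Longrightarrow> odd (above E (span_tree ep V) Z)"
    using X[of p r q] V by (simp add: tree2_sym[of ep V r p] tree2_sym[of ep V r q] conj_commute)
  show "odd (forest_q Z) \<Longrightarrow> odd (forest_r Z) \<Longrightarrow> odd (above E (span_tree ep V) Z)"
    using X[of q r p] V by (simp add: tree2_sym[of ep V r p] tree2_sym[of ep V r q] tree2_sym[of ep V q p] conj_commute)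
qed

lemma star3_counts:
  assumes f: "f1 \<notin> E" "ep f1 = {w, p}" "f2 \<notin> E" "ep f2 = {w, q}" "f3 \<notin> E" "ep f3 = {w, r}"
      "f1 \<noteq> f2" "f1 \<noteq> f3" "f2 \<noteq> f3"
    and cE: "card E + 3 = 2 * card V"
    and c3: "p \<noteq> q \<or> p \<noteq> r \<Longrightarrow> card V \<ge> 3"
  shows "\<exists>N. tree_pairs ep (insert w V) (E \<union> {f1, f2, f3}) = 4 * N \<and>
    zero_count ep (insert w V) (E \<union> {f1, f2, f3}) mod 8 = 4 * ((\<Sum>Z\<in>Pow E. above E (span_tree ep V) Z) + N) mod 8"
proof (intro exI conjI)
  let ?t = "above E (span_tree ep V)" and ?s = "above E split_forest"
  \<comment> \<open>The factor 4 consists of a 2 from \<open>two\<close>, as a split forest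
    satisfies two \<open>tree2\<close> conditions, and a 2 from the order of the parts, by
    complementation in \<open>N'\<close>.\<close>
  let ?N = "card {T \<in> Pow E. span_tree ep V T \<and> split_forest (E - T)}"
  have two: "of_bool (tree2 ep V p q F) + of_bool (tree2 ep V p r F) + of_bool (tree2 ep V q r F)
      = (2 * of_bool (split_forest F) :: nat)" if "F \<subseteq> E" for F
    using tree2_exclusive_triple[OF that] unfolding split_forest_def
    by (cases "tree2 ep V p q F"; cases "tree2 ep V p r F"; cases "tree2 ep V q r F") simp_all
  have N: "?N = (\<Sum>T\<in>Pow E. of_bool (span_tree ep V T) * of_bool (split_forest (E - T)))"
    using base(4) by (simp add: of_bool_conj[symmetric] Int_def del: of_bool_conj)
  have N': "?N = (\<Sum>T\<in>Pow E. of_bool (split_forest T) * of_bool (span_tree ep V (E - T)))"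
    unfolding N by (rule sum.reindex_bij_witness[of _ "\<lambda>T. E - T" "\<lambda>T. E - T"]) (auto simp: double_diff)
  have d: "distinct [f1, f2, f3]" using f(7-9) by simp
  have "tree_pairs ep (insert w V) (E \<union> {f1, f2, f3}) = (\<Sum>T\<in>Pow E.
      2 * (of_bool (span_tree ep V T) * of_bool (split_forest (E - T))) +
      2 * (of_bool (split_forest T) * of_bool (span_tree ep V (E - T))))"
    unfolding tree_pairs_star3[OF base d f(1,3,5,2,4,6) V]
  proof (rule sum.cong[OF refl], goal_cases)
    case (1 T)
    then have T: "T \<subseteq> E" "E - T \<subseteq> E" by auto
    have e1: "of_bool (span_tree ep V T) * of_bool (tree2 ep V p q (E - T)) + of_bool (span_tree ep V T) * of_bool (tree2 ep V p r (E - T))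
        + of_bool (span_tree ep V T) * of_bool (tree2 ep V q r (E - T)) =
        (of_bool (span_tree ep V T) * (2 * of_bool (split_forest (E - T))) :: nat)"
      by (simp only: distrib_left[symmetric] two[OF T(2)])
    have e2: "of_bool (tree2 ep V p q T) * of_bool (span_tree ep V (E - T)) + of_bool (tree2 ep V p r T) * of_bool (span_tree ep V (E - T))
        + of_bool (tree2 ep V q r T) * of_bool (span_tree ep V (E - T)) =
        (2 * of_bool (split_forest T) * of_bool (span_tree ep V (E - T)) :: nat)"
      by (simp only: distrib_right[symmetric] two[OF T(1)])
    show ?case
      unfolding of_bool_conj using e1 e2 by linarith
  qed
  then show "tree_pairs ep (insert w V) (E \<union> {f1, f2, f3}) = 4 * ?N"
    using N N' by (simp only: sum.distrib sum_distrib_left[symmetric])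
  define C where "C Z \<longleftrightarrow> odd (?t Z) \<or> odd (above E (tree2 ep V p q) Z) \<or> odd (above E (tree2 ep V p r) Z)
      \<or> odd (above E (tree2 ep V q r) Z)" for Z
  define D where "D Z \<longleftrightarrow> odd (above E (tree3 ep V p q r) Z)" for Z
  \<comment> \<open>If \<open>?t Z\<close> is even, at most one of the three forest counts is odd.
    Hence some pairwise sum is odd exactly if their total \<open>?s Z\<close> is, and the
    disjunction becomes a polynomial.\<close>
  have C_iff: "C Z \<longleftrightarrow> odd (?t Z + ?s Z + ?t Z * ?s Z)" if "Z \<subseteq> E" for Z
    using odd_trees_if[OF that] unfolding C_def trees2_eq by auto
  have ev: "even (above E (tree2 ep V p q) Z + above E (tree2 ep V p r) Z + above E (tree2 ep V q r) Z)" for Z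
    unfolding trees2_eq by presburger
  have "zero_count ep (insert w V) (E \<union> {f1, f2, f3}) = (\<Sum>Z\<in>Pow E. if C Z then 4 else if D Z then 0 else 8)"
    unfolding C_def D_def
    by (rule zero_count_star3[OF base f(1,2) V(1) f(3,4) V(2) f(5,6) V(3) f(7-9) ev])
  also have "\<dots> = (\<Sum>Z\<in>Pow E. 4 * of_bool (C Z) + 8 * of_bool (\<not> C Z \<and> \<not> D Z))"
    by (rule sum.cong) auto
  also have "\<dots> = 4 * card {Z \<in> Pow E. C Z} + 8 * (\<Sum>Z\<in>Pow E. of_bool (\<not> C Z \<and> \<not> D Z))"
    using base(4) by (simp add: sum.distrib sum_distrib_left[symmetric] Int_def del: of_bool_conj)
  finally have zc: "zero_count ep (insert w V) (E \<union> {f1, f2, f3}) mod 8 = 4 * card {Z \<in> Pow E. C Z} mod 8"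
    by simp
  have "even (card {Z \<in> Pow E. C Z}) \<longleftrightarrow> even (\<Sum>Z\<in>Pow E. ?t Z + ?s Z + ?t Z * ?s Z)"
  proof -
    have "{Z \<in> Pow E. C Z} = {Z \<in> Pow E. odd (?t Z + ?s Z + ?t Z * ?s Z)}" using C_iff by blast
    then show ?thesis using even_sum_iff[of "Pow E" "\<lambda>Z. ?t Z + ?s Z + ?t Z * ?s Z"] base(4) by simp
  qed
  \<comment> \<open>The empty set could only be a split forest on two vertices with
    \<open>p\<close>, \<open>q\<close>, \<open>r\<close> not all equal, which \<open>c3\<close>
    excludes.\<close>
  moreover have "even (\<Sum>Z\<in>Pow E. ?s Z)"
  proof (rule even_sum_above[OF base(4)], rule notI)
    assume "split_forest {}"
    then have "card V = 2 \<and> (p \<noteq> q \<or> p \<noteq> r)"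
      using tree2_distinct[of ep V p q "{}"] tree2_distinct[of ep V p r "{}"] tree2_distinct[of ep V q r "{}"] base(1) V
      unfolding split_forest_def tree2_def edges_within_def by auto
    then show False using c3 by simp
  qed
  moreover have "even (\<Sum>Z\<in>Pow E. ?t Z * ?s Z) \<longleftrightarrow> even ?N"
  proof -
    \<comment> \<open>By \<open>cE\<close> a tree and a split forest have together as many edges as
      \<open>E\<close>, so disjoint ones are complementary.\<close>
    have "{s \<in> Pow E \<times> Pow E. span_tree ep V (fst s) \<and> split_forest (snd s) \<and> fst s \<inter> snd s = {}} =
      (\<lambda>T. (T, E - T)) ` {T \<in> Pow E. span_tree ep V T \<and> split_forest (E - T)}" (is "?L = ?R")
    proof
      show "?L \<subseteq> ?R"
      proof
        fix s assume s: "s \<in> ?L"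
        obtain T F where TF: "s = (T, F)" by fastforce
        have *: "T \<subseteq> E" "F \<subseteq> E" "span_tree ep V T" "split_forest F" "T \<inter> F = {}" using s TF by auto
        have "card T + 1 = card V" "card F + 2 = card V"
          using *(3,4) unfolding span_tree_def split_forest_def tree2_def by auto
        moreover have "card (T \<union> F) = card T + card F"
          using * subset_edges by (intro card_Un_disjoint) auto
        ultimately have "card (T \<union> F) = card E" using cE by linarith
        then have "T \<union> F = E" using * base(4) by (intro card_subset_eq) auto
        then have "F = E - T" using *(5) by blast
        then show "s \<in> ?R" using * TF by blast
      qed
    qed auto
    moreover have "inj_on (\<lambda>T. (T, E - T)) {T \<in> Pow E. span_tree ep V T \<and> split_forest (E - T)}"
      by (auto simp: inj_on_def)
    ultimately show ?thesis
      using odd_sum_above_product[OF base(4), of "span_tree ep V" split_forest] by (simp only: card_image) blast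
  qed
  ultimately have "even (card {Z \<in> Pow E. C Z}) \<longleftrightarrow> even ((\<Sum>Z\<in>Pow E. ?t Z) + ?N)"
    by (simp add: sum.distrib)
  then have "4 * card {Z \<in> Pow E. C Z} mod 8 = 4 * ((\<Sum>Z\<in>Pow E. ?t Z) + ?N) mod 8"
    by (rule four_mult_mod_8_cong)
  then show "zero_count ep (insert w V) (E \<union> {f1, f2, f3}) mod 8 = 4 * ((\<Sum>Z\<in>Pow E. ?t Z) + ?N) mod 8"
    using zc by simp
qed

end

text \<open>By Laplace expansion this parity is a determinant modulo 2: its rows are the edges, its
  columns those of the incidence matrix for \<open>V - {p}\<close> followed by those for
  \<open>V - {p, q}\<close>. With a third vertex \<open>r\<close> the column of \<open>r\<close>
  occurs twice, so the determinant is 0.\<close>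

lemma even_tree_forest_partitions:
  assumes V: "finite V" "p \<in> V" "q \<in> V" "p \<noteq> q" "3 \<le> card V"
    and E: "finite E" "edges_within ep V E" "card E + 3 = 2 * card V"
  shows "even (card {T \<in> Pow E. span_tree ep V T \<and> tree2 ep V p q (E - T)})"
proof -
  define A where "A = Inl ` (V - {p}) \<union> (Inr ` (V - {p, q}) :: ('a + 'a) set)"
  have finA: "finite A" using V by (simp add: A_def)
  have cV: "card (V - {p}) = card V - 1" "card (V - {p, q}) = card V - 2"
    using V by (simp_all add: card_Diff_subset)
  have "card A = card (V - {p}) + card (V - {p, q})"
    unfolding A_def using V by (subst card_Un_disjoint) (auto simp: card_image)
  then have cA: "card A = card E" using cV V(5) E(3) by linarith
  define U where "U = {u :: 'a + 'a \<Rightarrow> bit. \<forall>i. i \<notin> A \<longrightarrow> u i = 0}"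
  have U_iff: "u \<in> U \<longleftrightarrow> (\<forall>v. v \<notin> V - {p} \<longrightarrow> u (Inl v) = 0) \<and> (\<forall>v. v \<notin> V - {p, q} \<longrightarrow> u (Inr v) = 0)" for u
  proof -
    have "Inl v \<in> A \<longleftrightarrow> v \<in> V - {p}" "Inr v \<in> A \<longleftrightarrow> v \<in> V - {p, q}" for v by (auto simp: A_def)
    then show ?thesis unfolding U_def mem_Collect_eq split_sum_all by presburger
  qed
  have forms: "bit_form (\<lambda>u :: 'a + 'a \<Rightarrow> bit. diff ep e (\<lambda>v. u (Inl v)))"
    "bit_form (\<lambda>u :: 'a + 'a \<Rightarrow> bit. diff ep e (\<lambda>v. u (Inr v)))" if "e \<in> E" for e
    using diff_form[OF E(2) that] by (simp_all add: bit_form_def)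
  have parity: "odd (card {S \<in> Pow E. \<forall>u\<in>U. (\<forall>e\<in>S. diff ep e (\<lambda>v. u (Inl v)) = 0) \<and>
      (\<forall>e\<in>E - S. diff ep e (\<lambda>v. u (Inr v)) = 0) \<longrightarrow> u = (\<lambda>_. 0)}) \<longleftrightarrow>
    (\<forall>u\<in>U. (\<forall>e\<in>E. diff ep e (\<lambda>v. u (Inl v)) = diff ep e (\<lambda>v. u (Inr v))) \<longrightarrow> u = (\<lambda>_. 0))"
  proof (rule odd_card_transversals[OF E(1)])
    show "bit_subspace U" unfolding U_def by (rule bit_subspace_supported(1)[OF finA])
    show "2 ^ card E \<le> card U" unfolding U_def bit_subspace_supported(2)[OF finA] cA by simp
  qed (rule forms; assumption)+
  have trans: "(\<forall>u\<in>U. (\<forall>e\<in>S. diff ep e (\<lambda>v. u (Inl v)) = 0) \<and>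
      (\<forall>e\<in>E - S. diff ep e (\<lambda>v. u (Inr v)) = 0) \<longrightarrow> u = (\<lambda>_. 0)) \<longleftrightarrow>
      span_tree ep V S \<and> tree2 ep V p q (E - S)" (is "?L \<longleftrightarrow> ?R") if S: "S \<subseteq> E" for S
  proof -
    have ew: "edges_within ep V S" "edges_within ep V (E - S)"
      using edges_within_mono[OF E(2)] S by blast+
    have finS: "finite S" "finite (E - S)" using S E(1) finite_subset by auto
    have "?L \<longleftrightarrow> pins ep V {p} S \<and> pins ep V {p, q} (E - S)"
    proof
      assume L: ?L
      have "pins ep V {p} S"
        unfolding pins_def
      proof (intro allI impI ballI)
        fix g y assume g: "flat ep S g \<and> (\<forall>x\<in>{p}. g x = 0)" and y: "y \<in> V"
        define h where "h v = (if v \<in> V then g v else 0)" for v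
        have h0: "v \<notin> V - {p} \<Longrightarrow> h v = 0" for v using g by (auto simp: h_def)
        have "diff ep e h = 0" if "e \<in> S" for e
          using diff_cong[OF ew(1) that, of h g] g that unfolding flat_iff_diff h_def by simp
        moreover define u :: "'a + 'a \<Rightarrow> bit" where "u = case_sum h (\<lambda>_. 0)"
        moreover from this have "u \<in> U" unfolding U_iff using h0 by simp
        moreover have "diff ep e (\<lambda>_. 0) = 0" for e by (simp add: diff_def)
        ultimately have "u = (\<lambda>_. 0)" using L by simp
        then have "h y = 0" unfolding u_def by (metis sum.case(1))
        then show "g y = 0" using y by (simp add: h_def)
      qed
      moreover have "pins ep V {p, q} (E - S)"
        unfolding pins_def
      proof (intro allI impI ballI)
        fix g y assume g: "flat ep (E - S) g \<and> (\<forall>x\<in>{p, q}. g x = 0)" and y: "y \<in> V"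
        define h where "h v = (if v \<in> V then g v else 0)" for v
        have h0: "v \<notin> V - {p, q} \<Longrightarrow> h v = 0" for v using g by (auto simp: h_def)
        have "diff ep e h = 0" if "e \<in> E - S" for e
          using diff_cong[OF ew(2) that, of h g] g that unfolding flat_iff_diff h_def by simp
        moreover define u :: "'a + 'a \<Rightarrow> bit" where "u = case_sum (\<lambda>_. 0) h"
        moreover from this have "u \<in> U" unfolding U_iff using h0 by simp
        moreover have "diff ep e (\<lambda>_. 0) = 0" for e by (simp add: diff_def)
        ultimately have "u = (\<lambda>_. 0)" using L by simp
        then have "h y = 0" unfolding u_def by (metis sum.case(2))
        then show "g y = 0" using y by (simp add: h_def)
      qed
      ultimately show "pins ep V {p} S \<and> pins ep V {p, q} (E - S)" ..
    next
      assume P: "pins ep V {p} S \<and> pins ep V {p, q} (E - S)"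
      show ?L
      proof (intro ballI impI)
        fix u assume u: "u \<in> U" and z: "(\<forall>e\<in>S. diff ep e (\<lambda>v. u (Inl v)) = 0) \<and>
          (\<forall>e\<in>E - S. diff ep e (\<lambda>v. u (Inr v)) = 0)"
        have "flat ep S (\<lambda>v. u (Inl v))" "flat ep (E - S) (\<lambda>v. u (Inr v))"
          using z unfolding flat_iff_diff by blast+
        moreover have "\<forall>x\<in>{p}. u (Inl x) = 0" "\<forall>x\<in>{p, q}. u (Inr x) = 0" using u unfolding U_iff by blast+
        ultimately have "\<forall>v\<in>V. u (Inl v) = 0" "\<forall>v\<in>V. u (Inr v) = 0"
          using P unfolding pins_def by blast+
        then show "u = (\<lambda>_. 0)" using u unfolding bit_sum_fun_eq_zero U_iff by blast
      qed
    qed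
    also have "\<dots> \<longleftrightarrow> ?R"
    proof
      assume P: "pins ep V {p} S \<and> pins ep V {p, q} (E - S)"
      have "card V \<le> 1 + card S" "card V \<le> 2 + card (E - S)"
        using pins_card[of ep V "{p}" S] pins_card[of ep V "{p, q}" "E - S"] P V ew finS by simp_all
      moreover have "card (E - S) = card E - card S" "card S \<le> card E"
        using S finS E(1) by (simp_all add: card_Diff_subset card_mono)
      ultimately have "card S + 1 = card V" "card (E - S) + 2 = card V" using E(3) by linarith+
      then show ?R using P span_tree_iff_pins[OF V(2)] tree2_iff_pins[OF V(2,3)] by blast
    next
      assume ?R
      then show "pins ep V {p} S \<and> pins ep V {p, q} (E - S)"
        using span_tree_iff_pins[OF V(2)] tree2_iff_pins[OF V(2,3)] by blast
    qed
    finally show ?thesis .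
  qed
  have "\<not> (\<forall>u\<in>U. (\<forall>e\<in>E. diff ep e (\<lambda>v. u (Inl v)) = diff ep e (\<lambda>v. u (Inr v))) \<longrightarrow> u = (\<lambda>_. 0))"
  proof -
    have "V - {p, q} \<noteq> {}"
    proof
      assume "V - {p, q} = {}"
      then have "card (V - {p, q}) = 0" by (simp only: card.empty)
      then show False using cV V(5) by linarith
    qed
    then obtain r where r: "r \<in> V" "r \<noteq> p" "r \<noteq> q" by blast
    define u where "u = case_sum (point r) (point r)"
    have "u \<in> U" unfolding U_iff using r by (auto simp: u_def point_def)
    moreover have "u (Inl r) = 1" by (simp add: u_def point_def)
    then have "u \<noteq> (\<lambda>_. 0)" by auto
    moreover have "\<forall>e\<in>E. diff ep e (\<lambda>v. u (Inl v)) = diff ep e (\<lambda>v. u (Inr v))" by (simp add: u_def)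
    ultimately show ?thesis by blast
  qed
  moreover have "{T \<in> Pow E. span_tree ep V T \<and> tree2 ep V p q (E - T)} =
      {S \<in> Pow E. \<forall>u\<in>U. (\<forall>e\<in>S. diff ep e (\<lambda>v. u (Inl v)) = 0) \<and>
      (\<forall>e\<in>E - S. diff ep e (\<lambda>v. u (Inr v)) = 0) \<longrightarrow> u = (\<lambda>_. 0)}"
    using trans by blast
  ultimately show ?thesis using parity by presburger
qed

text \<open>There is one edge more than a tree and a 2-forest contain, so a disjoint pair misses
  exactly one edge \<open>e\<close> and partitions \<open>E - {e}\<close>.\<close>

lemma even_disjoint_tree_forest:
  assumes V: "finite V" "p \<in> V" "q \<in> V" "p \<noteq> q" "3 \<le> card V"
    and E: "finite E" "edges_within ep V E" "card E + 2 = 2 * card V"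
  shows "even (card {s \<in> Pow E \<times> Pow E. span_tree ep V (fst s) \<and> tree2 ep V p q (snd s) \<and> fst s \<inter> snd s = {}})"
proof -
  define A where "A e = {T \<in> Pow (E - {e}). span_tree ep V T \<and> tree2 ep V p q (E - {e} - T)}" for e
  let ?f = "\<lambda>(e, T). (T, E - {e} - T)"
  have evA: "even (card (A e))" if "e \<in> E" for e
  proof -
    have "card (E - {e}) + 1 = card E" using that E(1) by (metis Suc_eq_plus1 card_Suc_Diff1)
    then show ?thesis
      unfolding A_def using V E(1,3) edges_within_mono[OF E(2), of "E - {e}"]
      by (intro even_tree_forest_partitions) auto
  qed
  have "{s \<in> Pow E \<times> Pow E. span_tree ep V (fst s) \<and> tree2 ep V p q (snd s) \<and> fst s \<inter> snd s = {}} =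
      ?f ` (SIGMA e:E. A e)" (is "?L = ?R")
  proof
    show "?L \<subseteq> ?R"
    proof
      fix s assume s: "s \<in> ?L"
      obtain T F where TF: "s = (T, F)" by fastforce
      have *: "T \<subseteq> E" "F \<subseteq> E" "span_tree ep V T" "tree2 ep V p q F" "T \<inter> F = {}" using s TF by auto
      have fin: "finite T" "finite F" using finite_subset[OF *(1) E(1)] finite_subset[OF *(2) E(1)] .
      have "card T + 1 = card V" "card F + 2 = card V"
        using *(3,4) unfolding span_tree_def tree2_def by auto
      moreover have "card (T \<union> F) = card T + card F"
        using * fin by (intro card_Un_disjoint) auto
      moreover have "card (E - (T \<union> F)) = card E - card (T \<union> F)"
        using * fin by (intro card_Diff_subset) auto
      ultimately have "card (E - (T \<union> F)) = 1" using E(3) by linarith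
      then obtain e where e: "E - (T \<union> F) = {e}" by (rule card_1_singletonE)
      then have "F = E - {e} - T" "T \<subseteq> E - {e}" "e \<in> E" using * by blast+
      then have "s = ?f (e, T)" "(e, T) \<in> (SIGMA e:E. A e)" using * TF unfolding A_def by auto
      then show "s \<in> ?R" by blast
    qed
  qed (auto simp: A_def)
  moreover have "inj_on ?f (SIGMA e:E. A e)"
  proof (rule inj_onI)
    fix x y assume xy: "x \<in> (SIGMA e:E. A e)" "y \<in> (SIGMA e:E. A e)" "?f x = ?f y"
    obtain e T e' T' where [simp]: "x = (e, T)" "y = (e', T')" by (cases x; cases y)
    have T: "T' = T" "e \<in> E" "e' \<in> E" "T \<subseteq> E - {e}" "T \<subseteq> E - {e'}" "E - {e} - T = E - {e'} - T"
      using xy by (auto simp: A_def)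
    then have "e = e'" by blast
    then show "x = y" using T by simp
  qed
  moreover have "card (SIGMA e:E. A e) = (\<Sum>e\<in>E. card (A e))"
    using E(1) by (intro card_SigmaI) (auto simp: A_def)
  ultimately show ?thesis using evA by (simp only: card_image dvd_sum)
qed

lemma add_mod_8_eq: "c mod 8 = 0 \<Longrightarrow> z mod 8 = (z + c) mod (8 :: nat)"
  by presburger

text \<open>Replacing the true count by one that ignores \<open>tree2\<close> errs by 4 for every
  \<open>Z\<close> with \<open>f0 = 0\<close> and \<open>d = 1\<close>. The number of such
  \<open>Z\<close> has the parity of the sum of \<open>d + f0 d\<close>, which is even.\<close>

lemma star2_counts:
  assumes base: "finite V" "w \<notin> V" "edges_within ep V E" "finite E" "V \<noteq> {}"
    and f: "f1 \<notin> E" "ep f1 = {w, p}" "p \<in> V" "f2 \<notin> E" "ep f2 = {w, q}" "q \<in> V" "f1 \<noteq> f2"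
    and cE: "card E + 2 = 2 * card V" and c3: "p \<noteq> q \<Longrightarrow> card V \<ge> 3"
  shows "zero_count ep (insert w V) (E \<union> {f1, f2}) mod 8 =
    (\<Sum>Z\<in>Pow E. if odd (above E (span_tree ep V) Z) then 2 else 4) mod 8"
proof -
  let ?t = "above E (span_tree ep V)" and ?d = "above E (tree2 ep V p q)"
  let ?B = "{Z \<in> Pow E. odd (?d Z + ?t Z * ?d Z)}"
  have nt: "\<not> tree2 ep V p q F" if "F \<subseteq> E" "p = q" for F
    using tree2_distinct[of ep V p q F] that base edges_within_mono[OF base(3)] finite_subset f(3) by blast
  have "(\<Sum>Z\<in>Pow E. if odd (?t Z) then 2 else 4) =
      (\<Sum>Z\<in>Pow E. (if odd (?t Z) then 2 else if odd (?d Z) then 0 else 4) + 4 * of_bool (odd (?d Z + ?t Z * ?d Z)) :: nat)"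
    by (rule sum.cong) auto
  also have "\<dots> = zero_count ep (insert w V) (E \<union> {f1, f2}) + 4 * card ?B"
    unfolding zero_count_star2[OF base f] sum.distrib sum_distrib_left[symmetric]
    using base(4) by (simp add: Int_def)
  finally have eq: "(\<Sum>Z\<in>Pow E. if odd (?t Z) then 2 else 4) =
      zero_count ep (insert w V) (E \<union> {f1, f2}) + 4 * card ?B" .
  have "even (\<Sum>Z\<in>Pow E. ?d Z)"
  proof (rule even_sum_above[OF base(4)], rule notI)
    assume t: "tree2 ep V p q {}"
    then have "p \<noteq> q" using nt by blast
    then show False using t c3 unfolding tree2_def by simp
  qed
  moreover have "even (\<Sum>Z\<in>Pow E. ?t Z * ?d Z)"
  proof (cases "p = q")
    case True
    then have "?d Z = 0" for Z
      using above_cong[of E "tree2 ep V p q" "\<lambda>_. False" Z] nt by (simp add: above_def)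
    then show ?thesis by simp
  next
    case False
    then show ?thesis
      using odd_sum_above_product[OF base(4), of "span_tree ep V" "tree2 ep V p q"]
        even_disjoint_tree_forest[OF base(1) f(3,6) False c3 base(4,3) cE] by blast
  qed
  ultimately have "even (\<Sum>Z\<in>Pow E. ?d Z + ?t Z * ?d Z)" by (simp add: sum.distrib)
  then have "even (card ?B)"
    using even_sum_iff[of "Pow E" "\<lambda>Z. ?d Z + ?t Z * ?d Z"] base(4) by simp
  then have "4 * card ?B mod 8 = 0" using four_mult_mod_8_cong[of "card ?B" 0] by simp
  then show ?thesis unfolding eq by (rule add_mod_8_eq)
qed

section \<open>Two adjacent vertices without common neighbours\<close>

locale quartic_edge =
  fixes ep :: "'e \<Rightarrow> 'v set" and V :: "'v set" and E :: "'e set" and v w :: 'v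
  assumes quartic: "quartic ep V E" and vw: "v \<in> V" "w \<in> V" "v \<noteq> w"
    and no_loop: "\<And>e. e \<in> E \<Longrightarrow> ep e \<noteq> {v}" "\<And>e. e \<in> E \<Longrightarrow> ep e \<noteq> {w}"
    and apart: "\<And>e f u. e \<in> E \<Longrightarrow> f \<in> E \<Longrightarrow> ep e = {v, u} \<Longrightarrow> ep f = {w, u} \<Longrightarrow> False"
begin

definition "inner_vertices = V - {v, w}"
definition "inner_edges = {e \<in> E. v \<notin> ep e \<and> w \<notin> ep e}"
definition "joining = {e \<in> E. ep e = {v, w}}"
definition "star = {e \<in> E. w \<in> ep e \<and> v \<notin> ep e}"

lemma fin: "finite V" "finite E" and ew: "edges_within ep V E"
  using quartic by (auto simp: quartic_def)

lemma ends_cases: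
  assumes "e \<in> E" "u \<in> ep e"
  obtains u' where "u' \<in> V" "ep e = {u, u'}"
proof -
  obtain p q where "p \<in> V" "q \<in> V" "ep e = {p, q}" using ew assms(1) unfolding edges_within_def by blast
  then show thesis using assms(2) that[of p] that[of q] by (auto simp: insert_commute)
qed

lemma star_ends:
  assumes "f \<in> star"
  shows "\<exists>u. ep f = {w, u} \<and> u \<in> inner_vertices"
proof -
  have f: "f \<in> E" "w \<in> ep f" "v \<notin> ep f" using assms by (auto simp: star_def)
  from f(1,2) obtain u where u: "u \<in> V" "ep f = {w, u}" by (rule ends_cases)
  then show ?thesis using f no_loop(2)[OF f(1)] unfolding inner_vertices_def by auto
qed

lemma card_star: "card star + card joining = 4"
proof -
  have "{e \<in> E. w \<in> ep e} = star \<union> joining"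
  proof
    show "{e \<in> E. w \<in> ep e} \<subseteq> star \<union> joining"
    proof
      fix e assume e: "e \<in> {e \<in> E. w \<in> ep e}"
      show "e \<in> star \<union> joining"
      proof (cases "v \<in> ep e")
        case True
        have "e \<in> E" using e by blast
        then obtain u where "ep e = {v, u}" using ends_cases[OF _ True] by blast
        then have "ep e = {v, w}" using e vw by auto
        then show ?thesis using e by (simp add: joining_def)
      qed (use e in \<open>simp add: star_def\<close>)
    qed
  qed (auto simp: star_def joining_def)
  moreover have "star \<inter> joining = {}" by (auto simp: star_def joining_def)
  moreover have "card {e \<in> E. w \<in> ep e} = 4"
  proof -
    have "4 = (\<Sum>e\<in>E. incidences ep e w)" using quartic vw by (simp add: quartic_def)
    also have "\<dots> = (\<Sum>e\<in>E. of_bool (w \<in> ep e))"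
      by (rule sum.cong) (use no_loop in \<open>auto simp: incidences_def\<close>)
    also have "\<dots> = card {e \<in> E. w \<in> ep e}" using fin by (simp add: Int_def)
    finally show ?thesis by simp
  qed
  moreover have "finite star" "finite joining" using fin by (simp_all add: star_def joining_def)
  ultimately show ?thesis using card_Un_disjoint[of star joining] by simp
qed

lemma avoiding_eq: "avoiding ep E v = inner_edges \<union> star"
  by (auto simp: avoiding_def inner_edges_def star_def)

lemma vertices_eq: "V - {v} = insert w inner_vertices"
  using vw by (auto simp: inner_vertices_def)

lemma disjoint: "inner_edges \<inter> star = {}" "finite inner_edges" "finite star"
  using fin by (auto simp: inner_edges_def star_def)

lemma card_inner: "card inner_edges + 4 = 2 * card inner_vertices + card joining"
proof -
  have "{e \<in> E. ep e = {v}} = {}" using no_loop by blast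
  then have "card {e \<in> E. ep e = {v}} = 0" by (simp only: card.empty)
  then have "card (avoiding ep E v) + 4 = 2 * card V"
    using card_avoiding[OF quartic vw(1)] by linarith
  moreover have "card (avoiding ep E v) = card inner_edges + card star"
    unfolding avoiding_eq using disjoint by (simp add: card_Un_disjoint)
  moreover have "card V = card inner_vertices + 2"
  proof -
    have "V = insert v (insert w inner_vertices)" using vw by (auto simp: inner_vertices_def)
    then have "card V = card (insert v (insert w inner_vertices))" by (rule arg_cong)
    moreover have "v \<notin> insert w inner_vertices" "w \<notin> inner_vertices" "finite inner_vertices"
      using vw fin by (auto simp: inner_vertices_def)
    then have "card (insert v (insert w inner_vertices)) = card inner_vertices + 2" by simp
    ultimately show ?thesis by (rule trans)
  qed
  ultimately show ?thesis using card_star by linarith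
qed

lemma base: "finite inner_vertices" "w \<notin> inner_vertices" "edges_within ep inner_vertices inner_edges" "finite inner_edges"
proof -
  show "edges_within ep inner_vertices inner_edges"
    unfolding edges_within_def
  proof
    fix e assume e: "e \<in> inner_edges"
    then obtain p q where "p \<in> V" "q \<in> V" "ep e = {p, q}"
      using ew unfolding edges_within_def inner_edges_def by blast
    moreover from this e have "p \<noteq> v" "q \<noteq> v" "p \<noteq> w" "q \<noteq> w" by (auto simp: inner_edges_def)
    ultimately show "\<exists>p\<in>inner_vertices. \<exists>q\<in>inner_vertices. ep e = {p, q}"
      unfolding inner_vertices_def by blast
  qed
qed (use fin in \<open>auto simp: inner_vertices_def inner_edges_def\<close>)

lemma opposite: "quartic_edge ep V E w v"
proof
  show "quartic ep V E" "w \<in> V" "v \<in> V" "w \<noteq> v" using quartic vw by auto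
  show "ep e \<noteq> {w}" "ep e \<noteq> {v}" if "e \<in> E" for e using no_loop[OF that] by auto
  show False if "e \<in> E" "f \<in> E" "ep e = {w, u}" "ep f = {v, u}" for e f u
    using apart[OF that(2,1,4,3)] .
qed

text \<open>Since \<open>v\<close> has a neighbour that is not a neighbour of \<open>w\<close>, two distinct neighbours of \<open>w\<close>
  leave room for a third inner vertex.\<close>

lemma three_inner_vertices:
  assumes j: "card joining < 4" and p: "f \<in> star" "ep f = {w, p}" "g \<in> star" "ep g = {w, q}" "p \<noteq> q"
  shows "3 \<le> card inner_vertices"
proof -
  interpret opp: quartic_edge ep V E w v by (rule opposite)
  have "opp.joining = joining" unfolding opp.joining_def joining_def by (simp add: insert_commute)
  then have "card opp.joining = card joining" by (rule arg_cong)
  then have "card opp.star > 0" using opp.card_star j by linarith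
  then obtain h where h: "h \<in> opp.star" by (auto simp: card_gt_0_iff)
  then obtain u where u: "ep h = {v, u}" "u \<in> opp.inner_vertices" using opp.star_ends by blast
  have E: "h \<in> E" "f \<in> E" "g \<in> E" using h p by (auto simp: opp.star_def star_def)
  have "u \<noteq> p" "u \<noteq> q" using apart[OF E(1,2), of p] apart[OF E(1,3), of q] u(1) p by auto
  moreover have "p \<in> inner_vertices" "q \<in> inner_vertices"
    using star_ends[OF p(1)] star_ends[OF p(3)] p vw base(2) by (auto simp: doubleton_eq_iff)
  moreover have "u \<in> inner_vertices" using u(2) by (simp add: opp.inner_vertices_def inner_vertices_def insert_commute)
  ultimately have "{u, p, q} \<subseteq> inner_vertices" "card {u, p, q} = 3" using p(5) by auto
  then show ?thesis using card_mono[OF base(1)] by metis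
qed

text \<open>Only the inner graph, the number of joining edges and \<open>N\<close> enter, so
  exchanging \<open>v\<close> and \<open>w\<close> leaves it unchanged. The last branch is the case
  of four joining edges.\<close>

definition residue :: "nat \<Rightarrow> nat" where
  "residue N =
    (if card joining = 1 then 4 * ((\<Sum>Z\<in>Pow inner_edges. above inner_edges (span_tree ep inner_vertices) Z) + N)
     else if card joining = 2 then
       (\<Sum>Z\<in>Pow inner_edges. if odd (above inner_edges (span_tree ep inner_vertices) Z) then 2 else 4)
     else if card joining = 3 then
       (\<Sum>Z\<in>Pow inner_edges. if odd (above inner_edges (span_tree ep inner_vertices) Z) then 0 else 2)
     else card {Z \<in> Pow inner_edges. even (above inner_edges
       (\<lambda>T. card T = card inner_vertices \<and> pins ep inner_vertices {} T) Z)})"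

lemma zero_count_residue:
  assumes "joining \<noteq> {}"
  shows "zero_count ep (V - {v}) (avoiding ep E v) mod 8 = residue (pairs_without ep V E v div 4) mod 8"
proof -
  have finJ: "finite joining" using fin by (simp add: joining_def)
  have nI: "f \<notin> inner_edges" if "f \<in> star" for f using that disjoint(1) by blast
  have "\<forall>f\<in>star. \<exists>u. ep f = {w, u} \<and> u \<in> inner_vertices" using star_ends by blast
  then obtain \<nu> where \<nu>: "\<And>f. f \<in> star \<Longrightarrow> ep f = {w, \<nu> f}" "\<And>f. f \<in> star \<Longrightarrow> \<nu> f \<in> inner_vertices"
    by metis
  have "card joining > 0" using assms finJ by (simp add: card_gt_0_iff)
  then consider "card joining = 1" | "card joining = 2" | "card joining = 3" | "card joining = 4"
    using card_star by linarith
  then show ?thesis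
  proof cases
    case 1
    then have "card star = 3" using card_star by linarith
    then obtain f1 f2 f3 where f: "star = {f1, f2, f3}" "f1 \<noteq> f2" "f2 \<noteq> f3" "f1 \<noteq> f3"
      by (auto simp: card_3_iff)
    have s: "f1 \<in> star" "f2 \<in> star" "f3 \<in> star" using f(1) by auto
    have ne: "inner_vertices \<noteq> {}" using \<nu>(2)[OF s(1)] by blast
    have j: "card joining < 4" using 1 by simp
    have "card inner_edges + 3 = 2 * card inner_vertices" using card_inner 1 by linarith
    moreover have "\<nu> f1 \<noteq> \<nu> f2 \<or> \<nu> f1 \<noteq> \<nu> f3 \<Longrightarrow> 3 \<le> card inner_vertices"
      using three_inner_vertices[OF j s(1) \<nu>(1)[OF s(1)] s(2) \<nu>(1)[OF s(2)]]
        three_inner_vertices[OF j s(1) \<nu>(1)[OF s(1)] s(3) \<nu>(1)[OF s(3)]] by blast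
    ultimately obtain N where
      N: "tree_pairs ep (insert w inner_vertices) (inner_edges \<union> {f1, f2, f3}) = 4 * N"
        "zero_count ep (insert w inner_vertices) (inner_edges \<union> {f1, f2, f3}) mod 8 =
          4 * ((\<Sum>Z\<in>Pow inner_edges. above inner_edges (span_tree ep inner_vertices) Z) + N) mod 8"
      using star3_counts[OF base ne \<nu>(2)[OF s(1)] \<nu>(2)[OF s(2)] \<nu>(2)[OF s(3)] nI[OF s(1)] \<nu>(1)[OF s(1)]
          nI[OF s(2)] \<nu>(1)[OF s(2)] nI[OF s(3)] \<nu>(1)[OF s(3)] f(2,4,3)] by blast
    \<comment> \<open>The number \<open>N\<close> is obtained from the edges at \<open>w\<close>
      alone; expressing it by \<open>pairs_without\<close> makes it comparable with the one obtained
      from the edges at \<open>v\<close>.\<close>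
    then have "pairs_without ep V E v div 4 = N"
      unfolding pairs_without_def vertices_eq avoiding_eq f(1) by simp
    then show ?thesis using N(2) unfolding residue_def vertices_eq avoiding_eq f(1) 1 by simp
  next
    case 2
    then have "card star = 2" using card_star by linarith
    then obtain f1 f2 where f: "star = {f1, f2}" "f1 \<noteq> f2" by (auto simp: card_2_iff)
    have s: "f1 \<in> star" "f2 \<in> star" using f(1) by auto
    have ne: "inner_vertices \<noteq> {}" using \<nu>(2)[OF s(1)] by blast
    have j: "card joining < 4" using 2 by simp
    have "card inner_edges + 2 = 2 * card inner_vertices" using card_inner 2 by linarith
    moreover have "\<nu> f1 \<noteq> \<nu> f2 \<Longrightarrow> 3 \<le> card inner_vertices"
      using three_inner_vertices[OF j s(1) \<nu>(1)[OF s(1)] s(2) \<nu>(1)[OF s(2)]] .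
    ultimately have "zero_count ep (insert w inner_vertices) (inner_edges \<union> {f1, f2}) mod 8 =
      (\<Sum>Z\<in>Pow inner_edges. if odd (above inner_edges (span_tree ep inner_vertices) Z) then 2 else 4) mod 8"
      by (rule star2_counts[OF base ne nI[OF s(1)] \<nu>(1)[OF s(1)] \<nu>(2)[OF s(1)]
            nI[OF s(2)] \<nu>(1)[OF s(2)] \<nu>(2)[OF s(2)] f(2)])
    then show ?thesis unfolding residue_def vertices_eq avoiding_eq f(1) 2 by simp
  next
    case 3
    then have "card star = 1" using card_star by linarith
    then obtain f1 where f: "star = {f1}" by (rule card_1_singletonE)
    have s: "f1 \<in> star" using f(1) by auto
    have ne: "inner_vertices \<noteq> {}" using \<nu>(2)[OF s] by blast
    show ?thesis
      using zero_count_star1[OF base ne nI[OF s] \<nu>(1)[OF s] \<nu>(2)[OF s]]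
      unfolding residue_def vertices_eq avoiding_eq f(1) 3 by simp
  next
    case 4
    then have "star = {}" using card_star disjoint(3) by simp
    \<comment> \<open>All four edges at \<open>w\<close> end at \<open>v\<close>, so
      \<open>w\<close> is isolated after the deletion and the condition is one on the inner
      graph.\<close>
    moreover have "span_tree ep (insert w inner_vertices) T \<longleftrightarrow> card T = card inner_vertices \<and> pins ep inner_vertices {} T"
      if "T \<subseteq> inner_edges" for T
      using span_tree_star[OF base(1,2) edges_within_mono[OF base(3) that] finite_subset[OF that base(4)] finite.emptyI]
      by simp
    then have "above inner_edges (span_tree ep (insert w inner_vertices)) Z =
        above inner_edges (\<lambda>T. card T = card inner_vertices \<and> pins ep inner_vertices {} T) Z" for Z
      by (rule above_cong)
    ultimately show ?thesis
      unfolding residue_def vertices_eq avoiding_eq zero_count_def 4 by simp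
  qed
qed

end

lemma zero_count_symmetric:
  assumes "quartic_edge ep V E v w" "e \<in> E" "ep e = {v, w}"
  shows "zero_count ep (V - {v}) (avoiding ep E v) mod 8 = zero_count ep (V - {w}) (avoiding ep E w) mod 8"
proof -
  interpret quartic_edge ep V E v w by (rule assms(1))
  interpret opp: quartic_edge ep V E w v by (rule opposite)
  have j: "opp.joining = joining" unfolding opp.joining_def joining_def by (simp add: insert_commute)
  have "opp.inner_edges = inner_edges" "opp.inner_vertices = inner_vertices"
    unfolding opp.inner_edges_def inner_edges_def opp.inner_vertices_def inner_vertices_def by auto
  then have "opp.residue N = residue N" for N unfolding opp.residue_def residue_def j by simp
  moreover have "joining \<noteq> {}" using assms(2,3) by (auto simp: joining_def)
  moreover have "pairs_without ep V E v = pairs_without ep V E w"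
    by (rule pairs_without_independent[OF quartic vw(1,2)])
  ultimately show ?thesis using zero_count_residue opp.zero_count_residue j by simp
qed

section \<open>Return to multigraphs and to the invariant\<close>

lemma quartic_if_regular:
  assumes "finite_multigraph G" "regular_graph 4 G"
  shows "quartic (ends G) (vertices G) (edges G)"
proof -
  have fin: "finite (edges G)" using assms(1) by (simp add: finite_multigraph_def)
  have "(\<Sum>e\<in>edges G. incidences (ends G) e y) = vertex_degree G y" for y
    using fin by (simp add: incidences_def vertex_degree_def sum.distrib Int_def)
  then show ?thesis
    using assms finite_multigraph_edges_within[OF assms(1)]
    by (simp add: quartic_def finite_multigraph_def regular_graph_def)
qed

lemma point_count_delete_vertex:
  assumes "finite_multigraph G"
  shows "point_count TYPE(bit) (delete_vertex G v) =
    zero_count (ends G) (vertices G - {v}) (avoiding (ends G) (edges G) v)"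
proof -
  let ?H = "delete_vertex G v"
  have H: "vertices ?H = vertices G - {v}" "edges ?H = avoiding (ends G) (edges G) v" "ends ?H = ends G"
    by (simp_all add: delete_vertex_def avoiding_def)
  have "finite_multigraph ?H"
    unfolding finite_multigraph_def H
    using edges_within_avoiding[OF finite_multigraph_edges_within[OF assms], of v] assms
    unfolding edges_within_def by (auto simp: finite_multigraph_def avoiding_def)
  from point_count_bit_eq[OF this] show ?thesis
    unfolding zero_count_def above_def H .
qed

text \<open>For q = 2 the invariant is the binary digit of weight 4 of the point count, hence
  determined modulo 8.\<close>

lemma div_4_mod_2_cong: "x mod 8 = y mod 8 \<Longrightarrow> x div 4 mod 2 = y div 4 mod (2 :: nat)"
proof -
  have *: "z mod 8 div 4 = z div 4 mod 2" for z :: nat using mod_mult2_eq[of z 4 2] by simp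
  assume "x mod 8 = y mod 8"
  then show ?thesis unfolding *[symmetric] by (rule arg_cong)
qed

lemma card_bit: "CARD(bit) = 2"
proof -
  have "(UNIV :: bit set) = {0, 1}" by (auto intro: bit.exhaust)
  then have "CARD(bit) = card {0, 1 :: bit}" by (rule arg_cong)
  then show ?thesis by simp
qed

theorem mainTheorem3:
  fixes G :: "('v, 'e) multigraph" and v w :: 'v
  assumes "finite_multigraph G"
    and "connected_graph G"
    and "regular_graph 4 G"
    and "v \<in> vertices G" and "w \<in> vertices G"
    and "adjacent G v w"
    and "\<not> (\<exists>x\<in>vertices G. adjacent G v x \<and> adjacent G w x)"
  shows "c2 TYPE(bit) (delete_vertex G v) = c2 TYPE(bit) (delete_vertex G w)"
proof -
  obtain e where e: "e \<in> edges G" "ends G e = {v, w}" using assms(6) unfolding adjacent_def by blast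
  have adj: "adjacent G w v" using assms(6) by (simp add: adjacent_def insert_commute)
  \<comment> \<open>A vertex with a loop is its own neighbour, so a loop at \<open>v\<close> or
    \<open>w\<close> would make that vertex a common neighbour.\<close>
  have no_v: "\<not> adjacent G v v" and no_w: "\<not> adjacent G w w"
    using assms(4-7) adj by blast+
  have common: False if "f \<in> edges G" "g \<in> edges G" "ends G f = {v, u}" "ends G g = {w, u}" for f g u
  proof -
    obtain p q where "p \<in> vertices G" "q \<in> vertices G" "ends G f = {p, q}"
      using \<open>f \<in> edges G\<close> finite_multigraph_edges_within[OF assms(1)] unfolding edges_within_def by blast
    moreover have "u \<in> ends G f" using that(3) by simp
    ultimately have "u \<in> vertices G" by auto
    then show False using assms(7) that unfolding adjacent_def by blast
  qed
  have qe: "quartic_edge (ends G) (vertices G) (edges G) v w"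
  proof
    show "quartic (ends G) (vertices G) (edges G)" by (rule quartic_if_regular[OF assms(1,3)])
    show "v \<noteq> w" using no_v assms(6) by blast
    show "ends G f \<noteq> {v}" "ends G f \<noteq> {w}" if "f \<in> edges G" for f
      using no_v no_w that unfolding adjacent_def by auto
  qed (use assms(4,5) common in auto)
  have "(2::nat) ^ 2 = 4" by simp
  then show ?thesis
    unfolding c2_def point_count_delete_vertex[OF assms(1)] card_bit
    by (simp only: div_4_mod_2_cong[OF zero_count_symmetric[OF qe e]])
qed

end
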